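(* Let $N\ge 2$ and $1<p<N^*$, where $N^*=(N+2)/(N-2)$ if $N\ge3$ and $N^*=\infty$ if $N=2$. Let $\nu_k=k(k+N-1)$ and $\lambda_k:=\nu_k/(p-1)$ for integers $k\ge1$. Then for each $k\ge1$ and each $\lambda$ with $\lambda_k<\lambda\le\lambda_{k+1}$, the equation $$-\Delta_{\mathbb S^N}v=v^p-\lambda v\quad\text{and}\quad v>0\quad\text{on }\mathbb S^N$$ has $k$ distinct non-constant solutions $v_1,\dots,v_k$ such that $v_j-\lambda^{1/(p-1)}\in\mathcal S_j$ for $1\le j\le k$.
   Context: $\mathbb S^N\subset\mathbb R^{N+1}$ is the unit sphere with its standard metric and $\Delta_{\mathbb S^N}$ its Laplace–Beltrami operator. Let $G$ be the subgroup of the orthogonal group $O(N+1)$ consisting of the elements which fix $\mathbf e_{N+1}=(0,\dots,0,1)$. A function $v$ on $\mathbb S^N$ is $G$-invariant if $v(O\theta)=v(\theta)$ for all $\theta\in\mathbb S^N$, $O\in G$; such $v$ can be written $v(\theta)=\tilde v(\theta_{N+1})$ for a function $\tilde v$ on $[-1,1]$, where $\theta_{N+1}$ is the last coordinate of $\theta$. Fix $0<\alpha<1$; $C^{2,\alpha}_G(\mathbb S^N)$ is the space of $G$-invariant functions in the Hölder space $C^{2,\alpha}(\mathbb S^N)$. For each $k$, $$\mathcal S_k:=\{v\in C^{2,\alpha}_G(\mathbb S^N):\ \tilde v\text{ has exactly }k\text{ zeroes, all of them are in }(-1,1)\text{ and are simple}\}.$$ *)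

theory Defs
  imports "HOL-Analysis.Analysis"
begin

text \<open>
  The sphere is \<open>sphere 0 1\<close>, and a function on it is a total function on the ambient Euclidean
  space of which only the values on \<open>sphere 0 1\<close> matter.  All derivatives are taken within the
  sphere, so no extension off the sphere is involved.
\<close>

text \<open>
  The derivative within the sphere is determined only on the tangent space, the orthogonal
  complement of \<open>\<theta>\<close>; it is extended by 0 in the normal direction, which makes it unique
  (lemma \<open>sphere_differential_eqI\<close>).
\<close>

definition sphere_differential ::
    "('a::euclidean_space \<Rightarrow> 'b::real_normed_vector) \<Rightarrow> 'a \<Rightarrow> 'a \<Rightarrow> 'b" where
  "sphere_differential f \<theta> =
     (THE D. (f has_derivative D) (at \<theta> within sphere 0 1) \<and> D \<theta> = 0)"

definition sphere_grad :: "('a::euclidean_space \<Rightarrow> real) \<Rightarrow> 'a \<Rightarrow> 'a" where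
  "sphere_grad v \<theta> = (THE g. \<forall>h. g \<bullet> h = sphere_differential v \<theta> h)"

text \<open>
  The divergence of a tangent field \<open>X\<close> is the trace of its covariant derivative on the tangent
  space.  For the induced metric the covariant derivative is the tangential part of the ambient
  one.  Since the differential vanishes on \<open>\<theta>\<close>, the trace over the whole ambient space
  is the trace over the tangent space, and only the tangential part contributes.
\<close>

definition sphere_div :: "('a::euclidean_space \<Rightarrow> 'a) \<Rightarrow> 'a \<Rightarrow> real" where
  "sphere_div X \<theta> = (\<Sum>b\<in>Basis. sphere_differential X \<theta> b \<bullet> b)"

definition sphere_laplacian :: "('a::euclidean_space \<Rightarrow> real) \<Rightarrow> 'a \<Rightarrow> real" where
  "sphere_laplacian v \<theta> = sphere_div (sphere_grad v) \<theta>"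

text \<open>
  The Hoelder space of order (2, \<open>\<alpha>\<close>) on the sphere; by compactness, the Hoelder estimate for the
  second derivative gives continuity and boundedness of all derivatives up to order two.
\<close>

definition sphere_C2_holder :: "real \<Rightarrow> ('a::euclidean_space \<Rightarrow> real) set" where
  "sphere_C2_holder \<alpha> =
     {v. (\<forall>\<theta>\<in>sphere 0 1. v differentiable (at \<theta> within sphere 0 1)) \<and>
         (\<forall>\<theta>\<in>sphere 0 1. sphere_grad v differentiable (at \<theta> within sphere 0 1)) \<and>
         (\<exists>C. \<forall>\<theta>\<in>sphere 0 1. \<forall>\<eta>\<in>sphere 0 1. \<forall>h.
            norm (sphere_differential (sphere_grad v) \<theta> h
                  - sphere_differential (sphere_grad v) \<eta> h)
              \<le> C * dist \<theta> \<eta> powr \<alpha> * norm h)}"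

text \<open>
  With \<open>N = CARD('n)\<close>, the ambient space of dimension \<open>N + 1\<close> is \<open>(real ^ 'n) \<times> real\<close> (with the
  Euclidean inner product): the last coordinate of \<open>\<theta>\<close> is \<open>snd \<theta>\<close> and the last unit vector is
  \<open>(0, 1)\<close>.
\<close>

definition axis_group :: "((real ^ 'n) \<times> real \<Rightarrow> (real ^ 'n) \<times> real) set" where
  "axis_group = {T. orthogonal_transformation T \<and> T (0, 1) = (0, 1)}"

definition sphere_C2_holder_inv :: "real \<Rightarrow> ((real ^ 'n) \<times> real \<Rightarrow> real) set" where
  "sphere_C2_holder_inv \<alpha> =
     {v \<in> sphere_C2_holder \<alpha>. \<forall>T\<in>axis_group. \<forall>\<theta>\<in>sphere 0 1. v (T \<theta>) = v \<theta>}"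

text \<open>
  The function \<open>w\<close> below is uniquely determined on \<open>{-1..1}\<close> by \<open>v\<close>.
\<close>

definition nodal_set :: "real \<Rightarrow> nat \<Rightarrow> ((real ^ 'n) \<times> real \<Rightarrow> real) set" where
  "nodal_set \<alpha> k =
     {v \<in> sphere_C2_holder_inv \<alpha>.
        \<exists>w :: real \<Rightarrow> real.
          (\<forall>\<theta>\<in>sphere 0 1. v \<theta> = w (snd \<theta>)) \<and>
          finite {t \<in> {-1..1}. w t = 0} \<and>
          card {t \<in> {-1..1}. w t = 0} = k \<and>
          (\<forall>t\<in>{-1..1}. w t = 0 \<longrightarrow>
             t \<in> {-1<..<1} \<and> (\<exists>d. d \<noteq> 0 \<and> (w has_real_derivative d) (at t)))}"

definition crit_exponent :: "nat \<Rightarrow> ereal" where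
  "crit_exponent N = (if N = 2 then \<infinity> else ereal ((real N + 2) / (real N - 2)))"

definition nu :: "nat \<Rightarrow> nat \<Rightarrow> real" where
  "nu N k = real k * (real k + real N - 1)"

definition lambda_crit :: "nat \<Rightarrow> real \<Rightarrow> nat \<Rightarrow> real" where
  "lambda_crit N p k = nu N k / (p - 1)"

lemma sphere_differential_unique_aux:
  fixes f :: "'a::euclidean_space \<Rightarrow> 'b::real_normed_vector"
  assumes \<theta>: "norm \<theta> = 1"
    and D: "(f has_derivative D) (at \<theta> within sphere 0 1)" "D \<theta> = 0"
    and E: "(f has_derivative E) (at \<theta> within sphere 0 1)" "E \<theta> = 0"
  shows "D = E"
proof
  have unit: "D h = E h" if h: "norm h = 1" "\<theta> \<bullet> h = 0" for h
  proof -
    define c where "c = (\<lambda>t::real. cos t *\<^sub>R \<theta> + sin t *\<^sub>R h)"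
    have c_sphere: "c ` UNIV \<subseteq> sphere 0 1"
    proof clarsimp
      fix t
      have "(norm (c t))\<^sup>2 = (cos t)\<^sup>2 * (norm \<theta>)\<^sup>2 + (sin t)\<^sup>2 * (norm h)\<^sup>2"
        using h(2) by (simp add: c_def power2_norm_eq_inner inner_commute algebra_simps
            power2_eq_square[of "cos t"] power2_eq_square[of "sin t"])
      also have "\<dots> = 1"
        by (simp add: \<theta> h(1))
      finally show "norm (c t) = 1"
        by (metis norm_ge_zero one_power2 power2_eq_iff_nonneg zero_le_one)
    qed
    have c0: "c 0 = \<theta>"
      by (simp add: c_def)
    have c_deriv: "(c has_derivative (\<lambda>s. s *\<^sub>R h)) (at 0)"
      unfolding c_def by (auto intro!: derivative_eq_intros)
    have chain: "((f \<circ> c) has_derivative (F \<circ> (\<lambda>s. s *\<^sub>R h))) (at 0)"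
      if "(f has_derivative F) (at \<theta> within sphere 0 1)" for F
    proof (rule diff_chain_within[OF c_deriv])
      show "(f has_derivative F) (at (c 0) within range c)"
        unfolding c0 using that c_sphere by (rule has_derivative_subset)
    qed
    have "D \<circ> (\<lambda>s. s *\<^sub>R h) = E \<circ> (\<lambda>s. s *\<^sub>R h)"
      using chain[OF D(1)] chain[OF E(1)] by (rule has_derivative_unique)
    then show ?thesis
      by (metis comp_apply scaleR_one)
  qed
  fix x
  interpret D: bounded_linear D by (rule has_derivative_bounded_linear[OF D(1)])
  interpret E: bounded_linear E by (rule has_derivative_bounded_linear[OF E(1)])
  define y where "y = x - (\<theta> \<bullet> x) *\<^sub>R \<theta>"
  have y: "\<theta> \<bullet> y = 0"
    using \<theta> by (simp add: y_def inner_diff_right dot_square_norm)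
  have "D y = E y"
  proof (cases "y = 0")
    case True
    then show ?thesis by (simp add: D.zero E.zero)
  next
    case False
    then have "D (inverse (norm y) *\<^sub>R y) = E (inverse (norm y) *\<^sub>R y)"
      using y by (intro unit) auto
    then show ?thesis
      using False by (simp add: D.scaleR E.scaleR)
  qed
  then show "D x = E x"
    by (simp add: y_def D.diff E.diff D.scaleR E.scaleR D(2) E(2))
qed

lemma sphere_differential_eqI:
  fixes f :: "'a::euclidean_space \<Rightarrow> 'b::real_normed_vector"
  assumes "norm \<theta> = 1" "(f has_derivative D) (at \<theta> within sphere 0 1)" "D \<theta> = 0"
  shows "sphere_differential f \<theta> = D"
  unfolding sphere_differential_def
  using assms by (blast intro: the_equality sphere_differential_unique_aux)

end

theory Submission imports Defs begin

text \<open>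
  A solution \<open>v \<theta> = W t\<close> depending only on the last coordinate \<open>t\<close> satisfies
  \<open>(1 - t\<^sup>2) W'' - N t W' + W\<^sup>p - lam W = 0\<close> (\<open>laplacian_axial\<close>).  On each hemisphere, with \<open>r = 1 - \<bar>t\<bar>\<close>
  measured from the pole, this is \<open>r (2 - r) y'' + N (1 - r) y' + f y = 0\<close>.  It is singular at the pole, and
  for each starting value at the pole there is one regular solution, which depends continuously on that value
  (\<open>shooting_family\<close>).  Two such solutions, shot from the two poles, form a solution on the sphere if and
  only if on the equator their values agree and their slopes are opposite.

  Let \<open>c\<close> be the constant solution \<open>lam powr (1 / (p - 1))\<close>.  The point
  \<open>(y - c, - sqrt (r (2 - r)) y')\<close> never meets the origin, unless \<open>y\<close> is constant, and crosses the vertical axis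
  counterclockwise only (\<open>phase_angle_crossing\<close>).  So if the angles through which two matching solutions turn add up
  to \<open>j * pi\<close>, the glued function minus \<open>c\<close> has exactly \<open>j\<close> zeros, all of them simple
  (\<open>glued_zero_count\<close>).

  For starting values near \<open>c\<close> the angle is close to that of the linearized
  equation with coefficient \<open>(p - 1) lam\<close>.  As this exceeds the eigenvalue \<open>nu N j\<close>, Sturm comparison with the zonal
  polynomials shows that the angle exceeds \<open>j * pi / 2\<close> (\<open>linear_rotation\<close>).  When the starting value tends to 0
  the angle tends to 0.  The energy \<open>r (2 - r) y'\<^sup>2 / 2 + F y\<close>, with \<open>F' = f\<close> and \<open>F 0 = 0\<close>, decreases
  towards the equator; where it is negative \<open>y\<close> is positive.  Solutions starting below \<open>c\<close> have negative energy
  throughout.  This is where subcriticality enters: a Pohozaev quantity, which would have to be both large and bounded,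
  shows that a solution with large starting value cannot stay positive (\<open>reaches_zero\<close>).  Therefore there is a
  first starting value above \<open>c\<close> for which the energy on the equator is 0; below this value solutions are
  positive, and at this value the angle is less than \<open>pi\<close>.

  For even \<open>j\<close> the intermediate value theorem yields a starting value below \<open>c\<close> with angle
  \<open>j * pi / 2\<close>; that solution matches its own reflection.  For odd \<open>j\<close> one solution starts below \<open>c\<close> and the other
  above it.  Energy increases along rays from the rest state \<open>(c, 0)\<close>, so it suffices that the
  energies on the equator agree and the angles add up to \<open>j * pi\<close>.  These are two equations for two starting
  values in a rectangle, on whose sides the signs are known; Brouwer's theorem provides a solution
  (\<open>matched_branches\<close>).
\<close>

section \<open>Axially symmetric functions on the sphere\<close>

text \<open>
  On the sphere \<open>x \<bullet> x - 1\<close> vanishes, so subtracting \<open>(x \<bullet> x - 1) / 2\<close> times a constant does not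
  change the function there; the constant \<open>D \<theta>\<close> makes the derivative vanish in the normal direction,
  as the definition of \<^const>\<open>sphere_differential\<close> asks.
\<close>

lemma sphere_differential_tangential:
  fixes f :: "'a::euclidean_space \<Rightarrow> 'b::real_normed_vector"
  assumes \<theta>: "norm \<theta> = 1" and D: "(f has_derivative D) (at \<theta> within sphere 0 1)"
  shows "sphere_differential f \<theta> = (\<lambda>h. D h - (\<theta> \<bullet> h) *\<^sub>R D \<theta>)"
proof (rule sphere_differential_eqI[OF \<theta>])
  have "((\<lambda>x. f x - ((x \<bullet> x - 1) / 2) *\<^sub>R D \<theta>) has_derivative
      (\<lambda>h. D h - (\<theta> \<bullet> h) *\<^sub>R D \<theta>)) (at \<theta> within sphere 0 1)"
    by (rule derivative_eq_intros D refl | simp add: inner_commute)+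
  then show "(f has_derivative (\<lambda>h. D h - (\<theta> \<bullet> h) *\<^sub>R D \<theta>)) (at \<theta> within sphere 0 1)"
  proof (rule has_derivative_transform[rotated 2])
    show "\<theta> \<in> sphere 0 1" using \<theta> by simp
    show "f x = f x - ((x \<bullet> x - 1) / 2) *\<^sub>R D \<theta>" if "x \<in> sphere 0 1" for x
      using that by (simp add: dot_square_norm)
  qed
  show "D \<theta> - (\<theta> \<bullet> \<theta>) *\<^sub>R D \<theta> = 0"
    using \<theta> by (simp add: dot_square_norm)
qed

locale axial_profile =
  fixes e :: "'a::euclidean_space" and W W1 W2 :: "real \<Rightarrow> real"
  assumes e: "norm e = 1"
    and W: "\<And>t. t \<in> {-1..1} \<Longrightarrow> (W has_real_derivative W1 t) (at t within {-1..1})"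
    and W1: "\<And>t. t \<in> {-1..1} \<Longrightarrow> (W1 has_real_derivative W2 t) (at t within {-1..1})"
begin

lemma height_in_interval: "\<theta> \<in> sphere 0 1 \<Longrightarrow> \<theta> \<bullet> e \<in> {-1..1}"
  using Cauchy_Schwarz_ineq2[of \<theta> e] e by (auto simp: abs_le_iff)

lemma compose_height:
  assumes \<theta>: "\<theta> \<in> sphere 0 1"
    and G: "(G has_real_derivative g) (at (\<theta> \<bullet> e) within {-1..1})"
  shows "((\<lambda>x. G (x \<bullet> e)) has_derivative (\<lambda>h. g * (h \<bullet> e))) (at \<theta> within sphere 0 1)"
proof -
  have 1: "((\<lambda>x. x \<bullet> e) has_derivative (\<lambda>h. h \<bullet> e)) (at \<theta> within sphere 0 1)"
    by (rule derivative_eq_intros refl | simp)+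
  have "(\<lambda>x. x \<bullet> e) ` sphere 0 1 \<subseteq> {-1..1}"
    using height_in_interval by blast
  then have "(G has_derivative (*) g) (at (\<theta> \<bullet> e) within (\<lambda>x. x \<bullet> e) ` sphere 0 1)"
    using G unfolding has_field_derivative_def by (rule has_derivative_subset[rotated])
  from diff_chain_within[OF 1 this] show ?thesis
    by (simp add: o_def)
qed

lemma grad_axial:
  assumes \<theta>: "\<theta> \<in> sphere 0 1"
  shows "sphere_grad (\<lambda>x. W (x \<bullet> e)) \<theta> = W1 (\<theta> \<bullet> e) *\<^sub>R (e - (\<theta> \<bullet> e) *\<^sub>R \<theta>)"
    (is "_ = ?g")
proof -
  have "sphere_differential (\<lambda>x. W (x \<bullet> e)) \<theta> = (\<lambda>h. ?g \<bullet> h)"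
    by (subst sphere_differential_tangential[OF _ compose_height[OF \<theta> W[OF height_in_interval[OF \<theta>]]]])
       (use \<theta> in \<open>auto simp: algebra_simps inner_commute\<close>)
  then show ?thesis
    unfolding sphere_grad_def by (simp add: vector_eq_rdot del: inner_scaleR_left)
qed

text \<open>
  The gradient of \<open>W (x \<bullet> e)\<close> is the tangent field \<open>W1 t *\<^sub>R (e - t *\<^sub>R \<theta>)\<close> with \<open>t = \<theta> \<bullet> e\<close>.  The right-hand
  side makes sense off the sphere too, and \<open>grad_diff\<close> is its ambient derivative; \<open>hess\<close> is
  the normalization that annihilates \<open>\<theta>\<close>.
\<close>

definition grad_diff :: "'a \<Rightarrow> 'a \<Rightarrow> 'a" where
  "grad_diff \<theta> h = (W2 (\<theta> \<bullet> e) * (h \<bullet> e)) *\<^sub>R (e - (\<theta> \<bullet> e) *\<^sub>R \<theta>)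
     - W1 (\<theta> \<bullet> e) *\<^sub>R ((h \<bullet> e) *\<^sub>R \<theta> + (\<theta> \<bullet> e) *\<^sub>R h)"

definition hess :: "'a \<Rightarrow> 'a \<Rightarrow> 'a" where
  "hess \<theta> h = grad_diff \<theta> h - (\<theta> \<bullet> h) *\<^sub>R grad_diff \<theta> \<theta>"

lemma grad_axial_has_derivative:
  assumes \<theta>: "\<theta> \<in> sphere 0 1"
  shows "(sphere_grad (\<lambda>x. W (x \<bullet> e)) has_derivative grad_diff \<theta>) (at \<theta> within sphere 0 1)"
proof (rule has_derivative_transform[OF \<theta> grad_axial])
  have alg: "a *\<^sub>R (0 - (x + y)) + z = z - a *\<^sub>R (y + x)" for a and x y z :: 'a
    by (simp add: add.commute[of x y] del: minus_add_distrib scaleR_right_distrib)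
  have d: "((\<lambda>x. x \<bullet> e) has_derivative (\<lambda>h. h \<bullet> e)) (at \<theta> within sphere 0 1)"
    by (intro has_derivative_inner_left has_derivative_ident)
  have "((\<lambda>x. W1 (x \<bullet> e) *\<^sub>R (e - (x \<bullet> e) *\<^sub>R x)) has_derivative
      (\<lambda>h. W1 (\<theta> \<bullet> e) *\<^sub>R (0 - ((\<theta> \<bullet> e) *\<^sub>R h + (h \<bullet> e) *\<^sub>R \<theta>))
        + (W2 (\<theta> \<bullet> e) * (h \<bullet> e)) *\<^sub>R (e - (\<theta> \<bullet> e) *\<^sub>R \<theta>)))
      (at \<theta> within sphere 0 1)"
    by (intro has_derivative_scaleR has_derivative_diff has_derivative_const has_derivative_ident d
        compose_height[OF \<theta> W1[OF height_in_interval[OF \<theta>]]])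
  then show "((\<lambda>x. W1 (x \<bullet> e) *\<^sub>R (e - (x \<bullet> e) *\<^sub>R x)) has_derivative grad_diff \<theta>)
      (at \<theta> within sphere 0 1)"
    by (rule has_derivative_eq_rhs) (simp only: grad_diff_def fun_eq_iff alg simp_thms)
qed

lemma sphere_differential_grad_axial:
  assumes \<theta>: "\<theta> \<in> sphere 0 1"
  shows "sphere_differential (sphere_grad (\<lambda>x. W (x \<bullet> e))) \<theta> = hess \<theta>"
  using sphere_differential_tangential[OF _ grad_axial_has_derivative[OF \<theta>]] \<theta>
  by (simp add: hess_def fun_eq_iff)

text \<open>
  The trace of \<open>hess\<close>: every term is a product of two linear forms in the basis vector, so the sum
  collapses to inner products of \<open>\<theta>\<close> and \<open>e\<close>.  The remaining identity part contributes
  the factor \<open>DIM('a)\<close>.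
\<close>

lemma laplacian_axial:
  assumes \<theta>: "\<theta> \<in> sphere 0 1"
  defines "t \<equiv> \<theta> \<bullet> e"
  shows "sphere_laplacian (\<lambda>x. W (x \<bullet> e)) \<theta>
     = (1 - t\<^sup>2) * W2 t - (real DIM('a) - 1) * t * W1 t"
proof -
  have tt: "\<theta> \<bullet> \<theta> = 1" "e \<bullet> e = 1"
    using \<theta> e by (simp_all add: dot_square_norm)
  have rep: "(\<Sum>b\<in>Basis. (x \<bullet> b) * (b \<bullet> y)) = x \<bullet> y" for x y :: 'a
    by (subst (3) euclidean_inner) (simp add: inner_commute)
  have "sphere_laplacian (\<lambda>x. W (x \<bullet> e)) \<theta> = (\<Sum>b\<in>Basis. hess \<theta> b \<bullet> b)"
    by (simp add: sphere_laplacian_def sphere_div_def sphere_differential_grad_axial[OF \<theta>])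
  also have "\<dots> = (\<Sum>b\<in>Basis. W2 t * ((e \<bullet> b) * (b \<bullet> e)) - (W2 t * t) * ((\<theta> \<bullet> b) * (b \<bullet> e))
      - (W2 t * t) * ((e \<bullet> b) * (b \<bullet> \<theta>)) + (W2 t * t * t) * ((\<theta> \<bullet> b) * (b \<bullet> \<theta>))
      - W1 t * ((\<theta> \<bullet> b) * (b \<bullet> e)) - W1 t * t + (2 * t * W1 t) * ((\<theta> \<bullet> b) * (b \<bullet> \<theta>)))"
  proof (rule sum.cong)
    fix b :: 'a assume "b \<in> Basis"
    then have b: "b \<bullet> b = 1" by simp
    show "hess \<theta> b \<bullet> b = W2 t * ((e \<bullet> b) * (b \<bullet> e)) - (W2 t * t) * ((\<theta> \<bullet> b) * (b \<bullet> e))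
      - (W2 t * t) * ((e \<bullet> b) * (b \<bullet> \<theta>)) + (W2 t * t * t) * ((\<theta> \<bullet> b) * (b \<bullet> \<theta>))
      - W1 t * ((\<theta> \<bullet> b) * (b \<bullet> e)) - W1 t * t + (2 * t * W1 t) * ((\<theta> \<bullet> b) * (b \<bullet> \<theta>))"
      unfolding hess_def grad_diff_def t_def[symmetric] inner_diff_left inner_add_left inner_scaleR_left b
        inner_commute[of b e] inner_commute[of b \<theta>]
      by (simp add: algebra_simps)
  qed simp
  also have "\<dots> = W2 t * (e \<bullet> e) - (W2 t * t) * (\<theta> \<bullet> e)
      - (W2 t * t) * (e \<bullet> \<theta>) + (W2 t * t * t) * (\<theta> \<bullet> \<theta>)
      - W1 t * (\<theta> \<bullet> e) - real DIM('a) * (W1 t * t) + (2 * t * W1 t) * (\<theta> \<bullet> \<theta>)"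
    unfolding sum.distrib sum_subtractf sum_distrib_left[symmetric] rep by simp
  also have "\<dots> = (1 - t\<^sup>2) * W2 t - (real DIM('a) - 1) * t * W1 t"
    by (simp add: tt t_def[symmetric] inner_commute[of e \<theta>] algebra_simps power2_eq_square)
  finally show ?thesis .
qed

text \<open>
  A Lipschitz estimate implies a Hoelder estimate because distances on the sphere are at most 2.
\<close>

lemma lipschitz_powr_bound:
  assumes "\<theta> \<in> sphere 0 1" "\<eta> \<in> sphere 0 1" "0 < \<alpha>" "\<alpha> < 1"
  shows "dist \<theta> \<eta> \<le> 2 * dist \<theta> (\<eta>::'a) powr \<alpha>"
proof (cases "\<theta> = \<eta>")
  case False
  then have d: "dist \<theta> \<eta> > 0" by simp
  have "dist \<theta> \<eta> \<le> 2"
    using assms norm_triangle_ineq4[of \<theta> \<eta>] by (simp add: dist_norm)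
  then have "dist \<theta> \<eta> powr (1 - \<alpha>) \<le> 2 powr (1 - \<alpha>)"
    using assms by (intro powr_mono2) auto
  also have "\<dots> \<le> 2 powr 1" using assms by (intro powr_mono) auto
  finally have "dist \<theta> \<eta> powr \<alpha> * dist \<theta> \<eta> powr (1 - \<alpha>) \<le> dist \<theta> \<eta> powr \<alpha> * 2"
    by (intro mult_left_mono) auto
  then show ?thesis using d by (simp add: powr_add[symmetric] mult.commute)
qed simp

text \<open>
  Maps depending on a point of the sphere and on a direction \<open>h\<close>, bounded and Lipschitz in the point
  with constants proportional to \<open>m h\<close>.  Products multiply the weights \<open>m\<close>, so the estimate for
  \<open>hess\<close> is assembled from its factors, exactly one of which carries the weight \<open>norm h\<close>.
\<close>

definition bounded_lipschitz :: "('a \<Rightarrow> real) \<Rightarrow> ('a \<Rightarrow> 'a \<Rightarrow> 'b::real_normed_vector) \<Rightarrow> bool" where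
  "bounded_lipschitz m g \<longleftrightarrow> (\<exists>C\<ge>0. \<forall>\<theta>\<in>sphere 0 1. \<forall>\<eta>\<in>sphere 0 1. \<forall>h.
     norm (g \<theta> h) \<le> C * m h \<and> norm (g \<theta> h - g \<eta> h) \<le> C * dist \<theta> \<eta> * m h)"

lemma bounded_lipschitz_scaleR:
  assumes s: "bounded_lipschitz m s" and g: "bounded_lipschitz k g"
    and m: "\<And>h. m h \<ge> 0" "\<And>h. k h \<ge> 0" "\<And>h. m h * k h = n h"
  shows "bounded_lipschitz n (\<lambda>\<theta> h. s \<theta> h *\<^sub>R g \<theta> h)"
proof -
  obtain C where C: "C \<ge> 0" "\<And>\<theta> \<eta> h. \<theta> \<in> sphere 0 1 \<Longrightarrow> \<eta> \<in> sphere 0 1 \<Longrightarrow>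
     norm (s \<theta> h) \<le> C * m h \<and> norm (s \<theta> h - s \<eta> h) \<le> C * dist \<theta> \<eta> * m h"
    using s unfolding bounded_lipschitz_def by metis
  obtain D where D: "D \<ge> 0" "\<And>\<theta> \<eta> h. \<theta> \<in> sphere 0 1 \<Longrightarrow> \<eta> \<in> sphere 0 1 \<Longrightarrow>
     norm (g \<theta> h) \<le> D * k h \<and> norm (g \<theta> h - g \<eta> h) \<le> D * dist \<theta> \<eta> * k h"
    using g unfolding bounded_lipschitz_def by metis
  have CD: "0 \<le> C * D" using C(1) D(1) by simp
  show ?thesis
    unfolding bounded_lipschitz_def
  proof (intro exI[of _ "2 * (C * D)"] conjI ballI allI)
    fix \<theta> \<eta> h :: 'a assume *: "\<theta> \<in> sphere 0 1" "\<eta> \<in> sphere 0 1"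
    have "norm (s \<theta> h *\<^sub>R g \<theta> h) \<le> (C * m h) * (D * k h)"
      unfolding norm_scaleR using C(2)[OF *, of h] D(2)[OF *, of h]
      by (intro mult_mono) (auto intro!: mult_nonneg_nonneg C D m)
    also have "\<dots> = (C * D) * n h" by (simp flip: m(3))
    also have "\<dots> \<le> (2 * (C * D)) * n h"
      using CD m(1,2)[of h] by (intro mult_right_mono) (auto simp flip: m(3))
    finally show "norm (s \<theta> h *\<^sub>R g \<theta> h) \<le> (2 * (C * D)) * n h" .
    have "norm (s \<theta> h *\<^sub>R g \<theta> h - s \<eta> h *\<^sub>R g \<eta> h)
        = norm (s \<theta> h *\<^sub>R (g \<theta> h - g \<eta> h) + (s \<theta> h - s \<eta> h) *\<^sub>R g \<eta> h)"
      by (simp add: algebra_simps)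
    also have "\<dots> \<le> norm (s \<theta> h) * norm (g \<theta> h - g \<eta> h) + norm (s \<theta> h - s \<eta> h) * norm (g \<eta> h)"
      by (rule norm_triangle_le) simp
    also have "\<dots> \<le> (C * m h) * (D * dist \<theta> \<eta> * k h) + (C * dist \<theta> \<eta> * m h) * (D * k h)"
      using C(2)[OF *, of h] D(2)[OF *, of h] D(2)[OF *(2,1), of h]
      by (intro add_mono mult_mono) (auto intro!: mult_nonneg_nonneg C D m)
    also have "\<dots> = 2 * (C * D) * dist \<theta> \<eta> * n h"
      by (simp flip: m(3))
    finally show "norm (s \<theta> h *\<^sub>R g \<theta> h - s \<eta> h *\<^sub>R g \<eta> h) \<le> 2 * (C * D) * dist \<theta> \<eta> * n h" .
  qed (use CD in simp)
qed

lemma bounded_lipschitz_diff: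
  assumes s: "bounded_lipschitz m s" and g: "bounded_lipschitz m g"
  shows "bounded_lipschitz m (\<lambda>\<theta> h. s \<theta> h - g \<theta> h)"
proof -
  obtain C where C: "C \<ge> 0" "\<And>\<theta> \<eta> h. \<theta> \<in> sphere 0 1 \<Longrightarrow> \<eta> \<in> sphere 0 1 \<Longrightarrow>
     norm (s \<theta> h) \<le> C * m h \<and> norm (s \<theta> h - s \<eta> h) \<le> C * dist \<theta> \<eta> * m h"
    using s unfolding bounded_lipschitz_def by metis
  obtain D where D: "D \<ge> 0" "\<And>\<theta> \<eta> h. \<theta> \<in> sphere 0 1 \<Longrightarrow> \<eta> \<in> sphere 0 1 \<Longrightarrow>
     norm (g \<theta> h) \<le> D * m h \<and> norm (g \<theta> h - g \<eta> h) \<le> D * dist \<theta> \<eta> * m h"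
    using g unfolding bounded_lipschitz_def by metis
  show ?thesis
    unfolding bounded_lipschitz_def
  proof (intro exI[of _ "C + D"] conjI ballI allI)
    fix \<theta> \<eta> h :: 'a assume *: "\<theta> \<in> sphere 0 1" "\<eta> \<in> sphere 0 1"
    show "norm (s \<theta> h - g \<theta> h) \<le> (C + D) * m h"
      using C(2)[OF *, of h] D(2)[OF *, of h] norm_triangle_ineq4[of "s \<theta> h" "g \<theta> h"]
      by (simp add: algebra_simps)
    have "norm (s \<theta> h - g \<theta> h - (s \<eta> h - g \<eta> h)) = norm ((s \<theta> h - s \<eta> h) - (g \<theta> h - g \<eta> h))"
      by (simp add: algebra_simps)
    also have "\<dots> \<le> norm (s \<theta> h - s \<eta> h) + norm (g \<theta> h - g \<eta> h)"
      by (rule norm_triangle_ineq4)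
    finally show "norm (s \<theta> h - g \<theta> h - (s \<eta> h - g \<eta> h)) \<le> (C + D) * dist \<theta> \<eta> * m h"
      using C(2)[OF *, of h] D(2)[OF *, of h] by (simp add: algebra_simps)
  qed (use C D in simp)
qed

lemma bounded_lipschitz_add:
  assumes s: "bounded_lipschitz m s" and g: "bounded_lipschitz m g"
  shows "bounded_lipschitz m (\<lambda>\<theta> h. s \<theta> h + g \<theta> h)"
proof -
  have "bounded_lipschitz m (\<lambda>\<theta> h. - g \<theta> h)"
    using g unfolding bounded_lipschitz_def by (simp add: norm_minus_commute)
  from bounded_lipschitz_diff[OF s this] show ?thesis by simp
qed

lemma bounded_lipschitz_of_height:
  assumes L: "\<And>s t. s \<in> {-1..1} \<Longrightarrow> t \<in> {-1..1} \<Longrightarrow> \<bar>w s - w t\<bar> \<le> L * \<bar>s - t\<bar>"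
  shows "bounded_lipschitz (\<lambda>_. 1) (\<lambda>\<theta> h. w (\<theta> \<bullet> e))"
  unfolding bounded_lipschitz_def
proof (intro exI[of _ "\<bar>w 0\<bar> + \<bar>L\<bar>"] conjI ballI allI)
  fix \<theta> \<eta> h :: 'a assume *: "\<theta> \<in> sphere 0 1" "\<eta> \<in> sphere 0 1"
  note t = height_in_interval[OF *(1)] height_in_interval[OF *(2)]
  have "\<bar>w (\<theta> \<bullet> e) - w 0\<bar> \<le> \<bar>L\<bar> * 1"
    using t(1) by (intro order_trans[OF L[of "\<theta> \<bullet> e" 0]] mult_mono) auto
  then show "norm (w (\<theta> \<bullet> e)) \<le> (\<bar>w 0\<bar> + \<bar>L\<bar>) * 1"
    by simp
  have "\<bar>\<theta> \<bullet> e - \<eta> \<bullet> e\<bar> \<le> dist \<theta> \<eta>"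
    using Cauchy_Schwarz_ineq2[of "\<theta> - \<eta>" e] e by (simp add: inner_diff_left dist_norm)
  then have "\<bar>w (\<theta> \<bullet> e) - w (\<eta> \<bullet> e)\<bar> \<le> \<bar>L\<bar> * dist \<theta> \<eta>"
    using t by (intro order_trans[OF L[of "\<theta> \<bullet> e" "\<eta> \<bullet> e"]] mult_mono) auto
  also have "\<dots> \<le> (\<bar>w 0\<bar> + \<bar>L\<bar>) * dist \<theta> \<eta>" by (intro mult_right_mono) auto
  finally show "norm (w (\<theta> \<bullet> e) - w (\<eta> \<bullet> e)) \<le> (\<bar>w 0\<bar> + \<bar>L\<bar>) * dist \<theta> \<eta> * 1"
    by simp
qed simp

lemma W1_lipschitz:
  assumes L2: "\<And>s t. s \<in> {-1..1} \<Longrightarrow> t \<in> {-1..1} \<Longrightarrow> \<bar>W2 s - W2 t\<bar> \<le> L * \<bar>s - t\<bar>"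
  shows "s \<in> {-1..1} \<Longrightarrow> t \<in> {-1..1} \<Longrightarrow> \<bar>W1 s - W1 t\<bar> \<le> (\<bar>W2 0\<bar> + \<bar>L\<bar>) * \<bar>s - t\<bar>"
proof -
  assume st: "s \<in> {-1..1}" "t \<in> {-1..1}"
  have B: "norm (W2 x) \<le> \<bar>W2 0\<bar> + \<bar>L\<bar>" if x: "x \<in> {-1..1}" for x
  proof -
    have "\<bar>W2 x - W2 0\<bar> \<le> \<bar>L\<bar> * 1"
      using x by (intro order_trans[OF L2[of x 0]] mult_mono) auto
    then show ?thesis by simp
  qed
  have "norm (W1 s - W1 t) \<le> (\<bar>W2 0\<bar> + \<bar>L\<bar>) * norm (s - t)"
    by (rule field_differentiable_bound[of "{-1..1}", OF _ W1 B]) (use st in auto)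
  then show ?thesis by simp
qed

lemma hess_lipschitz:
  assumes L2: "\<And>s t. s \<in> {-1..1} \<Longrightarrow> t \<in> {-1..1} \<Longrightarrow> \<bar>W2 s - W2 t\<bar> \<le> L * \<bar>s - t\<bar>"
  shows "bounded_lipschitz norm hess"
proof -
  let ?b = "bounded_lipschitz (\<lambda>_. 1)" and ?n = "bounded_lipschitz norm"
  have w2: "?b (\<lambda>\<theta> h. W2 (\<theta> \<bullet> e))" by (rule bounded_lipschitz_of_height[OF L2])
  have w1: "?b (\<lambda>\<theta> h. W1 (\<theta> \<bullet> e))" by (rule bounded_lipschitz_of_height[OF W1_lipschitz[OF L2]])
  have t: "?b (\<lambda>\<theta> h. \<theta> \<bullet> e)" by (rule bounded_lipschitz_of_height[where L = 1]) simp
  have c: "?b (\<lambda>\<theta> h. x)" for x :: "'b::real_normed_vector"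
    unfolding bounded_lipschitz_def by (intro exI[of _ "norm x"]) simp
  have \<theta>: "?b (\<lambda>\<theta> h. \<theta>)"
    unfolding bounded_lipschitz_def by (intro exI[of _ 1]) (simp add: dist_norm)
  have h: "?n (\<lambda>\<theta> h. h)"
    unfolding bounded_lipschitz_def by (intro exI[of _ 1]) simp
  have he: "?n (\<lambda>\<theta> h. h \<bullet> e)"
    unfolding bounded_lipschitz_def using Cauchy_Schwarz_ineq2[of _ e] e by (intro exI[of _ 1]) simp
  have \<theta>h: "?n (\<lambda>\<theta> h. \<theta> \<bullet> h)"
    unfolding bounded_lipschitz_def
    by (intro exI[of _ 1])
      (auto simp: dist_norm inner_diff_left[symmetric] intro!: order_trans[OF Cauchy_Schwarz_ineq2])
  note bb = bounded_lipschitz_scaleR[where m = "\<lambda>_. 1" and k = "\<lambda>_. 1" and n = "\<lambda>_. 1"]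
  note bn = bounded_lipschitz_scaleR[where m = "\<lambda>_. 1" and k = norm and n = norm]
  note nb = bounded_lipschitz_scaleR[where k = "\<lambda>_. 1" and m = norm and n = norm]
  note d = bounded_lipschitz_diff
  have tan: "?b (\<lambda>\<theta> h. e - (\<theta> \<bullet> e) *\<^sub>R \<theta>)"
    using d[OF c bb[OF t \<theta>]] by simp
  have w2h: "?n (\<lambda>\<theta> h. W2 (\<theta> \<bullet> e) *\<^sub>R (h \<bullet> e))" by (rule bn[OF w2 he]) auto
  have w2t: "?b (\<lambda>\<theta> h. W2 (\<theta> \<bullet> e) *\<^sub>R (\<theta> \<bullet> e))" by (rule bb[OF w2 t]) auto
  have a: "?n (\<lambda>\<theta> h. (W2 (\<theta> \<bullet> e) *\<^sub>R (h \<bullet> e)) *\<^sub>R (e - (\<theta> \<bullet> e) *\<^sub>R \<theta>))"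
    by (rule nb[OF w2h tan]) auto
  have a': "?b (\<lambda>\<theta> h. (W2 (\<theta> \<bullet> e) *\<^sub>R (\<theta> \<bullet> e)) *\<^sub>R (e - (\<theta> \<bullet> e) *\<^sub>R \<theta>))"
    by (rule bb[OF w2t tan]) auto
  have b: "?n (\<lambda>\<theta> h. (h \<bullet> e) *\<^sub>R \<theta>)" by (rule nb[OF he \<theta>]) auto
  have b': "?n (\<lambda>\<theta> h. (\<theta> \<bullet> e) *\<^sub>R h)" by (rule bn[OF t h]) auto
  have b'': "?b (\<lambda>\<theta> h. (\<theta> \<bullet> e) *\<^sub>R \<theta>)" by (rule bb[OF t \<theta>]) auto
  have gd: "?n grad_diff"
    unfolding grad_diff_def using d[OF a bn[OF w1 bounded_lipschitz_add[OF b b']]] by simp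
  have gd': "?b (\<lambda>\<theta> h. grad_diff \<theta> \<theta>)"
    unfolding grad_diff_def using d[OF a' bb[OF w1 bounded_lipschitz_add[OF b'' b'']]] by simp
  have "?n (\<lambda>\<theta> h. (\<theta> \<bullet> h) *\<^sub>R grad_diff \<theta> \<theta>)"
    by (rule nb[OF \<theta>h gd']) auto
  from d[OF gd this] show ?thesis
    unfolding hess_def .
qed

theorem axial_C2_holder:
  assumes L2: "\<And>s t. s \<in> {-1..1} \<Longrightarrow> t \<in> {-1..1} \<Longrightarrow> \<bar>W2 s - W2 t\<bar> \<le> L * \<bar>s - t\<bar>"
    and \<alpha>: "0 < \<alpha>" "\<alpha> < 1"
  shows "(\<lambda>x. W (x \<bullet> e)) \<in> sphere_C2_holder \<alpha>"
proof -
  obtain C where C: "\<And>\<theta> \<eta> h. \<theta> \<in> sphere 0 1 \<Longrightarrow> \<eta> \<in> sphere 0 1 \<Longrightarrow>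
    norm (hess \<theta> h - hess \<eta> h) \<le> C * dist \<theta> \<eta> * norm h" "C \<ge> 0"
    using hess_lipschitz[OF L2] unfolding bounded_lipschitz_def by blast
  have "norm (sphere_differential (sphere_grad (\<lambda>x. W (x \<bullet> e))) \<theta> h
        - sphere_differential (sphere_grad (\<lambda>x. W (x \<bullet> e))) \<eta> h)
      \<le> (C * 2) * dist \<theta> \<eta> powr \<alpha> * norm h"
    if "\<theta> \<in> sphere 0 1" "\<eta> \<in> sphere 0 1" for \<theta> \<eta> h
  proof -
    have "C * dist \<theta> \<eta> * norm h \<le> C * (2 * dist \<theta> \<eta> powr \<alpha>) * norm h"
      by (intro mult_right_mono mult_left_mono lipschitz_powr_bound that \<alpha> C(2)) auto
    with C(1)[OF that, of h] show ?thesis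
      unfolding sphere_differential_grad_axial[OF that(1)] sphere_differential_grad_axial[OF that(2)]
      by simp
  qed
  moreover have "(\<lambda>x. W (x \<bullet> e)) differentiable (at \<theta> within sphere 0 1)"
    if "\<theta> \<in> sphere 0 1" for \<theta>
    using compose_height[OF that W[OF height_in_interval[OF that]]] by (auto simp: differentiable_def)
  moreover have "sphere_grad (\<lambda>x. W (x \<bullet> e)) differentiable (at \<theta> within sphere 0 1)"
    if "\<theta> \<in> sphere 0 1" for \<theta>
    using grad_axial_has_derivative[OF that] by (auto simp: differentiable_def)
  ultimately show ?thesis
    unfolding sphere_C2_holder_def by blast
qed

end

section \<open>The radial equation near a pole\<close>

text \<open>
  On either hemisphere the variable is \<open>r = 1 - \<bar>t\<bar>\<close>, which is 0 at the pole and 1 on the equator, so that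
  \<open>1 - t\<^sup>2 = r * (2 - r)\<close>.  Its root \<open>Q\<close> is the sine of the polar angle.
\<close>

definition Q :: "real \<Rightarrow> real" where "Q r = sqrt (r * (2 - r))"

text \<open>
  The equation \<open>r (2 - r) y'' + N (1 - r) y' + f y = 0\<close>, which in divergence form reads
  \<open>(Q\<^sup>N y')' = - Q\<^bsup>N-2\<^esup> f y\<close>.  Being differentiable with continuous derivative up to the singular point
  \<open>r = 0\<close> selects the solutions that are regular at the pole, a one-parameter family.
\<close>

definition axial_solution :: "nat \<Rightarrow> (real \<Rightarrow> real) \<Rightarrow> (real \<Rightarrow> real) \<Rightarrow> (real \<Rightarrow> real) \<Rightarrow> bool" where
  "axial_solution N f y y' \<longleftrightarrow>
     (\<forall>r\<in>{0..1}. (y has_real_derivative y' r) (at r within {0..1})) \<and>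
     continuous_on {0..1} y' \<and>
     (\<forall>r\<in>{0<..1}. (y' has_real_derivative - (f (y r) + real N * (1 - r) * y' r) / (r * (2 - r)))
        (at r within {0..1}))"

text \<open>
  The regular solution of \<open>(Q\<^sup>N A)' = Q\<^bsup>N-2\<^esup> u\<close> is \<open>A s = Q s\<^bsup>-N\<^esup> \<integral>\<^bsub>0\<^esub>\<^bsup>s\<^esup> Q\<^bsup>N-2\<^esup> u\<close>.  The substitution of \<open>s x\<^sup>2\<close> for
  the integration variable turns this quotient, singular at \<open>s = 0\<close>, into the integral of \<open>u\<close> against a kernel
  that is continuous up to \<open>s = 0\<close>; the square avoids the fractional powers of \<open>x\<close> that odd \<open>N\<close> would
  otherwise produce.
\<close>

definition polar_kernel :: "nat \<Rightarrow> real \<Rightarrow> real \<Rightarrow> real" where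
  "polar_kernel N s x = 2 * x ^ (N - 1) * sqrt (2 - s * x\<^sup>2) ^ (N - 2) / sqrt (2 - s) ^ N"

definition polar_avg :: "nat \<Rightarrow> (real \<Rightarrow> real) \<Rightarrow> real \<Rightarrow> real" where
  "polar_avg N u s = integral {0..1} (\<lambda>x. polar_kernel N s x * u (s * x\<^sup>2))"

lemma two_le_Suc_Suc: "2 \<le> N \<Longrightarrow> \<exists>m. N = Suc (Suc m)"
  by presburger

lemma Q_pos: "0 < r \<Longrightarrow> r \<le> 1 \<Longrightarrow> Q r > 0"
  by (simp add: Q_def)

lemma Q_nonneg: "0 \<le> r \<Longrightarrow> r \<le> 1 \<Longrightarrow> Q r \<ge> 0"
  by (simp add: Q_def)

lemma Q_sq: "0 \<le> r \<Longrightarrow> r \<le> 1 \<Longrightarrow> (Q r)\<^sup>2 = r * (2 - r)"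
  by (simp add: Q_def)

lemma continuous_Q [continuous_intros]: "continuous_on S Q"
  unfolding Q_def by (intro continuous_intros)

lemma Q_power_deriv:
  assumes "0 < r" "r \<le> 1" "N \<ge> 2"
  shows "((\<lambda>r. Q r ^ N) has_real_derivative real N * (1 - r) * Q r ^ (N - 2)) (at r within S)"
proof -
  obtain m where N: "N = Suc (Suc m)" using assms(3) two_le_Suc_Suc by blast
  have "Q r > 0" using assms by (intro Q_pos)
  have "(Q has_real_derivative (1 - r) / Q r) (at r)"
    unfolding Q_def using assms
    by (auto intro!: derivative_eq_intros simp: field_simps)
  then have "((\<lambda>r. Q r ^ N) has_real_derivative real N * ((1 - r) / Q r) * Q r ^ (N - 1)) (at r)"
    by (auto intro!: derivative_eq_intros simp: field_simps)
  also have "real N * ((1 - r) / Q r) * Q r ^ (N - 1) = real N * (1 - r) * Q r ^ (N - 2)"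
    using \<open>Q r > 0\<close> by (simp add: N)
  finally show ?thesis by (rule has_field_derivative_at_within)
qed

lemma kernel_continuous:
  fixes S :: "'a::topological_space set"
  assumes f: "continuous_on S f" and g: "continuous_on S g"
    and r: "\<And>x. x \<in> S \<Longrightarrow> f x \<le> 1"
  shows "continuous_on S (\<lambda>x. polar_kernel N (f x) (g x))"
  unfolding polar_kernel_def by (intro continuous_intros f g) (use r in force)

lemma polar_avg_continuous:
  fixes E :: "'a::metric_space set"
  assumes u: "continuous_on (E \<times> {0..1}) (\<lambda>(e, s). u e s)"
  shows "continuous_on (E \<times> {0..1}) (\<lambda>(e, s). polar_avg N (u e) s)"
proof -
  have "continuous_on ((E \<times> {0..1}) \<times> cbox 0 1)
      (\<lambda>(p, x). polar_kernel N (snd p) x * u (fst p) (snd p * x\<^sup>2))"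
  proof -
    have 1: "continuous_on ((E \<times> {0..1}) \<times> cbox 0 1) (\<lambda>z. polar_kernel N (snd (fst z)) (snd z))"
      by (intro kernel_continuous continuous_intros) auto
    have "(\<lambda>z. (fst (fst z), snd (fst z) * (snd z)\<^sup>2)) ` ((E \<times> {0..1}) \<times> cbox 0 1) \<subseteq> E \<times> {0..(1::real)}"
      by (auto intro!: mult_nonneg_nonneg mult_le_one power_le_one)
    then have "continuous_on ((E \<times> {0..1}) \<times> cbox 0 1) (\<lambda>z. u (fst (fst z)) (snd (fst z) * (snd z)\<^sup>2))"
      using continuous_on_compose2[OF u, of "(E \<times> {0..1}) \<times> cbox 0 1" "\<lambda>z. (fst (fst z), snd (fst z) * (snd z)\<^sup>2)"]
      by (force intro!: continuous_intros)
    with 1 show ?thesis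
      unfolding case_prod_unfold by (rule continuous_on_mult)
  qed
  from integral_continuous_on_param[OF this] show ?thesis
    by (simp add: polar_avg_def case_prod_unfold)
qed

lemma polar_avg_continuous1:
  assumes u: "continuous_on {0..1} u"
  shows "continuous_on {0..1} (polar_avg N u)"
proof -
  have "continuous_on ({0::real} \<times> {0..1}) (\<lambda>(e::real, s). u s)"
    unfolding case_prod_unfold by (intro continuous_on_compose2[OF u] continuous_intros) auto
  from polar_avg_continuous[OF this, of N]
  have "continuous_on {0..1} ((\<lambda>(e::real, s). polar_avg N u s) \<circ> (\<lambda>s. (0, s)))"
    by (intro continuous_on_compose continuous_intros) (auto elim: continuous_on_subset)
  then show ?thesis by (simp add: o_def)
qed

lemma integral_rescale:
  assumes g: "continuous_on {0..1} (g :: real \<Rightarrow> real)" and r: "r \<in> {0..1}"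
  shows "integral {0..r} g = r * integral {0..1} (\<lambda>x. g (r * x))"
proof -
  have d: "((\<lambda>x. integral {0..x} g) has_real_derivative g x) (at x within {0..1})" if "x \<in> {0..1}" for x
    using integral_has_real_derivative[OF g that] .
  have "((\<lambda>x. integral {0..r * x} g) has_vector_derivative r * g (r * x)) (at x within {0..1})"
    if x: "x \<in> {0..1}" for x
  proof -
    have rx: "r * x \<in> {0..1}" using r x by (auto intro: mult_le_one)
    have "(\<lambda>x. r * x) ` {0..1} \<subseteq> {0..1}" using r by (auto intro: mult_le_one)
    then have "((\<lambda>x. integral {0..x} g) has_real_derivative g (r * x)) (at (r * x) within (\<lambda>x. r * x) ` {0..1})"
      by (rule has_field_derivative_subset[OF d[OF rx]])
    moreover have "((\<lambda>x. r * x) has_real_derivative r) (at x within {0..1})"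
      by (auto intro!: derivative_eq_intros)
    ultimately show ?thesis
      using DERIV_image_chain[of "\<lambda>x. integral {0..x} g" "g (r * x)" "\<lambda>x. r * x" x "{0..1}" r]
      by (simp add: o_def has_real_derivative_iff_has_vector_derivative mult.commute)
  qed
  then have "((\<lambda>x. r * g (r * x)) has_integral (integral {0..r * 1} g - integral {0..r * 0} g)) {0..1}"
    by (intro fundamental_theorem_of_calculus) auto
  then show ?thesis
    by (simp add: integral_unique flip: integral_mult_right)
qed

text \<open>
  The substitution that leads to \<^const>\<open>polar_kernel\<close>, carried out with the fundamental theorem of
  calculus for \<open>x \<mapsto> \<integral>\<^bsub>0\<^esub>\<^bsup>s x\<^sup>2\<^esup> Q\<^bsup>N-2\<^esup> u\<close>.
\<close>

lemma polar_avg_integral: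
  assumes N: "N \<ge> 2" and u: "continuous_on {0..1} u" and s: "s \<in> {0..1}"
  shows "Q s ^ N * polar_avg N u s = integral {0..s} (\<lambda>x. Q x ^ (N - 2) * u x)"
proof -
  obtain m where m: "N = Suc (Suc m)" using N two_le_Suc_Suc by blast
  define g where "g = (\<lambda>x. Q x ^ m * u x)"
  have g: "continuous_on {0..1} g" unfolding g_def by (intro continuous_intros u)
  have d: "((\<lambda>x. integral {0..x} g) has_real_derivative g x) (at x within {0..1})" if "x \<in> {0..1}" for x
    using integral_has_real_derivative[OF g that] .
  have in01: "s * x\<^sup>2 \<in> {0..1}" if "x \<in> {0..1}" for x
    using s that by (auto intro!: mult_le_one power_le_one)
  have "((\<lambda>x. integral {0..s * x\<^sup>2} g) has_vector_derivative (2 * s * x) * g (s * x\<^sup>2)) (at x within {0..1})"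
    if x: "x \<in> {0..1}" for x
  proof -
    have "(\<lambda>x. s * x\<^sup>2) ` {0..1} \<subseteq> {0..1}" using in01 by auto
    then have "((\<lambda>x. integral {0..x} g) has_real_derivative g (s * x\<^sup>2)) (at (s * x\<^sup>2) within (\<lambda>x. s * x\<^sup>2) ` {0..1})"
      by (rule has_field_derivative_subset[OF d[OF in01[OF x]]])
    moreover have "((\<lambda>x. s * x\<^sup>2) has_real_derivative 2 * s * x) (at x within {0..1})"
      by (auto intro!: derivative_eq_intros)
    ultimately show ?thesis
      using DERIV_image_chain[of "\<lambda>x. integral {0..x} g" "g (s * x\<^sup>2)" "\<lambda>x. s * x\<^sup>2" x "{0..1}" "2 * s * x"]
      by (simp add: o_def has_real_derivative_iff_has_vector_derivative mult.commute)
  qed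
  then have "((\<lambda>x. (2 * s * x) * g (s * x\<^sup>2)) has_integral
      (integral {0..s * 1\<^sup>2} g - integral {0..s * 0\<^sup>2} g)) {0..1}"
    by (intro fundamental_theorem_of_calculus) auto
  then have "integral {0..s} g = integral {0..1} (\<lambda>x. (2 * s * x) * g (s * x\<^sup>2))"
    by (simp add: integral_unique)
  also have "\<dots> = integral {0..1} (\<lambda>x. Q s ^ N * (polar_kernel N s x * u (s * x\<^sup>2)))"
  proof (rule integral_cong)
    fix x :: real assume x: "x \<in> {0..1}"
    have s2: "sqrt (2 - s) > 0" using s by simp
    have "Q s ^ N = s * sqrt s ^ m * sqrt (2 - s) ^ N"
      using s by (simp add: Q_def real_sqrt_mult power_mult_distrib m)
    moreover have "Q (s * x\<^sup>2) = sqrt s * x * sqrt (2 - s * x\<^sup>2)"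
      using s x by (simp add: Q_def real_sqrt_mult)
    ultimately show "(2 * s * x) * g (s * x\<^sup>2) = Q s ^ N * (polar_kernel N s x * u (s * x\<^sup>2))"
      using s2 by (simp add: g_def polar_kernel_def m power_mult_distrib)
  qed
  also have "\<dots> = Q s ^ N * polar_avg N u s"
    by (simp add: polar_avg_def)
  finally show ?thesis by (simp add: g_def m)
qed

lemma polar_avg_deriv:
  assumes N: "N \<ge> 2" and u: "continuous_on {0..1} u" and s: "s \<in> {0<..1}"
  shows "(polar_avg N u has_real_derivative (u s - real N * (1 - s) * polar_avg N u s) / (s * (2 - s)))
    (at s within {0..1})"
proof -
  let ?I = "\<lambda>x. integral {0..x} (\<lambda>x. Q x ^ (N - 2) * u x)"
  have s': "s \<in> {0..1}" using s by auto
  have Qs: "Q s > 0" using s Q_pos by auto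
  obtain m where m: "N = Suc (Suc m)" using N two_le_Suc_Suc by blast
  have I: "(?I has_real_derivative Q s ^ (N - 2) * u s) (at s within {0..1})"
    by (rule integral_has_real_derivative[OF _ s']) (intro continuous_intros u)
  have "((\<lambda>x. ?I x / Q x ^ N) has_real_derivative
      (Q s ^ (N - 2) * u s * Q s ^ N - ?I s * (real N * (1 - s) * Q s ^ (N - 2))) / (Q s ^ N * Q s ^ N))
      (at s within {0..1})"
    by (rule DERIV_divide[OF I Q_power_deriv]) (use s N Qs in auto)
  also have "(Q s ^ (N - 2) * u s * Q s ^ N - ?I s * (real N * (1 - s) * Q s ^ (N - 2))) / (Q s ^ N * Q s ^ N)
      = (u s - real N * (1 - s) * polar_avg N u s) / (Q s)\<^sup>2"
    unfolding polar_avg_integral[OF N u s', symmetric] using Qs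
    by (simp add: m field_simps power2_eq_square)
  also have "(Q s)\<^sup>2 = s * (2 - s)" using s by (simp add: Q_sq)
  finally show ?thesis
  proof (rule has_field_derivative_transform_within)
    show "0 < s" using s by auto
    show "?I x / Q x ^ N = polar_avg N u x" if "x \<in> {0..1}" "dist x s < s" for x
    proof -
      have "x > 0" using that by (auto simp: dist_real_def abs_if split: if_splits)
      then have "Q x > 0" using that Q_pos by auto
      then show ?thesis using polar_avg_integral[OF N u, of x] that by (simp add: field_simps)
    qed
  qed (use s' in auto)
qed

lemma polar_kernel_bound:
  assumes "s \<in> {0..1}" "x \<in> {0..1}" "N \<ge> 2"
  shows "\<bar>polar_kernel N s x\<bar> \<le> 2 ^ N"
proof -
  obtain m where m: "N = Suc (Suc m)" using assms(3) two_le_Suc_Suc by blast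
  have le1: "s * x\<^sup>2 \<le> 1" "0 \<le> s * x\<^sup>2" using assms by (auto intro!: mult_le_one power_le_one)
  have "sqrt (2 - s * x\<^sup>2) \<le> sqrt (2\<^sup>2)" using le1 by (intro real_sqrt_le_mono) simp
  then have "sqrt (2 - s * x\<^sup>2) ^ m \<le> 2 ^ m" using le1 by (intro power_mono) auto
  moreover have "x ^ (N - 1) \<le> 1" "x ^ (N - 1) \<ge> 0" using assms by (auto intro: power_le_one)
  ultimately have "(2 * x ^ (N - 1)) * sqrt (2 - s * x\<^sup>2) ^ m \<le> 2 * 2 ^ m"
    using le1 by (intro mult_mono) auto
  moreover have "1 \<le> sqrt (2 - s) ^ N" using assms by (intro one_le_power) simp
  ultimately have "2 * x ^ (N - 1) * sqrt (2 - s * x\<^sup>2) ^ m / sqrt (2 - s) ^ N \<le> 2 * 2 ^ m / 1"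
    by (intro frac_le) auto
  also have "\<dots> \<le> 2 ^ N" by (simp add: m)
  finally show ?thesis
    using assms le1 by (simp add: polar_kernel_def m abs_mult)
qed

lemma polar_avg_diff_bound:
  assumes N: "N \<ge> 2" and u: "continuous_on {0..1} u" and v: "continuous_on {0..1} v" and s: "s \<in> {0..1}"
    and M: "\<And>x. x \<in> {0..s} \<Longrightarrow> \<bar>u x - v x\<bar> \<le> M"
  shows "\<bar>polar_avg N u s - polar_avg N v s\<bar> \<le> 2 ^ N * M"
proof -
  have in01: "s * x\<^sup>2 \<in> {0..1}" "s * x\<^sup>2 \<in> {0..s}" if "x \<in> {0..1}" for x
    using s that by (auto intro!: mult_le_one power_le_one mult_left_le)
  have c: "continuous_on {0..1} (\<lambda>x. polar_kernel N s x * w (s * x\<^sup>2))" if w: "continuous_on {0..1} w" for w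
    by (intro continuous_intros kernel_continuous continuous_on_compose2[OF w]) (use in01 s in auto)
  have i: "(\<lambda>x. polar_kernel N s x * w (s * x\<^sup>2)) integrable_on {0..1}" if "continuous_on {0..1} w" for w
    by (intro integrable_continuous_interval c that)
  have "polar_avg N u s - polar_avg N v s
      = integral {0..1} (\<lambda>x. polar_kernel N s x * u (s * x\<^sup>2) - polar_kernel N s x * v (s * x\<^sup>2))"
    unfolding polar_avg_def by (rule integral_diff[symmetric]) (intro i u v)+
  also have "norm \<dots> \<le> (2 ^ N * M) * (1 - 0)"
  proof (rule integral_bound)
    show "continuous_on {0..1} (\<lambda>x. polar_kernel N s x * u (s * x\<^sup>2) - polar_kernel N s x * v (s * x\<^sup>2))"
      by (intro continuous_on_diff c u v)
    fix t :: real assume t: "t \<in> {0..1}"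
    have "norm (polar_kernel N s t * u (s * t\<^sup>2) - polar_kernel N s t * v (s * t\<^sup>2))
        = \<bar>polar_kernel N s t\<bar> * \<bar>u (s * t\<^sup>2) - v (s * t\<^sup>2)\<bar>"
      by (simp add: right_diff_distrib[symmetric] abs_mult)
    also have "\<dots> \<le> 2 ^ N * M"
      by (intro mult_mono polar_kernel_bound M in01 s t N) auto
    finally show "norm (polar_kernel N s t * u (s * t\<^sup>2) - polar_kernel N s t * v (s * t\<^sup>2)) \<le> 2 ^ N * M" .
  qed simp
  finally show ?thesis by simp
qed

lemma integral_upper_continuous:
  fixes E :: "'a::metric_space set" and g :: "'a \<Rightarrow> real \<Rightarrow> real"
  assumes g: "continuous_on (E \<times> {0..1}) (\<lambda>(e, s). g e s)"
  shows "continuous_on (E \<times> {0..1}) (\<lambda>(e, r). integral {0..r} (g e))"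
proof -
  have "continuous_on ((E \<times> {0..1}) \<times> cbox 0 1) (\<lambda>(p, x). g (fst p) (snd p * x))"
  proof -
    have "(\<lambda>z. (fst (fst z), snd (fst z) * snd z)) ` ((E \<times> {0..1}) \<times> cbox 0 1) \<subseteq> E \<times> {0..(1::real)}"
      by (auto intro: mult_le_one)
    then show ?thesis
      using continuous_on_compose2[OF g, of "(E \<times> {0..1}) \<times> cbox 0 1" "\<lambda>z. (fst (fst z), snd (fst z) * snd z)"]
      unfolding case_prod_unfold by (force intro!: continuous_intros)
  qed
  from integral_continuous_on_param[OF this]
  have c: "continuous_on (E \<times> {0..1}) (\<lambda>p. snd p * integral {0..1} (\<lambda>x. g (fst p) (snd p * x)))"
    by (intro continuous_intros) simp
  have "continuous_on {0..1} (g e)" if "e \<in> E" for e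
    using continuous_on_compose2[OF g, of "{0..1}" "\<lambda>s. (e, s)"] that
    by (force intro!: continuous_intros)
  then show ?thesis
    by (intro continuous_on_eq[OF c]) (auto simp: integral_rescale)
qed

text \<open>
  Existence for a whole interval of parameters at once.  The integral equation
  \<open>\<phi> r = 1 - \<integral>\<^bsub>0\<^esub>\<^bsup>r\<^esup> polar_avg N (H e \<circ> \<phi>)\<close> is solved by the contraction principle in a space of functions of
  the pair \<open>(e, r)\<close>; continuous dependence on the parameter is then part of the statement that the
  fixed point lies in that space.  The weight \<open>exp (- K r)\<close> makes the Volterra operator a contraction on all
  of \<open>{0..1}\<close>, and retracting \<open>(e, r)\<close> to the rectangle lets bounded continuous functions
  on the whole plane be used.
\<close>

lemma shooting_family:
  fixes H :: "real \<Rightarrow> real \<Rightarrow> real"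
  assumes N: "N \<ge> 2" and e01: "e0 \<le> e1"
    and cont: "continuous_on ({e0..e1} \<times> UNIV) (\<lambda>(e, w). H e w)"
    and lip: "\<And>e w w'. e \<in> {e0..e1} \<Longrightarrow> \<bar>H e w - H e w'\<bar> \<le> L * \<bar>w - w'\<bar>"
  obtains \<phi> \<phi>' where
    "continuous_on ({e0..e1} \<times> {0..1}) (\<lambda>(e, r). \<phi> e r)"
    "continuous_on ({e0..e1} \<times> {0..1}) (\<lambda>(e, r). \<phi>' e r)"
    "\<And>e. e \<in> {e0..e1} \<Longrightarrow> axial_solution N (H e) (\<phi> e) (\<phi>' e) \<and> \<phi> e 0 = 1"
proof -
  have "0 \<le> \<bar>H e0 1 - H e0 0\<bar>" by simp
  also have "\<dots> \<le> L" using lip[of e0 1 0] e01 by simp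
  finally have L: "L \<ge> 0" .
  define K where "K = 2 ^ (N + 1) * (L + 1)"
  have K: "K > 0" using L by (simp add: K_def)
  have LK: "2 ^ N * L / K \<le> 1 / 2" using L K by (simp add: K_def field_simps)
  define v where "v = (\<lambda>(\<Psi> :: (real \<times> real) \<Rightarrow>\<^sub>C real) e s. H e (exp (K * s) * apply_bcontfun \<Psi> (e, s)))"
  define A where "A = (\<lambda>\<Psi> e. polar_avg N (v \<Psi> e))"
  define J where "J = (\<lambda>\<Psi> e r. integral {0..r} (A \<Psi> e))"
  define cl where "cl = (\<lambda>p::real \<times> real. (max e0 (min (fst p) e1), max 0 (min (snd p) (1::real))))"
  define S where "S = (\<lambda>\<Psi> p. exp (- K * snd p) * (1 - J \<Psi> (fst p) (snd p)))"
  have cv: "continuous_on ({e0..e1} \<times> {0..1}) (\<lambda>(e, s). v \<Psi> e s)" for \<Psi>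
  proof -
    have "continuous_on ({e0..e1} \<times> {0..1})
        (\<lambda>p. (\<lambda>(e, w). H e w) (fst p, exp (K * snd p) * apply_bcontfun \<Psi> p))"
      by (rule continuous_on_compose2[OF cont]) (auto intro!: continuous_intros)
    then show ?thesis by (simp add: v_def case_prod_unfold)
  qed
  have cA: "continuous_on ({e0..e1} \<times> {0..1}) (\<lambda>(e, s). A \<Psi> e s)" for \<Psi>
    unfolding A_def by (rule polar_avg_continuous[OF cv])
  have cJ: "continuous_on ({e0..e1} \<times> {0..1}) (\<lambda>(e, s). J \<Psi> e s)" for \<Psi>
    unfolding J_def by (rule integral_upper_continuous[OF cA])
  have cS: "continuous_on ({e0..e1} \<times> {0..1}) (S \<Psi>)" for \<Psi>
    unfolding S_def by (intro continuous_intros cJ[unfolded case_prod_unfold])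
  have slice: "continuous_on {0..1} (g e)" if "continuous_on ({e0..e1} \<times> {0..1}) (\<lambda>(e, s). g e s)" "e \<in> {e0..e1}"
    for g :: "real \<Rightarrow> real \<Rightarrow> real" and e
    using continuous_on_compose2[OF that(1), of "{0..1}" "\<lambda>s. (e, s)"] that(2)
    by (force intro!: continuous_intros)
  have cl_in: "cl p \<in> {e0..e1} \<times> {0..1}" for p using e01 by (auto simp: cl_def)
  have cl_id: "cl p = p" if "p \<in> {e0..e1} \<times> {0..1}" for p using that by (auto simp: cl_def)
  have T_bc: "(\<lambda>p. S \<Psi> (cl p)) \<in> bcontfun" for \<Psi>
  proof -
    have "continuous_on UNIV cl" unfolding cl_def by (intro continuous_intros)
    then have "continuous_on UNIV (\<lambda>p. S \<Psi> (cl p))"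
      by (rule continuous_on_compose2[OF cS]) (use cl_in in blast)
    moreover have "compact (S \<Psi> ` ({e0..e1} \<times> {0..1}))"
      by (intro compact_continuous_image cS compact_Times) auto
    then have "bounded (S \<Psi> ` ({e0..e1} \<times> {0..1}))" by (rule compact_imp_bounded)
    then have "bounded (range (\<lambda>p. S \<Psi> (cl p)))"
      by (rule bounded_subset) (use cl_in in blast)
    ultimately show ?thesis by (simp add: bcontfun_def)
  qed
  define T where "T = (\<lambda>\<Psi>. Bcontfun (\<lambda>p. S \<Psi> (cl p)))"
  have T: "apply_bcontfun (T \<Psi>) p = S \<Psi> (cl p)" for \<Psi> p
    unfolding T_def using T_bc by (simp add: Bcontfun_inverse)
  \<comment> \<open>Integrating \<open>exp (K s)\<close> gains the factor \<open>1 / K\<close>, which beats the Lipschitz and kernel constants.\<close>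
  have S_contract: "\<bar>S \<Psi> (e, r) - S \<Phi> (e, r)\<bar> \<le> 1 / 2 * dist \<Psi> \<Phi>" if e: "e \<in> {e0..e1}" and r: "r \<in> {0..1}" for \<Psi> \<Phi> e r
  proof -
    define d where "d = dist \<Psi> \<Phi>"
    have d: "d \<ge> 0" by (simp add: d_def)
    have bA: "\<bar>A \<Psi> e s - A \<Phi> e s\<bar> \<le> 2 ^ N * (L * (exp (K * s) * d))" if s: "s \<in> {0..1}" for s
      unfolding A_def
    proof (rule polar_avg_diff_bound[OF N slice[OF cv e] slice[OF cv e] s])
      fix x assume x: "x \<in> {0..s}"
      have "\<bar>v \<Psi> e x - v \<Phi> e x\<bar> \<le> L * \<bar>exp (K * x) * (apply_bcontfun \<Psi> (e, x) - apply_bcontfun \<Phi> (e, x))\<bar>"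
        unfolding v_def right_diff_distrib by (rule lip[OF e])
      also have "\<dots> = L * (exp (K * x) * dist (apply_bcontfun \<Psi> (e, x)) (apply_bcontfun \<Phi> (e, x)))"
        by (simp add: abs_mult dist_real_def)
      also have "\<dots> \<le> L * (exp (K * s) * d)"
        unfolding d_def using x K L by (intro mult_left_mono mult_mono dist_bounded) auto
      finally show "\<bar>v \<Psi> e x - v \<Phi> e x\<bar> \<le> L * (exp (K * s) * d)" .
    qed
    have iA: "A X e integrable_on {0..r}" for X
      by (rule integrable_continuous_interval, rule continuous_on_subset[OF slice[OF cA e]]) (use r in auto)
    have ie: "((\<lambda>s. 2 ^ N * (L * (exp (K * s) * d))) has_integral
        (2 ^ N * L * d / K * exp (K * r) - 2 ^ N * L * d / K * exp (K * 0))) {0..r}"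
      using r K by (intro fundamental_theorem_of_calculus)
        (auto intro!: derivative_eq_intros simp: has_real_derivative_iff_has_vector_derivative[symmetric])
    have "\<bar>J \<Psi> e r - J \<Phi> e r\<bar> = norm (integral {0..r} (\<lambda>s. A \<Psi> e s - A \<Phi> e s))"
      unfolding J_def by (simp add: integral_diff iA)
    also have "\<dots> \<le> integral {0..r} (\<lambda>s. 2 ^ N * (L * (exp (K * s) * d)))"
      using bA r by (intro integral_norm_bound_integral integrable_diff iA has_integral_integrable[OF ie]) auto
    also have "\<dots> \<le> (2 ^ N * L / K) * (d * exp (K * r))"
      unfolding integral_unique[OF ie] using K L d by (simp add: field_simps)
    also have "\<dots> \<le> 1 / 2 * (d * exp (K * r))"
      using d by (intro mult_right_mono LK) auto
    finally have *: "\<bar>J \<Psi> e r - J \<Phi> e r\<bar> \<le> 1 / 2 * d * exp (K * r)" by simp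
    have "\<bar>S \<Psi> (e, r) - S \<Phi> (e, r)\<bar> = exp (- K * r) * \<bar>J \<Psi> e r - J \<Phi> e r\<bar>"
      by (simp add: S_def right_diff_distrib[symmetric] abs_mult abs_minus_commute del: exp_minus)
    also have "\<dots> \<le> exp (- K * r) * (1 / 2 * d * exp (K * r))"
      by (intro mult_left_mono *) auto
    also have "\<dots> = 1 / 2 * d" by (simp add: exp_minus)
    finally show ?thesis by (simp add: d_def)
  qed
  have "dist (T \<Psi>) (T \<Phi>) \<le> 1 / 2 * dist \<Psi> \<Phi>" for \<Psi> \<Phi>
  proof (rule dist_bound)
    fix p
    obtain e r where er: "cl p = (e, r)" by fastforce
    then show "dist (apply_bcontfun (T \<Psi>) p) (apply_bcontfun (T \<Phi>) p) \<le> 1 / 2 * dist \<Psi> \<Phi>"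
      using S_contract[of e r \<Psi> \<Phi>] cl_in[of p] by (simp add: T dist_real_def)
  qed
  then obtain \<Psi> where fix_point: "T \<Psi> = \<Psi>"
    using banach_fix_type[of "1/2" T] by auto
  define \<phi> where "\<phi> = (\<lambda>e r. exp (K * r) * apply_bcontfun \<Psi> (e, r))"
  define \<phi>' where "\<phi>' = (\<lambda>e r. - A \<Psi> e r)"
  have \<phi>_eq: "\<phi> e r = 1 - J \<Psi> e r" if "e \<in> {e0..e1}" "r \<in> {0..1}" for e r
  proof -
    have "apply_bcontfun \<Psi> (e, r) = S \<Psi> (e, r)"
      using T[of \<Psi> "(e, r)"] cl_id[of "(e, r)"] that by (simp add: fix_point)
    then show ?thesis by (simp add: \<phi>_def S_def mult.assoc[symmetric] exp_minus)
  qed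
  have v_\<phi>: "v \<Psi> e = (\<lambda>s. H e (\<phi> e s))" for e by (simp add: v_def \<phi>_def)
  show ?thesis
  proof (rule that)
    show "continuous_on ({e0..e1} \<times> {0..1}) (\<lambda>(e, r). \<phi> e r)"
      unfolding \<phi>_def case_prod_unfold by (auto intro!: continuous_intros)
    show "continuous_on ({e0..e1} \<times> {0..1}) (\<lambda>(e, r). \<phi>' e r)"
      using cA[of \<Psi>] unfolding \<phi>'_def case_prod_unfold by (intro continuous_intros)
    fix e assume e: "e \<in> {e0..e1}"
    have "(\<phi> e has_real_derivative \<phi>' e r) (at r within {0..1})" if r: "r \<in> {0..1}" for r
    proof -
      have "((\<lambda>r. 1 - integral {0..r} (A \<Psi> e)) has_real_derivative 0 - A \<Psi> e r) (at r within {0..1})"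
        by (intro DERIV_diff DERIV_const integral_has_real_derivative[OF slice[OF cA e] r])
      then have "((\<lambda>r. 1 - integral {0..r} (A \<Psi> e)) has_real_derivative \<phi>' e r) (at r within {0..1})"
        by (simp add: \<phi>'_def)
      then show ?thesis
        by (rule has_field_derivative_transform_within[OF _ zero_less_one r])
          (use \<phi>_eq[OF e] in \<open>simp add: J_def\<close>)
    qed
    moreover have "continuous_on {0..1} (\<phi>' e)"
      unfolding \<phi>'_def by (intro continuous_intros slice[OF cA e])
    moreover have "(\<phi>' e has_real_derivative
        - (H e (\<phi> e r) + real N * (1 - r) * \<phi>' e r) / (r * (2 - r))) (at r within {0..1})"
      if r: "r \<in> {0<..1}" for r
    proof -
      have "((\<lambda>r. - A \<Psi> e r) has_real_derivative
          - ((v \<Psi> e r - real N * (1 - r) * A \<Psi> e r) / (r * (2 - r)))) (at r within {0..1})"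
        unfolding A_def by (intro DERIV_minus polar_avg_deriv[OF N slice[OF cv e] r])
      then show ?thesis
        unfolding \<phi>'_def v_\<phi> by (rule DERIV_cong) (simp add: minus_divide_left)
    qed
    moreover have "\<phi> e 0 = 1" using \<phi>_eq[OF e, of 0] by (simp add: J_def)
    ultimately show "axial_solution N (H e) (\<phi> e) (\<phi>' e) \<and> \<phi> e 0 = 1"
      by (simp add: axial_solution_def)
  qed
qed

section \<open>Regularity at the pole\<close>

text \<open>
  Differentiating \<open>r (2 - r) w' + N (1 - r) w = - u\<close> gives an equation of the same type for \<open>w'\<close> with
  \<open>N + 2\<close> in place of \<open>N\<close> and \<open>u' - N w\<close> in place of \<open>u\<close>.  So \<open>w'\<close> has to be the polar average of
  \<open>N w - u'\<close>, which is continuous up to the pole.  As the conclusion has the form of the hypothesis, the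
  lemma can be iterated.
\<close>

lemma pole_regularity:
  assumes N: "N \<ge> 2" and w: "continuous_on {0..1} w"
    and u: "\<And>r. r \<in> {0..1} \<Longrightarrow> (u has_real_derivative u' r) (at r within {0..1})"
    and u': "continuous_on {0..1} u'"
    and w': "\<And>r. r \<in> {0<..1} \<Longrightarrow>
      (w has_real_derivative - (u r + real N * (1 - r) * w r) / (r * (2 - r))) (at r within {0..1})"
  obtains z where "continuous_on {0..1} z"
    "\<And>r. r \<in> {0..1} \<Longrightarrow> (w has_real_derivative z r) (at r within {0..1})"
    "\<And>r. r \<in> {0<..1} \<Longrightarrow> (z has_real_derivative
      - ((u' r - real N * w r) + real (N + 2) * (1 - r) * z r) / (r * (2 - r))) (at r within {0..1})"
proof -
  obtain m where m: "N = Suc (Suc m)" using N two_le_Suc_Suc by blast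
  define b where "b = (\<lambda>r. real N * w r - u' r)"
  have b: "continuous_on {0..1} b" unfolding b_def by (intro continuous_intros w u')
  define z where "z = polar_avg (N + 2) b"
  have z: "continuous_on {0..1} z" unfolding z_def by (rule polar_avg_continuous1[OF b])
  define g where "g = (\<lambda>r. - (u r + real N * (1 - r) * w r))"
  have uc: "continuous_on {0..1} u" using u by (rule DERIV_continuous_on)
  have Ic: "continuous_on {0..1} (\<lambda>r. integral {0..r} h)" if "continuous_on {0..1} h" for h :: "real \<Rightarrow> real"
    using integral_has_real_derivative[OF that] by (rule DERIV_continuous_on)
  have wz: "g r = r * (2 - r) * z r" if r: "r \<in> {0<..1}" for r
  proof -
    \<comment> \<open>Both sides of the claim, multiplied by \<open>Q r ^ N\<close>, vanish at 0 and have the same derivative.\<close>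
    let ?h = "\<lambda>r. Q r ^ N * g r - integral {0..r} (\<lambda>x. Q x ^ N * b x)"
    have "?h r = ?h 0"
    proof (rule DERIV_isconst_end[where f = ?h])
      show "continuous_on {0..r} ?h"
        by (rule continuous_on_subset[of "{0..1}"], unfold g_def)
          (use r in \<open>auto intro!: continuous_intros Ic b uc w\<close>)
      fix x assume x: "0 < x" "x < r"
      then have x': "x \<in> {0<..1}" "x \<in> {0..1}" and at: "at x within {0..1} = at x"
        using r by (auto intro: at_within_Icc_at)
      have Qx: "Q x > 0" "(Q x)\<^sup>2 = x * (2 - x)" using x' by (auto intro: Q_pos Q_sq)
      have l: "((\<lambda>r. real N * (1 - r)) has_real_derivative - real N) (at x within {0..1})"
        by (auto intro!: derivative_eq_intros)
      have g': "(g has_real_derivative - (u' x + (- real N * w x + g x / (x * (2 - x)) * (real N * (1 - x)))))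
          (at x within {0..1})"
        using DERIV_minus[OF DERIV_add[OF u[OF x'(2)] DERIV_mult[OF l w'[OF x'(1)]]]]
        unfolding g_def .
      have I': "((\<lambda>r. integral {0..r} (\<lambda>x. Q x ^ N * b x)) has_real_derivative Q x ^ N * b x) (at x within {0..1})"
        by (rule integral_has_real_derivative[OF _ x'(2)]) (intro continuous_intros b)
      have "x \<le> 1" using x' by simp
      have "real N * (1 - x) * Q x ^ (N - 2) * g x
          + - (u' x + (- real N * w x + g x / (x * (2 - x)) * (real N * (1 - x)))) * Q x ^ N
          - Q x ^ N * b x = 0"
        unfolding b_def Qx(2)[symmetric] using Qx(1) by (simp add: m power2_eq_square field_simps)
      with DERIV_diff[OF DERIV_mult[OF Q_power_deriv[OF x(1) \<open>x \<le> 1\<close> N] g'] I']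
      show "(?h has_real_derivative 0) (at x)" by (simp only: at)
    qed (use r in auto)
    then have "Q r ^ N * g r = integral {0..r} (\<lambda>x. Q x ^ N * b x)"
      by (simp add: Q_def m)
    also have "\<dots> = Q r ^ (N + 2) * z r"
      using polar_avg_integral[of "N + 2" b r] b r by (simp add: z_def)
    finally have "Q r ^ N * g r = Q r ^ N * ((Q r)\<^sup>2 * z r)" by (simp add: power_add power2_eq_square mult.assoc)
    moreover have "Q r > 0" "(Q r)\<^sup>2 = r * (2 - r)" using r by (auto intro: Q_pos Q_sq)
    ultimately show ?thesis by simp
  qed
  have w_eq: "w r = w 0 + integral {0..r} z" if r: "r \<in> {0..1}" for r
  proof (cases "r = 0")
    case False
    have "w r - integral {0..r} z = w 0 - integral {0..0} z"
    proof (rule DERIV_isconst_end[where f = "\<lambda>r. w r - integral {0..r} z"])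
      show "continuous_on {0..r} (\<lambda>r. w r - integral {0..r} z)"
        by (rule continuous_on_subset[of "{0..1}"]) (use r in \<open>auto intro!: continuous_intros Ic z w\<close>)
      fix x assume x: "0 < x" "x < r"
      then have x': "x \<in> {0<..1}" "x \<in> {0..1}" and at: "at x within {0..1} = at x"
        using r by (auto intro: at_within_Icc_at)
      have "((\<lambda>r. w r - integral {0..r} z) has_real_derivative g x / (x * (2 - x)) - z x) (at x within {0..1})"
        using w'[OF x'(1)] unfolding g_def by (intro DERIV_diff integral_has_real_derivative[OF z x'(2)])
      then show "((\<lambda>r. w r - integral {0..r} z) has_real_derivative 0) (at x)"
        using wz[OF x'(1)] x' by (simp add: at)
    qed (use r False in auto)
    then show ?thesis by simp
  qed simp
  show ?thesis
  proof (rule that[of z])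
    show "(w has_real_derivative z r) (at r within {0..1})" if r: "r \<in> {0..1}" for r
    proof -
      have "((\<lambda>r. w 0 + integral {0..r} z) has_real_derivative 0 + z r) (at r within {0..1})"
        by (intro DERIV_add DERIV_const integral_has_real_derivative[OF z r])
      then have "((\<lambda>r. w 0 + integral {0..r} z) has_real_derivative z r) (at r within {0..1})" by simp
      then show ?thesis
        by (rule has_field_derivative_transform_within[OF _ zero_less_one r]) (rule w_eq[symmetric])
    qed
    show "(z has_real_derivative
      - ((u' r - real N * w r) + real (N + 2) * (1 - r) * z r) / (r * (2 - r))) (at r within {0..1})"
      if "r \<in> {0<..1}" for r
    proof -
      have "2 \<le> N + 2" by simp
      from polar_avg_deriv[OF this b that] show ?thesis
        unfolding z_def by (rule DERIV_cong) (simp add: b_def)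
    qed
  qed (rule z)
qed

text \<open>
  Two applications of \<open>pole_regularity\<close>, to \<open>y'\<close> and to \<open>y''\<close>, give a bounded third derivative.  The
  equation at the pole itself follows by continuity.
\<close>

lemma axial_solution_regular:
  assumes N: "N \<ge> 2" and sol: "axial_solution N f y y'"
    and f: "\<And>r. r \<in> {0..1} \<Longrightarrow> (f has_real_derivative f' (y r)) (at (y r))"
    and f': "\<And>r. r \<in> {0..1} \<Longrightarrow> (f' has_real_derivative f'' (y r)) (at (y r))"
    and f'': "continuous_on {0..1} (\<lambda>r. f'' (y r))"
  obtains y2 L where "\<And>r. r \<in> {0..1} \<Longrightarrow> (y' has_real_derivative y2 r) (at r within {0..1})"
    "\<And>r. r \<in> {0..1} \<Longrightarrow> r * (2 - r) * y2 r + real N * (1 - r) * y' r + f (y r) = 0"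
    "\<And>r s. r \<in> {0..1} \<Longrightarrow> s \<in> {0..1} \<Longrightarrow> \<bar>y2 r - y2 s\<bar> \<le> L * \<bar>r - s\<bar>"
proof -
  have y: "\<And>r. r \<in> {0..1} \<Longrightarrow> (y has_real_derivative y' r) (at r within {0..1})"
    and y'c: "continuous_on {0..1} y'"
    and y': "\<And>r. r \<in> {0<..1} \<Longrightarrow> (y' has_real_derivative
       - (f (y r) + real N * (1 - r) * y' r) / (r * (2 - r))) (at r within {0..1})"
    using sol by (auto simp: axial_solution_def)
  have fy: "((\<lambda>r. f (y r)) has_real_derivative f' (y r) * y' r) (at r within {0..1})" if "r \<in> {0..1}" for r
    by (rule DERIV_chain2[OF f[OF that] y[OF that]])
  have f'y: "((\<lambda>r. f' (y r)) has_real_derivative f'' (y r) * y' r) (at r within {0..1})" if "r \<in> {0..1}" for r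
    by (rule DERIV_chain2[OF f'[OF that] y[OF that]])
  have f'c: "continuous_on {0..1} (\<lambda>r. f' (y r))" using f'y by (rule DERIV_continuous_on)
  have fc: "continuous_on {0..1} (\<lambda>r. f (y r))" using fy by (rule DERIV_continuous_on)
  obtain z where z: "continuous_on {0..1} z"
    "\<And>r. r \<in> {0..1} \<Longrightarrow> (y' has_real_derivative z r) (at r within {0..1})"
    "\<And>r. r \<in> {0<..1} \<Longrightarrow> (z has_real_derivative
      - ((f' (y r) * y' r - real N * y' r) + real (N + 2) * (1 - r) * z r) / (r * (2 - r))) (at r within {0..1})"
    by (rule pole_regularity[OF N y'c fy continuous_on_mult[OF f'c y'c] y'])
      (assumption, assumption, rule that)
  have d: "((\<lambda>r. f' (y r) * y' r - real N * y' r) has_real_derivative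
      (f'' (y r) * y' r * y' r + z r * f' (y r)) - real N * z r) (at r within {0..1})" if "r \<in> {0..1}" for r
    by (intro DERIV_diff DERIV_mult DERIV_cmult f'y z that)
  obtain x where x: "continuous_on {0..1} x"
    "\<And>r. r \<in> {0..1} \<Longrightarrow> (z has_real_derivative x r) (at r within {0..1})"
  proof (rule pole_regularity[OF _ z(1) d _ z(3)])
    show "continuous_on {0..1} (\<lambda>r. f'' (y r) * y' r * y' r + z r * f' (y r) - real N * z r)"
      by (intro continuous_intros z(1) y'c f'c f'')
  qed auto
  have "compact (x ` {0..1})" by (intro compact_continuous_image x) auto
  then obtain L where L: "\<And>r. r \<in> {0..1} \<Longrightarrow> norm (x r) \<le> L"
    using compact_imp_bounded bounded_iff by (metis imageI)
  have "\<bar>z r - z s\<bar> \<le> L * \<bar>r - s\<bar>" if "r \<in> {0..1}" "s \<in> {0..1}" for r s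
    using field_differentiable_bound[of "{0..1}", OF _ x(2) L] that by simp
  moreover have "r * (2 - r) * z r + real N * (1 - r) * y' r + f (y r) = 0" if r: "r \<in> {0..1}" for r
  proof -
    let ?g = "\<lambda>r. r * (2 - r) * z r + real N * (1 - r) * y' r + f (y r)"
    have pos: "?g r = 0" if "r \<in> {0<..1}" for r
    proof -
      have "(y' has_real_derivative z r) (at r within {0..1})" using z(2) that by auto
      from has_field_derivative_unique[OF this y'[OF that]] that
      have "z r = - (f (y r) + real N * (1 - r) * y' r) / (r * (2 - r))"
        by (simp add: at_within_Icc_at trivial_limit_within islimpt_Icc)
      then show ?thesis using that by (simp add: field_simps)
    qed
    have "?g 0 = 0"
    proof (rule continuous_constant_on_closure[of "{0<..<1}" ?g 0 0])
      show "continuous_on (closure {0<..<1}) ?g"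
        by (auto intro!: continuous_intros z y'c fc)
    qed (use pos in auto)
    with pos r show ?thesis by (cases "r = 0") auto
  qed
  ultimately show ?thesis using that[of z L] z(2) by blast
qed

section \<open>Energy and uniqueness\<close>

definition energy :: "(real \<Rightarrow> real) \<Rightarrow> (real \<Rightarrow> real) \<Rightarrow> (real \<Rightarrow> real) \<Rightarrow> real \<Rightarrow> real" where
  "energy F y y' r = r * (2 - r) * (y' r)\<^sup>2 / 2 + F (y r)"

lemma axial_solutionD:
  assumes "axial_solution N f y y'"
  shows "r \<in> {0..1} \<Longrightarrow> (y has_real_derivative y' r) (at r within {0..1})"
    and "continuous_on {0..1} y" "continuous_on {0..1} y'"
    and "r \<in> {0<..1} \<Longrightarrow> (y' has_real_derivative
       - (f (y r) + real N * (1 - r) * y' r) / (r * (2 - r))) (at r within {0..1})"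
    and "0 < r \<Longrightarrow> r < 1 \<Longrightarrow> (y has_real_derivative y' r) (at r)"
    and "0 < r \<Longrightarrow> r < 1 \<Longrightarrow> (y' has_real_derivative
       - (f (y r) + real N * (1 - r) * y' r) / (r * (2 - r))) (at r)"
proof -
  show y: "r \<in> {0..1} \<Longrightarrow> (y has_real_derivative y' r) (at r within {0..1})" for r
    using assms by (auto simp: axial_solution_def)
  show y': "r \<in> {0<..1} \<Longrightarrow> (y' has_real_derivative
       - (f (y r) + real N * (1 - r) * y' r) / (r * (2 - r))) (at r within {0..1})" for r
    using assms by (auto simp: axial_solution_def)
  show "continuous_on {0..1} y" using y by (rule DERIV_continuous_on)
  show "continuous_on {0..1} y'" using assms by (auto simp: axial_solution_def)
  show "0 < r \<Longrightarrow> r < 1 \<Longrightarrow> (y has_real_derivative y' r) (at r)"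
    using y[of r] by (simp add: at_within_Icc_at)
  show "0 < r \<Longrightarrow> r < 1 \<Longrightarrow> (y' has_real_derivative
       - (f (y r) + real N * (1 - r) * y' r) / (r * (2 - r))) (at r)"
    using y'[of r] by (simp add: at_within_Icc_at)
qed

text \<open>
  Towards the equator the term \<open>N (1 - r) y'\<close> acts as friction: the derivative of the energy is
  \<open>- (N - 1) (1 - r) y'\<^sup>2\<close>.
\<close>

lemma energy_antimono:
  assumes N: "N \<ge> 2" and sol: "axial_solution N f y y'"
    and F: "\<And>w. (F has_real_derivative f w) (at w)"
    and rs: "0 \<le> r" "r \<le> s" "s \<le> 1"
  shows "energy F y y' s \<le> energy F y y' r"
proof (rule DERIV_nonpos_imp_decreasing_open[OF rs(2)])
  note S = axial_solutionD[OF sol]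
  have cF: "continuous_on UNIV F" using F by (intro DERIV_continuous_on) auto
  have "continuous_on {0..1} (energy F y y')"
    unfolding energy_def by (intro continuous_intros S continuous_on_compose2[OF cF]) auto
  then show "continuous_on {r..s} (energy F y y')"
    by (rule continuous_on_subset) (use rs in auto)
  fix x assume "r < x" "x < s"
  then have x: "0 < x" "x < 1" using rs by auto
  let ?y2 = "- (f (y x) + real N * (1 - x) * y' x) / (x * (2 - x))"
  have w: "((\<lambda>x. x * (2 - x)) has_real_derivative 2 - 2 * x) (at x)"
    by (auto intro!: derivative_eq_intros)
  have "((\<lambda>r. r * (2 - r) * (y' r)\<^sup>2 / 2 + F (y r)) has_real_derivative
     ((2 - 2 * x) * (y' x)\<^sup>2 + (real 2 * ?y2 * y' x ^ (2 - Suc 0)) * (x * (2 - x))) / 2 + f (y x) * y' x) (at x)"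
    by (intro DERIV_add DERIV_cdivide DERIV_mult w DERIV_power[of y' ?y2, unfolded mult.assoc[symmetric]] S x DERIV_chain2[OF F])
  moreover have "((2 - 2 * x) * (y' x)\<^sup>2 + (real 2 * ?y2 * y' x ^ (2 - Suc 0)) * (x * (2 - x))) / 2 + f (y x) * y' x
      = - ((real N - 1) * (1 - x) * (y' x)\<^sup>2)"
    using x by (simp add: field_simps power2_eq_square)
  moreover have "- ((real N - 1) * (1 - x) * (y' x)\<^sup>2) \<le> 0"
    using N x by simp
  ultimately show "\<exists>d. (energy F y y' has_real_derivative d) (at x) \<and> d \<le> 0"
    unfolding energy_def by auto
qed

text \<open>
  A rest point in the regular region \<open>r > 0\<close> forces the solution to have been at rest all along.  For
  \<open>D = y'\<^sup>2 + (y - y1)\<^sup>2\<close> the equation gives \<open>D' \<ge> - K D\<close> on \<open>{r0..r1}\<close>, with \<open>K\<close> depending on \<open>r0 > 0\<close> only, so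
  \<open>D exp (K r)\<close> increases to its final value 0.
\<close>

lemma solution_unique_backward:
  assumes sol: "axial_solution N f y y'" and L: "\<And>w. \<bar>f w\<bar> \<le> L * \<bar>w - y1\<bar>"
    and r1: "0 < r1" "r1 \<le> 1" "y r1 = y1" "y' r1 = 0"
  shows "y 0 = y1"
proof -
  note S = axial_solutionD[OF sol]
  have "0 \<le> L * \<bar>(y1 + 1) - y1\<bar>" by (rule order_trans[OF _ L]) simp
  then have L0: "L \<ge> 0" by simp
  have zero: "y r0 = y1" if r0: "0 < r0" "r0 \<le> r1" for r0
  proof -
    define K where "K = (L + 2 * N) / r0 + 1"
    define D where "D = (\<lambda>r. (y' r)\<^sup>2 + (y r - y1)\<^sup>2)"
    have "D r0 * exp (K * r0) \<le> D r1 * exp (K * r1)"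
    proof (rule DERIV_nonneg_imp_increasing_open[OF r0(2)])
      show "continuous_on {r0..r1} (\<lambda>r. D r * exp (K * r))"
        by (rule continuous_on_subset[of "{0..1}"], unfold D_def) (use r0 r1 in \<open>auto intro!: continuous_intros S\<close>)
      fix x assume x: "r0 < x" "x < r1"
      then have x': "0 < x" "x < 1" using r0 r1 by auto
      let ?f = "f (y x)"
      define y2 where "y2 = - (?f + real N * (1 - x) * y' x) / (x * (2 - x))"
      have y2: "(y' has_real_derivative y2) (at x)" unfolding y2_def by (rule S(6)[OF x'])
      have D: "(D has_real_derivative 2 * y2 * y' x + 2 * y' x * (y x - y1)) (at x)"
        unfolding D_def by (auto intro!: derivative_eq_intros y2 S x')
      define d where "d = \<bar>y x - y1\<bar>"
      define p where "p = \<bar>y' x\<bar>"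
      have "\<bar>y2\<bar> \<le> (L * d + N * p) / r0"
      proof -
        have "\<bar>real N * (1 - x) * y' x\<bar> = (real N * (1 - x)) * p"
          using x' by (simp add: abs_mult p_def)
        also have "\<dots> \<le> (real N * 1) * p" using x' by (intro mult_right_mono mult_left_mono) (auto simp: p_def)
        finally have "\<bar>?f + real N * (1 - x) * y' x\<bar> \<le> L * d + N * p"
          using L[of "y x"] by (simp add: d_def)
        moreover have "r0 \<le> x * (2 - x)"
          using mult_mono[of r0 x 1 "2 - x"] x x' r0 by simp
        ultimately have "\<bar>?f + real N * (1 - x) * y' x\<bar> / (x * (2 - x)) \<le> (L * d + N * p) / r0"
          using r0 L0 by (intro frac_le) (auto simp: d_def p_def)
        then show ?thesis using x' by (simp only: y2_def abs_divide abs_minus_cancel) (simp add: abs_mult)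
      qed
      then have "\<bar>y2\<bar> * (2 * p) \<le> ((L * d + N * p) / r0) * (2 * p)"
        by (rule mult_right_mono) (simp add: p_def)
      moreover have "\<bar>2 * y2 * y' x\<bar> = \<bar>y2\<bar> * (2 * p)" by (simp add: abs_mult p_def)
      ultimately have "\<bar>2 * y2 * y' x\<bar> \<le> ((L * d + N * p) / r0) * (2 * p)" by simp
      also have "\<dots> = (L * (2 * (d * p)) + 2 * N * (p * p)) / r0" by (simp add: algebra_simps)
      also have "\<dots> \<le> (L * (d * d + p * p) + 2 * N * (d * d + p * p)) / r0"
        using L0 r0 zero_le_square[of "d - p"] by (intro divide_right_mono add_mono mult_left_mono) (auto simp: algebra_simps)
      finally have 1: "\<bar>2 * y2 * y' x\<bar> \<le> (L + 2 * N) / r0 * (d * d + p * p)"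
        by (simp add: algebra_simps)
      have "\<bar>2 * y' x * (y x - y1)\<bar> = 2 * (d * p)" by (simp add: abs_mult d_def p_def)
      also have "\<dots> \<le> d * d + p * p" using zero_le_square[of "d - p"] by (simp add: algebra_simps)
      finally have 2: "\<bar>2 * y' x * (y x - y1)\<bar> \<le> d * d + p * p" .
      have "D x = d * d + p * p" by (simp add: D_def d_def p_def power2_eq_square)
      then have "K * D x = (L + 2 * N) / r0 * (d * d + p * p) + (d * d + p * p)"
        by (simp add: K_def distrib_right)
      with 1 2 have "0 \<le> 2 * y2 * y' x + 2 * y' x * (y x - y1) + K * D x" by linarith
      then have "0 \<le> (2 * y2 * y' x + 2 * y' x * (y x - y1) + K * D x) * exp (K * x)" by simp
      moreover have "((\<lambda>r. D r * exp (K * r)) has_real_derivative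
         (2 * y2 * y' x + 2 * y' x * (y x - y1) + K * D x) * exp (K * x)) (at x)"
        by (auto intro!: derivative_eq_intros D simp: algebra_simps)
      ultimately show "\<exists>z. ((\<lambda>r. D r * exp (K * r)) has_real_derivative z) (at x) \<and> 0 \<le> z" by blast
    qed
    also have "D r1 = 0" by (simp add: D_def r1)
    finally have "D r0 \<le> 0" by (simp add: mult_le_0_iff)
    then have "(y r0 - y1)\<^sup>2 \<le> 0" unfolding D_def using zero_le_power2[of "y' r0"] by linarith
    then show ?thesis by simp
  qed
  show ?thesis
  proof (rule continuous_constant_on_closure[of "{0<..<r1}" y y1 0])
    show "continuous_on (closure {0<..<r1}) y"
      by (rule continuous_on_subset[OF S(2)]) (use r1 in auto)
  qed (use zero r1 in auto)
qed

text \<open>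
  Uniqueness across the singular point \<open>r = 0\<close>.  With \<open>D = r (2 - r) y'\<^sup>2 + (L + 1) (y - y 0)\<^sup>2\<close> the friction term
  has a good sign and what remains is bounded by \<open>c D / sqrt r\<close>.  This singularity is integrable, so
  \<open>D exp (- 2 c sqrt r)\<close> decreases from its initial value 0.
\<close>

lemma solution_unique_forward:
  assumes N: "N \<ge> 1" and sol: "axial_solution N f y y'" and L: "\<And>w. \<bar>f w\<bar> \<le> L * \<bar>w - y 0\<bar>"
    and r: "r \<in> {0<..1}"
  shows "y r = y 0" "y' r = 0"
proof -
  note S = axial_solutionD[OF sol]
  define y1 where "y1 = y 0"
  have "0 \<le> L * \<bar>(y1 + 1) - y1\<bar>" unfolding y1_def by (rule order_trans[OF _ L]) simp
  then have L0: "L \<ge> 0" by simp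
  define c where "c = 2 * L + 1"
  define D where "D = (\<lambda>r. r * (2 - r) * (y' r)\<^sup>2 + (L + 1) * (y r - y1)\<^sup>2)"
  have "D r * exp (- 2 * c * sqrt r) \<le> D 0 * exp (- 2 * c * sqrt 0)"
  proof (rule DERIV_nonpos_imp_decreasing_open[where f = "\<lambda>r. D r * exp (- 2 * c * sqrt r)"])
    show "0 \<le> r" using r by simp
    show "continuous_on {0..r} (\<lambda>r. D r * exp (- 2 * c * sqrt r))"
      by (rule continuous_on_subset[of "{0..1}"], unfold D_def) (use r in \<open>auto intro!: continuous_intros S\<close>)
    fix x assume "0 < x" "x < r"
    then have x: "0 < x" "x < 1" using r by auto
    let ?f = "f (y x)"
    define y2 where "y2 = - (?f + real N * (1 - x) * y' x) / (x * (2 - x))"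
    have y2: "(y' has_real_derivative y2) (at x)" unfolding y2_def by (rule S(6)[OF x])
    have xy2: "x * (2 - x) * y2 = - (?f + real N * (1 - x) * y' x)"
      using x by (simp add: y2_def)
    define D' where "D' = (2 - 2 * x) * (y' x)\<^sup>2 + 2 * (x * (2 - x) * y2) * y' x + 2 * (L + 1) * y' x * (y x - y1)"
    have D: "(D has_real_derivative D') (at x)"
      unfolding D_def D'_def by (auto intro!: derivative_eq_intros y2 S x simp: algebra_simps power2_eq_square)
    define d where "d = \<bar>y x - y1\<bar>"
    define p where "p = \<bar>y' x\<bar>"
    have "D' = - (2 * (real N - 1) * (1 - x) * (y' x)\<^sup>2) + 2 * y' x * ((L + 1) * (y x - y1) - ?f)"
      unfolding D'_def xy2 by (simp add: algebra_simps power2_eq_square)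
    also have "\<dots> \<le> 0 + \<bar>2 * y' x * ((L + 1) * (y x - y1) - ?f)\<bar>"
      using N x by (intro add_mono) auto
    also have "\<dots> = 2 * p * \<bar>(L + 1) * (y x - y1) - ?f\<bar>" by (simp add: abs_mult p_def)
    also have "\<dots> \<le> 2 * p * (c * d)"
    proof (intro mult_left_mono)
      have "\<bar>(L + 1) * (y x - y1) - ?f\<bar> \<le> \<bar>(L + 1) * (y x - y1)\<bar> + \<bar>?f\<bar>" by (rule abs_triangle_ineq4)
      also have "\<dots> \<le> (L + 1) * d + L * d"
        using L[of "y x"] L0 by (simp add: abs_mult d_def y1_def)
      finally show "\<bar>(L + 1) * (y x - y1) - ?f\<bar> \<le> c * d" by (simp add: c_def algebra_simps)
    qed (auto simp: p_def)
    finally have D'_le: "D' \<le> c * (2 * p * d)" by (simp add: mult_ac)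
    have sx: "sqrt x > 0" "sqrt x * sqrt x = x" using x by auto
    have "sqrt x * (2 * p * d) \<le> (sqrt x * p)\<^sup>2 + d\<^sup>2"
      using zero_le_power2[of "sqrt x * p - d"] by (simp add: power2_diff algebra_simps)
    also have "(sqrt x * p)\<^sup>2 = x * (y' x)\<^sup>2" using x by (simp add: power_mult_distrib p_def)
    also have "x * (y' x)\<^sup>2 + d\<^sup>2 \<le> x * (2 - x) * (y' x)\<^sup>2 + (L + 1) * (y x - y1)\<^sup>2"
    proof (intro add_mono)
      show "x * (y' x)\<^sup>2 \<le> x * (2 - x) * (y' x)\<^sup>2" using x by (intro mult_right_mono) auto
      have "1 * (y x - y1)\<^sup>2 \<le> (L + 1) * (y x - y1)\<^sup>2" using L0 by (intro mult_right_mono) auto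
      then show "d\<^sup>2 \<le> (L + 1) * (y x - y1)\<^sup>2" by (simp add: d_def)
    qed
    also have "\<dots> = D x" by (simp add: D_def)
    finally have "2 * p * d \<le> D x / sqrt x" using sx by (simp add: field_simps)
    then have "c * (2 * p * d) \<le> c * (D x / sqrt x)" using L0 by (intro mult_left_mono) (auto simp: c_def)
    with D'_le have "D' - c * D x / sqrt x \<le> 0" by simp
    then have "(D' - c * D x / sqrt x) * exp (- 2 * c * sqrt x) \<le> 0" by (simp add: mult_le_0_iff)
    moreover have "((\<lambda>r. D r * exp (- 2 * c * sqrt r)) has_real_derivative
        (D' - c * D x / sqrt x) * exp (- 2 * c * sqrt x)) (at x)"
      using x sx by (auto intro!: derivative_eq_intros D simp: field_simps)
    ultimately show "\<exists>z. ((\<lambda>r. D r * exp (- 2 * c * sqrt r)) has_real_derivative z) (at x) \<and> z \<le> 0" by blast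
  qed
  also have "D 0 = 0" by (simp add: D_def y1_def)
  finally have "D r \<le> 0" by (simp add: mult_le_0_iff)
  moreover have "0 \<le> r * (2 - r) * (y' r)\<^sup>2" "0 \<le> (L + 1) * (y r - y1)\<^sup>2"
    using r L0 by auto
  ultimately have "r * (2 - r) * (y' r)\<^sup>2 = 0" "(L + 1) * (y r - y1)\<^sup>2 = 0"
    unfolding D_def by linarith+
  then show "y r = y 0" "y' r = 0" using r L0 by (auto simp: y1_def)
qed

section \<open>Rotation in the phase plane\<close>

text \<open>
  A continuous choice of the angle of the point \<open>(y, - Q y')\<close>, starting from 0 at the pole.  The sign of the
  second coordinate makes zeros of \<open>y\<close> correspond to counterclockwise crossings.
\<close>

definition phase_angle :: "(real \<Rightarrow> real) \<Rightarrow> (real \<Rightarrow> real) \<Rightarrow> (real \<Rightarrow> real) \<Rightarrow> bool" where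
  "phase_angle y y' \<rho> \<longleftrightarrow> continuous_on {0..1} \<rho> \<and> \<rho> 0 = 0 \<and>
     (\<forall>r\<in>{0..1}. \<exists>R>0. y r = R * cos (\<rho> r) \<and> - Q r * y' r = R * sin (\<rho> r))"

text \<open>
  The rectangle is contractible, so the nowhere vanishing complex function \<open>y - i Q y'\<close> has a continuous
  logarithm on it, whose imaginary part depends continuously on the parameter as well.
\<close>

lemma phase_angle_family:
  fixes e0 e1 :: real
  assumes c: "continuous_on ({e0..e1} \<times> {0..1}) (\<lambda>(e, r). y e r)"
    and c': "continuous_on ({e0..e1} \<times> {0..1}) (\<lambda>(e, r). y' e r)"
    and init: "\<And>e. e \<in> {e0..e1} \<Longrightarrow> y e 0 = 1"
    and nz: "\<And>e r. e \<in> {e0..e1} \<Longrightarrow> r \<in> {0<..1} \<Longrightarrow> y e r = 0 \<Longrightarrow> y' e r \<noteq> 0"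
  obtains \<rho> where "continuous_on ({e0..e1} \<times> {0..1}) (\<lambda>(e, r). \<rho> e r)"
    "\<And>e. e \<in> {e0..e1} \<Longrightarrow> phase_angle (y e) (y' e) (\<rho> e)"
proof -
  define Z where "Z = (\<lambda>p. Complex (y (fst p) (snd p)) (- Q (snd p) * y' (fst p) (snd p)))"
  let ?D = "{e0..e1} \<times> {0..(1::real)}"
  have "continuous_on ?D Z"
    unfolding Z_def Complex_eq
    by (intro continuous_intros c[unfolded case_prod_unfold] c'[unfolded case_prod_unfold]
        continuous_on_compose2[OF continuous_Q]) auto
  moreover have "contractible ?D"
    by (intro convex_imp_contractible convex_Times) auto
  moreover have "Z p \<noteq> 0" if "p \<in> ?D" for p
  proof (cases "snd p = 0")
    case True
    then show ?thesis using that init[of "fst p"] by (auto simp: Z_def complex_eq_iff)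
  next
    case False
    then have "snd p \<in> {0<..1}" "fst p \<in> {e0..e1}" using that by auto
    moreover from this have "Q (snd p) > 0" by (auto intro: Q_pos)
    ultimately show ?thesis using nz[of "fst p" "snd p"] by (auto simp: Z_def complex_eq_iff)
  qed
  ultimately obtain g where g: "continuous_on ?D g" "\<And>p. p \<in> ?D \<Longrightarrow> Z p = exp (g p)"
    using continuous_logarithm_on_contractible by metis
  define \<rho> where "\<rho> = (\<lambda>e r. Im (g (e, r)) - Im (g (e, 0)))"
  show ?thesis
  proof (rule that[of \<rho>])
    have 0: "continuous_on ?D (\<lambda>p. g (fst p, 0))"
      by (rule continuous_on_compose2[OF g(1)]) (auto intro!: continuous_intros)
    show c\<rho>: "continuous_on ?D (\<lambda>(e, r). \<rho> e r)"
      unfolding \<rho>_def case_prod_unfold by (intro continuous_intros g 0) (simp add: g)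
    fix e assume e: "e \<in> {e0..e1}"
    have "continuous_on {0..1} (\<rho> e)"
      using continuous_on_compose2[OF c\<rho>, of "{0..1}" "\<lambda>s. (e, s)"] e
      by (force intro!: continuous_intros)
    moreover have "\<exists>R>0. y e r = R * cos (\<rho> e r) \<and> - Q r * y' e r = R * sin (\<rho> e r)" if r: "r \<in> {0..1}" for r
    proof -
      have "Z (e, 0) = 1" using init[OF e] by (simp add: Z_def Q_def complex_eq_iff)
      then have "exp (g (e, 0)) = 1" using g(2)[of "(e, 0)"] e by simp
      then have "Z (e, r) = exp (g (e, r) - g (e, 0))"
        using g(2)[of "(e, r)"] e r by (simp add: exp_diff)
      then have "Re (Z (e, r)) = exp (Re (g (e, r) - g (e, 0))) * cos (\<rho> e r)"
        "Im (Z (e, r)) = exp (Re (g (e, r) - g (e, 0))) * sin (\<rho> e r)"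
        by (simp_all add: Re_exp Im_exp \<rho>_def)
      then show ?thesis
        by (intro exI[of _ "exp (Re (g (e, r) - g (e, 0)))"]) (simp add: Z_def)
    qed
    ultimately show "phase_angle (y e) (y' e) (\<rho> e)"
      unfolding phase_angle_def by (simp add: \<rho>_def)
  qed
qed

lemma phase_angle_exists:
  assumes "continuous_on {0..1} y" "continuous_on {0..1} y'" "y 0 = 1"
    and "\<And>r. r \<in> {0<..1} \<Longrightarrow> y r = 0 \<Longrightarrow> y' r \<noteq> 0"
  obtains \<rho> where "phase_angle y y' \<rho>"
proof (rule phase_angle_family[of 0 0 "\<lambda>_. y" "\<lambda>_. y'"])
  show "continuous_on ({0..0} \<times> {0..1}) (\<lambda>(e, r). y r)"
    unfolding case_prod_unfold by (intro continuous_on_compose2[OF assms(1)] continuous_intros) auto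
  show "continuous_on ({0..0} \<times> {0..1}) (\<lambda>(e, r). y' r)"
    unfolding case_prod_unfold by (intro continuous_on_compose2[OF assms(2)] continuous_intros) auto
  fix \<rho> assume "\<And>e::real. e \<in> {0..0} \<Longrightarrow> phase_angle y y' (\<rho> e)"
  then show thesis using that[of "\<rho> 0"] by simp
qed (use assms in auto)

lemma phase_angleE:
  assumes "phase_angle y y' \<rho>" "r \<in> {0..1}"
  obtains R where "R > 0" "y r = R * cos (\<rho> r)" "- Q r * y' r = R * sin (\<rho> r)"
  using assms unfolding phase_angle_def by blast

lemma continuous_near:
  assumes "continuous_on S (f :: real \<Rightarrow> real)" "x \<in> S" "\<epsilon> > 0"
  obtains d where "d > 0" "\<And>y. y \<in> S \<Longrightarrow> \<bar>y - x\<bar> < d \<Longrightarrow> \<bar>f y - f x\<bar> < \<epsilon>"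
  using assms unfolding continuous_on_iff dist_real_def by metis

lemma sin_pos_small: "\<bar>d\<bar> < pi \<Longrightarrow> sin d > 0 \<Longrightarrow> d > 0"
  using sin_ge_zero[of "-d"] by (cases "d \<le> 0") auto

text \<open>
  At a zero of \<open>y\<close> the sign of \<open>y'\<close> is opposite to that of the sine of the angle, so \<open>y\<close> changes sign in the
  way that makes the angle increase.
\<close>

lemma phase_angle_crossing:
  assumes ang: "phase_angle y y' \<rho>" and r0: "r0 \<in> {0<..1}" and cos0: "cos (\<rho> r0) = 0"
    and y: "(y has_real_derivative y' r0) (at r0 within {0..1})"
  obtains d where "d > 0"
    "\<And>r. r \<in> {0..1} \<Longrightarrow> r0 - d < r \<Longrightarrow> r < r0 \<Longrightarrow> \<rho> r < \<rho> r0"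
    "\<And>r. r \<in> {0..1} \<Longrightarrow> r0 < r \<Longrightarrow> r < r0 + d \<Longrightarrow> \<rho> r0 < \<rho> r"
proof -
  have r0': "r0 \<in> {0..1}" using r0 by auto
  obtain R where R: "R > 0" "y r0 = R * cos (\<rho> r0)" "- Q r0 * y' r0 = R * sin (\<rho> r0)"
    using phase_angleE[OF ang r0'] .
  define s where "s = sin (\<rho> r0)"
  have ss: "s * s = 1"
    using sin_cos_squared_add[of "\<rho> r0"] cos0 by (simp add: s_def power2_eq_square)
  have "Q r0 > 0" using r0 by (auto intro: Q_pos)
  moreover have "- s * (Q r0 * y' r0) = R * (s * s)"
    using arg_cong[OF R(3), of "\<lambda>x. s * x"] by (simp add: s_def mult_ac)
  ultimately have "- s * y' r0 = R * (s * s) / Q r0"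
    by (simp add: field_simps)
  then have pos: "- s * y' r0 > 0" using ss R(1) \<open>Q r0 > 0\<close> by simp
  have h: "((\<lambda>r. - s * y r) has_real_derivative - s * y' r0) (at r0 within {0..1})"
    by (intro DERIV_cmult y)
  have y0: "y r0 = 0" using R(2) cos0 by simp
  obtain d1 where d1: "d1 > 0" "\<And>h. h > 0 \<Longrightarrow> r0 + h \<in> {0..1} \<Longrightarrow> h < d1 \<Longrightarrow> - s * y (r0 + h) > 0"
    using has_real_derivative_pos_inc_right[OF h pos] y0 by auto
  obtain d2 where d2: "d2 > 0" "\<And>h. h > 0 \<Longrightarrow> r0 - h \<in> {0..1} \<Longrightarrow> h < d2 \<Longrightarrow> - s * y (r0 - h) < 0"
    using has_real_derivative_pos_inc_left[OF h pos] y0 by auto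
  have "continuous_on {0..1} \<rho>" using ang by (simp add: phase_angle_def)
  then obtain d3 where d3: "d3 > 0" "\<And>r. r \<in> {0..1} \<Longrightarrow> \<bar>r - r0\<bar> < d3 \<Longrightarrow> \<bar>\<rho> r - \<rho> r0\<bar> < pi"
    using continuous_near[OF _ r0' pi_gt_zero] by metis
  \<comment> \<open>Near \<open>r0\<close> the sign of \<open>y\<close> is, up to the factor \<open>- s\<close>, the sign of the increment of the angle.\<close>
  have sy: "\<exists>K>0. - s * y r = K * sin (\<rho> r - \<rho> r0)" if rr: "r \<in> {0..1}" for r
  proof -
    obtain K where K: "K > 0" "y r = K * cos (\<rho> r)" using phase_angleE[OF ang rr] by blast
    have "cos (\<rho> r) = cos (\<rho> r0 + (\<rho> r - \<rho> r0))" by simp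
    also have "\<dots> = - s * sin (\<rho> r - \<rho> r0)" unfolding cos_add by (simp add: cos0 s_def)
    finally have "- s * y r = K * (s * s) * sin (\<rho> r - \<rho> r0)" using K by simp
    then show ?thesis using ss K(1) by auto
  qed
  show ?thesis
  proof (rule that[of "min d1 (min d2 d3)"])
    fix r :: real assume r: "r \<in> {0..1}"
    { assume "r0 - min d1 (min d2 d3) < r" "r < r0"
      then have "- s * y r < 0" "\<bar>\<rho> r - \<rho> r0\<bar> < pi"
        using d2(2)[of "r0 - r"] d3(2)[of r] r by auto
      moreover have "sin (\<rho> r0 - \<rho> r) > 0"
      proof -
        obtain K where "K > 0" "- s * y r = K * sin (\<rho> r - \<rho> r0)" using sy[OF r] by blast
        with \<open>- s * y r < 0\<close> have "sin (\<rho> r - \<rho> r0) < 0" by (metis mult_less_cancel_left_pos mult_zero_right)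
        then show ?thesis using sin_minus[of "\<rho> r - \<rho> r0"] by simp
      qed
      ultimately show "\<rho> r < \<rho> r0" using sin_pos_small[of "\<rho> r0 - \<rho> r"] by (simp add: abs_minus_commute) }
    { assume "r0 < r" "r < r0 + min d1 (min d2 d3)"
      then have "- s * y r > 0" "\<bar>\<rho> r - \<rho> r0\<bar> < pi"
        using d1(2)[of "r - r0"] d3(2)[of r] r by auto
      moreover have "sin (\<rho> r - \<rho> r0) > 0"
      proof -
        obtain K where "K > 0" "- s * y r = K * sin (\<rho> r - \<rho> r0)" using sy[OF r] by blast
        with \<open>- s * y r > 0\<close> show ?thesis by (metis mult_less_cancel_left_pos mult_zero_right)
      qed
      ultimately show "\<rho> r0 < \<rho> r" using sin_pos_small[of "\<rho> r - \<rho> r0"] by simp }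
  qed (use d1 d2 d3 in auto)
qed

lemma first_point:
  assumes f: "continuous_on {a..b} (f :: real \<Rightarrow> real)" and ab: "a \<le> b" and "f a > l" "f b \<le> l"
  obtains z where "a < z" "z \<le> b" "f z = l" "\<And>x. a \<le> x \<Longrightarrow> x < z \<Longrightarrow> f x > l"
proof -
  define S where "S = {a..b} \<inter> f -` {..l}"
  have "closed S" unfolding S_def by (intro continuous_closed_preimage f) auto
  then have cS: "compact S" by (auto simp: compact_eq_bounded_closed S_def intro: bounded_subset[of "{a..b}"])
  have "b \<in> S" using assms by (auto simp: S_def)
  then obtain z where z: "z \<in> S" "\<And>x. x \<in> S \<Longrightarrow> z \<le> x"
    using compact_attains_inf[OF cS] by auto
  have z': "a \<le> z" "z \<le> b" "f z \<le> l" using z(1) by (auto simp: S_def)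
  have "a \<noteq> z" using z' assms by auto
  then have az: "a < z" using z' by simp
  have gt: "f x > l" if "a \<le> x" "x < z" for x
    using z(2)[of x] that z' by (force simp: S_def)
  have "f z \<ge> l"
  proof (rule ccontr)
    assume "\<not> f z \<ge> l"
    then obtain x where "a \<le> x" "x \<le> z" "f x = l"
      using IVT2'[of f z l a] z' assms continuous_on_subset[OF f, of "{a..z}"] by auto
    with gt[of x] \<open>\<not> f z \<ge> l\<close> show False by (cases "x = z") auto
  qed
  with z' gt az show ?thesis using that by auto
qed

text \<open>
  A level where the cosine vanishes can only be crossed upwards; once reached it is never met
  again.  Hence each of the levels between \<open>0\<close> and \<open>j * pi\<close> is attained exactly once, and no other one is.
\<close>

lemma count_upward_crossings:
  fixes T :: real
  assumes c: "continuous_on {0..T} \<Omega>" and T: "T > 0" and ends: "\<Omega> 0 = 0" "\<Omega> T = real j * pi"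
    and up: "\<And>x. 0 < x \<Longrightarrow> x < T \<Longrightarrow> cos (\<Omega> x) = 0 \<Longrightarrow>
      \<exists>d>0. (\<forall>y\<in>{0..T}. x - d < y \<and> y < x \<longrightarrow> \<Omega> y < \<Omega> x) \<and> (\<forall>y\<in>{0..T}. x < y \<and> y < x + d \<longrightarrow> \<Omega> x < \<Omega> y)"
  shows "finite {x\<in>{0..T}. cos (\<Omega> x) = 0} \<and> card {x\<in>{0..T}. cos (\<Omega> x) = 0} = j"
proof -
  have stay: "\<Omega> x2 > l" if l: "cos l = 0" and x: "0 \<le> x1" "x1 < x2" "x2 \<le> T" and ge: "\<Omega> x1 \<ge> l" for l x1 x2
  proof (rule ccontr)
    assume "\<not> \<Omega> x2 > l"
    then have le: "\<Omega> x2 \<le> l" by simp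
    obtain x1' where x1': "x1 \<le> x1'" "x1' < x2" "\<Omega> x1' > l"
    proof (cases "\<Omega> x1 > l")
      case False
      then have eq: "\<Omega> x1 = l" using ge by simp
      then have "x1 \<noteq> 0" using ends l by auto
      then obtain d where d: "d > 0" "\<And>y. y \<in> {0..T} \<Longrightarrow> x1 < y \<Longrightarrow> y < x1 + d \<Longrightarrow> \<Omega> x1 < \<Omega> y"
        using up[of x1] x eq l by auto
      show ?thesis
      proof (rule that[of "x1 + min d (x2 - x1) / 2"])
        have "0 < min d (x2 - x1) / 2" "min d (x2 - x1) / 2 < d" "min d (x2 - x1) / 2 < x2 - x1"
          using d(1) x by (auto simp: min_def)
        then show "x1 \<le> x1 + min d (x2 - x1) / 2" "x1 + min d (x2 - x1) / 2 < x2"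
          "l < \<Omega> (x1 + min d (x2 - x1) / 2)"
          using x d(2)[of "x1 + min d (x2 - x1) / 2"] eq by auto
      qed
    qed (use that x in auto)
    obtain z where z: "x1' < z" "z \<le> x2" "\<Omega> z = l" "\<And>y. x1' \<le> y \<Longrightarrow> y < z \<Longrightarrow> \<Omega> y > l"
      using first_point[of x1' x2 \<Omega> l] continuous_on_subset[OF c, of "{x1'..x2}"] x x1' le by auto
    have "cos (\<Omega> T) \<noteq> 0" by (simp add: ends)
    then have "z \<noteq> T" using z(3) l by auto
    then obtain d where d: "d > 0" "\<And>y. y \<in> {0..T} \<Longrightarrow> z - d < y \<Longrightarrow> y < z \<Longrightarrow> \<Omega> y < \<Omega> z"
      using up[of z] x x1' z l by auto
    have "\<Omega> (max x1' (z - d / 2)) < \<Omega> z" by (rule d(2)) (use d(1) z x x1' in auto)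
    moreover have "\<Omega> (max x1' (z - d / 2)) > l" by (rule z(4)) (use d(1) z in auto)
    ultimately show False using z by simp
  qed
  let ?Z = "{x\<in>{0..T}. cos (\<Omega> x) = 0}"
  have lev: "cos (real_of_int n * pi + pi / 2) = 0" for n by (auto simp: cos_zero_iff_int2)
  have "\<exists>x\<in>{0..T}. \<Omega> x = real m * pi + pi / 2" if m: "m < j" for m
  proof -
    have "(real m + 1) * pi \<le> real j * pi" using m by (intro mult_right_mono) auto
    then have "real m * pi + pi / 2 \<le> real j * pi" using pi_gt_zero
      unfolding distrib_right by linarith
    then show ?thesis
      using IVT'[of \<Omega> 0 "real m * pi + pi / 2" T] c T ends by force
  qed
  then have "\<forall>m. \<exists>x. m < j \<longrightarrow> x \<in> {0..T} \<and> \<Omega> x = real m * pi + pi / 2" by blast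
  then obtain h where
    h': "\<forall>m. m < j \<longrightarrow> h m \<in> {0..T} \<and> \<Omega> (h m) = real m * pi + pi / 2"
    by (rule choice[THEN exE])
  note h = h'[rule_format]
  have "bij_betw h {..<j} ?Z"
    unfolding bij_betw_def
  proof
    show "inj_on h {..<j}"
    proof (rule inj_onI)
      fix m n assume "m \<in> {..<j}" "n \<in> {..<j}" "h m = h n"
      then have mn: "m < j" "n < j" "h m = h n" by auto
      have "real m * pi + pi / 2 = \<Omega> (h m)" by (rule h[OF mn(1), THEN conjunct2, symmetric])
      also have "\<dots> = real n * pi + pi / 2" unfolding mn(3) by (rule h[OF mn(2), THEN conjunct2])
      finally have "real m * pi = real n * pi" by (rule add_right_imp_eq)
      then show "m = n" by (metis mult_cancel_right of_nat_eq_iff pi_neq_zero)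
    qed
    show "h ` {..<j} = ?Z"
    proof
      show "h ` {..<j} \<subseteq> ?Z" 
      proof
        fix x assume "x \<in> h ` {..<j}"
        then obtain m where "m < j" "x = h m" by auto
        then show "x \<in> ?Z" using h[of m] lev[of "int m"] by simp
      qed
      show "?Z \<subseteq> h ` {..<j}"
      proof
        fix x assume x: "x \<in> ?Z"
        then obtain n where n: "\<Omega> x = real_of_int n * pi + pi / 2" by (auto simp: cos_zero_iff_int2)
        have x0: "x \<noteq> 0" "x \<noteq> T" using x ends by auto
        have "n \<ge> 0"
        proof (rule ccontr)
          assume "\<not> n \<ge> 0"
          then have "real_of_int n * pi \<le> (-1) * pi" by (intro mult_right_mono) auto
          then have "\<Omega> 0 \<ge> real_of_int n * pi + pi / 2" using ends pi_gt_zero by linarith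
          from stay[OF lev _ _ _ this, of x] x x0 n show False by auto
        qed
        moreover have "n < int j"
        proof (rule ccontr)
          assume "\<not> n < int j"
          then have "real j * pi \<le> real_of_int n * pi" by (intro mult_right_mono) auto
          moreover have "\<Omega> T > real_of_int n * pi + pi / 2"
            by (rule stay[OF lev, of x]) (use x x0 n in auto)
          ultimately show False using ends pi_gt_zero by linarith
        qed
        ultimately have m: "nat n < j" "real (nat n) = real_of_int n" by auto
        then have hx: "\<Omega> (h (nat n)) = \<Omega> x" "h (nat n) \<in> {0..T}" using h[of "nat n"] n by auto
        have "h (nat n) = x"
        proof (rule linorder_cases[of "h (nat n)" x])
          assume "h (nat n) < x"
          then have "\<Omega> x > \<Omega> x" by (intro stay[of "\<Omega> x" "h (nat n)" x]) (use x hx in auto)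
          then show ?thesis by simp
        next
          assume "x < h (nat n)"
          then have "\<Omega> (h (nat n)) > \<Omega> x" by (intro stay[of "\<Omega> x" x]) (use x hx in auto)
          then show ?thesis using hx by simp
        qed auto
        then show "x \<in> h ` {..<j}" using m by auto
      qed
    qed
  qed
  then show ?thesis
    using bij_betw_finite[of h "{..<j}" ?Z] bij_betw_same_card[of h "{..<j}" ?Z] by simp
qed

section \<open>Rotation of the linearized equation\<close>

text \<open>
  If the cosines do not vanish at the meeting point this is continuity.  Otherwise both angles reach
  the same critical level from below, by \<open>phase_angle_crossing\<close>, and so the two cosines have equal signs there.
\<close>

lemma cos_product_pos_before_meeting:
  assumes ang1: "phase_angle y1 y1' \<rho>1" and ang2: "phase_angle y2 y2' \<rho>2"
    and y1: "\<And>r. r \<in> {0..1} \<Longrightarrow> (y1 has_real_derivative y1' r) (at r within {0..1})"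
    and y2: "\<And>r. r \<in> {0..1} \<Longrightarrow> (y2 has_real_derivative y2' r) (at r within {0..1})"
    and z: "z \<in> {0<..1}" "\<rho>1 z = \<rho>2 z"
  obtains d where "d > 0" "\<And>r. r \<in> {0..1} \<Longrightarrow> z - d < r \<Longrightarrow> r < z \<Longrightarrow> cos (\<rho>1 r) * cos (\<rho>2 r) > 0"
proof -
  have c1: "continuous_on {0..1} \<rho>1" and c2: "continuous_on {0..1} \<rho>2"
    using ang1 ang2 by (auto simp: phase_angle_def)
  have z': "z \<in> {0..1}" using z by auto
  show ?thesis
  proof (cases "cos (\<rho>1 z) = 0")
    case False
    have "continuous_on {0..1} (\<lambda>r. cos (\<rho>1 r) * cos (\<rho>2 r))" by (intro continuous_intros c1 c2)
    moreover have pos: "cos (\<rho>1 z) * cos (\<rho>2 z) > 0"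
      using False z(2) by (simp flip: power2_eq_square)
    ultimately obtain d where d: "d > 0" "\<And>r. r \<in> {0..1} \<Longrightarrow> \<bar>r - z\<bar> < d \<Longrightarrow>
        \<bar>cos (\<rho>1 r) * cos (\<rho>2 r) - cos (\<rho>1 z) * cos (\<rho>2 z)\<bar> < cos (\<rho>1 z) * cos (\<rho>2 z)"
      by (rule continuous_near[OF _ z']) blast
    show ?thesis
    proof (rule that[OF d(1)])
      fix r assume "r \<in> {0..1}" "z - d < r" "r < z"
      then have "\<bar>r - z\<bar> < d" by simp
      from d(2)[OF \<open>r \<in> {0..1}\<close> this] show "cos (\<rho>1 r) * cos (\<rho>2 r) > 0" by linarith
    qed
  next
    case True
    have one: "\<exists>d>0. \<forall>r\<in>{0..1}. z - d < r \<and> r < z \<longrightarrow>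
        (\<exists>K>0. cos (\<rho> r) = K * sin (\<rho>1 z))"
      if ang: "phase_angle y y' \<rho>" and y: "(y has_real_derivative y' z) (at z within {0..1})"
        and e: "\<rho> z = \<rho>1 z" for y y' \<rho>
    proof -
      have "cos (\<rho> z) = 0" using True e by simp
      obtain d1 where d1: "d1 > 0" "\<And>r. r \<in> {0..1} \<Longrightarrow> z - d1 < r \<Longrightarrow> r < z \<Longrightarrow> \<rho> r < \<rho> z"
        by (rule phase_angle_crossing[OF ang z(1) \<open>cos (\<rho> z) = 0\<close> y]) (rule that)
      have "continuous_on {0..1} \<rho>" using ang by (auto simp: phase_angle_def)
      then obtain d2 where d2: "d2 > 0" "\<And>r. r \<in> {0..1} \<Longrightarrow> \<bar>r - z\<bar> < d2 \<Longrightarrow> \<bar>\<rho> r - \<rho> z\<bar> < pi"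
        by (rule continuous_near[OF _ z' pi_gt_zero]) (rule that)
      have "\<exists>K>0. cos (\<rho> r) = K * sin (\<rho>1 z)" if r: "r \<in> {0..1}" "z - min d1 d2 < r" "r < z" for r
      proof (intro exI conjI)
        have "\<rho> r < \<rho> z" "\<bar>\<rho> r - \<rho> z\<bar> < pi" using r d1(2)[of r] d2(2)[of r] by auto
        then show "0 < sin (\<rho> z - \<rho> r)" by (intro sin_gt_zero) auto
        have "cos (\<rho> r) = cos (\<rho> z - (\<rho> z - \<rho> r))" by simp
        also have "\<dots> = sin (\<rho> z - \<rho> r) * sin (\<rho>1 z)"
          unfolding cos_diff using \<open>cos (\<rho> z) = 0\<close> e by simp
        finally show "cos (\<rho> r) = sin (\<rho> z - \<rho> r) * sin (\<rho>1 z)" .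
      qed
      then show ?thesis using d1(1) d2(1) by (intro exI[of _ "min d1 d2"]) auto
    qed
    obtain a where a: "a > 0" "\<And>r. r \<in> {0..1} \<Longrightarrow> z - a < r \<Longrightarrow> r < z \<Longrightarrow> \<exists>K>0. cos (\<rho>1 r) = K * sin (\<rho>1 z)"
      using one[OF ang1 y1[OF z']] by blast
    obtain b where b: "b > 0" "\<And>r. r \<in> {0..1} \<Longrightarrow> z - b < r \<Longrightarrow> r < z \<Longrightarrow> \<exists>K>0. cos (\<rho>2 r) = K * sin (\<rho>1 z)"
      using one[OF ang2 y2[OF z']] z(2) by auto
    have "sin (\<rho>1 z) \<noteq> 0" using True sin_cos_squared_add[of "\<rho>1 z"] by auto
    then have s: "sin (\<rho>1 z) * sin (\<rho>1 z) > 0" by (simp flip: power2_eq_square)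
    show ?thesis
    proof (rule that[of "min a b"])
      fix r assume r: "r \<in> {0..1}" "z - min a b < r" "r < z"
      then have "z - a < r" "z - b < r" by (auto simp: min_def split: if_splits)
      note ab = a(2)[OF r(1) this(1) r(3)] b(2)[OF r(1) this(2) r(3)]
      obtain K where K: "K > 0" "cos (\<rho>1 r) = K * sin (\<rho>1 z)" using ab(1) by blast
      obtain M where M: "M > 0" "cos (\<rho>2 r) = M * sin (\<rho>1 z)" using ab(2) by blast
      have "cos (\<rho>1 r) * cos (\<rho>2 r) = (K * M) * (sin (\<rho>1 z) * sin (\<rho>1 z))" unfolding K M by simp
      also have "\<dots> > 0" using K M s by simp
      finally show "cos (\<rho>1 r) * cos (\<rho>2 r) > 0" .
    qed (use a b in auto)
  qed
qed

text \<open>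
  Sturm comparison for angles.  The weighted Wronskian \<open>W\<close> equals a negative multiple of \<open>sin (\<rho>1 - \<rho>2)\<close>, and
  its derivative is \<open>- (m1 - m2) Q\<^bsup>N-2\<^esup> y1 y2\<close>.  Near the pole the product is positive, so \<open>\<rho>1\<close> takes
  the lead.  When \<open>\<rho>2\<close> first caught up at \<open>z\<close>, \<open>W\<close> would have to return from negative values to 0,
  although just before \<open>z\<close> the two angles are close, the product is positive and \<open>W\<close> decreases.
\<close>

lemma sturm_rotation:
  assumes N: "N \<ge> 2"
    and sol1: "axial_solution N (\<lambda>w. m1 * w) y1 y1'" and sol2: "axial_solution N (\<lambda>w. m2 * w) y2 y2'"
    and ang1: "phase_angle y1 y1' \<rho>1" and ang2: "phase_angle y2 y2' \<rho>2"
    and m: "m2 < m1"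
  shows "\<rho>2 1 < \<rho>1 1"
proof (rule ccontr)
  assume "\<not> \<rho>2 1 < \<rho>1 1"
  then have contra: "\<rho>1 1 - \<rho>2 1 \<le> 0" by simp
  note S1 = axial_solutionD[OF sol1] and S2 = axial_solutionD[OF sol2]
  obtain k where k: "N = Suc (Suc k)" using N two_le_Suc_Suc by blast
  have c1: "continuous_on {0..1} \<rho>1" and c2: "continuous_on {0..1} \<rho>2" and i: "\<rho>1 0 = 0" "\<rho>2 0 = 0"
    using ang1 ang2 by (auto simp: phase_angle_def)
  define W where "W = (\<lambda>r. Q r ^ N * (y1' r * y2 r - y1 r * y2' r))"
  have cW: "continuous_on {0..1} W" unfolding W_def by (intro continuous_intros S1 S2)
  have W': "(W has_real_derivative - ((m1 - m2) * Q r ^ k * (y1 r * y2 r))) (at r)" if r: "0 < r" "r < 1" for r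
  proof -
    define p1 where "p1 = - (m1 * y1 r + real N * (1 - r) * y1' r) / (r * (2 - r))"
    define p2 where "p2 = - (m2 * y2 r + real N * (1 - r) * y2' r) / (r * (2 - r))"
    have p: "(Q r)\<^sup>2 * p1 = - (m1 * y1 r + real N * (1 - r) * y1' r)"
      "(Q r)\<^sup>2 * p2 = - (m2 * y2 r + real N * (1 - r) * y2' r)"
      using r by (simp_all add: Q_sq p1_def p2_def)
    have "(y1' has_real_derivative p1) (at r)" "(y2' has_real_derivative p2) (at r)"
      unfolding p1_def p2_def using S1(6)[OF r] S2(6)[OF r] by auto
    note d = DERIV_mult[OF Q_power_deriv[OF r(1) less_imp_le[OF r(2)] N, where S = UNIV]
      DERIV_diff[OF DERIV_mult[OF this(1) S2(5)[OF r]] DERIV_mult[OF S1(5)[OF r] this(2)]]]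
    have "real N * (1 - r) * Q r ^ (N - 2) * (y1' r * y2 r - y1 r * y2' r) +
       (p1 * y2 r + y2' r * y1' r - (y1' r * y2' r + p2 * y1 r)) * Q r ^ N
       = Q r ^ k * (real N * (1 - r) * (y1' r * y2 r - y1 r * y2' r) +
         ((Q r)\<^sup>2 * p1) * y2 r - ((Q r)\<^sup>2 * p2) * y1 r)"
      by (simp add: k algebra_simps power2_eq_square)
    also have "\<dots> = - ((m1 - m2) * Q r ^ k * (y1 r * y2 r))"
      unfolding p by (simp add: algebra_simps)
    finally show ?thesis using d unfolding W_def by simp
  qed
  have W_dec: "W b < W a" if ab: "0 \<le> a" "a < b" "b \<le> 1"
    and pos: "\<And>r. a < r \<Longrightarrow> r < b \<Longrightarrow> cos (\<rho>1 r) * cos (\<rho>2 r) > 0" for a b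
  proof (rule DERIV_neg_imp_decreasing_open[OF ab(2)])
    show "continuous_on {a..b} W" by (rule continuous_on_subset[OF cW]) (use ab in auto)
    fix r assume r: "a < r" "r < b"
    then have r': "0 < r" "r < 1" "r \<in> {0..1}" using ab by auto
    obtain R1 where R1: "R1 > 0" "y1 r = R1 * cos (\<rho>1 r)" using phase_angleE[OF ang1 r'(3)] by blast
    obtain R2 where R2: "R2 > 0" "y2 r = R2 * cos (\<rho>2 r)" using phase_angleE[OF ang2 r'(3)] by blast
    have "y1 r * y2 r = (R1 * R2) * (cos (\<rho>1 r) * cos (\<rho>2 r))" unfolding R1 R2 by simp
    also have "\<dots> > 0" using R1 R2 pos[OF r] by simp
    finally have "(m1 - m2) * Q r ^ k * (y1 r * y2 r) > 0"
      using m Q_pos[of r] r' by simp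
    then show "\<exists>d. (W has_real_derivative d) (at r) \<and> d < 0"
      using W'[OF r'(1,2)] by (intro exI conjI) auto
  qed
  have W_sin: "\<exists>K>0. W r = - (K * sin (\<rho>1 r - \<rho>2 r))" if r: "r \<in> {0<..1}" for r
  proof -
    have r': "r \<in> {0..1}" using r by auto
    have Qr: "Q r > 0" using r Q_pos by auto
    obtain R1 where R1: "R1 > 0" "y1 r = R1 * cos (\<rho>1 r)" "- Q r * y1' r = R1 * sin (\<rho>1 r)"
      using phase_angleE[OF ang1 r'] by blast
    obtain R2 where R2: "R2 > 0" "y2 r = R2 * cos (\<rho>2 r)" "- Q r * y2' r = R2 * sin (\<rho>2 r)"
      using phase_angleE[OF ang2 r'] by blast
    have "W r = Q r ^ Suc k * ((Q r * y1' r) * y2 r - y1 r * (Q r * y2' r))"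
      by (simp add: W_def k algebra_simps)
    also have "Q r * y1' r = - (R1 * sin (\<rho>1 r))" using R1(3) by simp
    also have "Q r * y2' r = - (R2 * sin (\<rho>2 r))" using R2(3) by simp
    also have "Q r ^ Suc k * (- (R1 * sin (\<rho>1 r)) * y2 r - y1 r * - (R2 * sin (\<rho>2 r)))
      = - ((Q r ^ Suc k * R1 * R2) * sin (\<rho>1 r - \<rho>2 r))"
      unfolding R1(2) R2(2) sin_diff by (simp add: algebra_simps)
    finally show ?thesis using Qr R1(1) R2(1) by (intro exI[of _ "Q r ^ Suc k * R1 * R2"]) simp
  qed
  have W0: "W 0 = 0" by (simp add: W_def Q_def k)
  have zero: "(0::real) \<in> {0..1}" by simp
  have p4: "pi / 4 > 0" by simp
  obtain d1 where d1: "d1 > 0" "\<And>r. r \<in> {0..1} \<Longrightarrow> \<bar>r - 0\<bar> < d1 \<Longrightarrow> \<bar>\<rho>1 r - \<rho>1 0\<bar> < pi / 4"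
    by (rule continuous_near[OF c1 zero p4]) (rule that)
  obtain d2 where d2: "d2 > 0" "\<And>r. r \<in> {0..1} \<Longrightarrow> \<bar>r - 0\<bar> < d2 \<Longrightarrow> \<bar>\<rho>2 r - \<rho>2 0\<bar> < pi / 4"
    by (rule continuous_near[OF c2 zero p4]) (rule that)
  define \<delta> where "\<delta> = min 1 (min d1 d2 / 2)"
  have \<delta>: "0 < \<delta>" "\<delta> \<le> 1" "\<delta> < d1" "\<delta> < d2" using d1(1) d2(1) by (auto simp: \<delta>_def min_def)
  have small: "\<bar>\<rho>1 r\<bar> < pi / 4" "\<bar>\<rho>2 r\<bar> < pi / 4" if "0 \<le> r" "r \<le> \<delta>" for r
    using d1(2)[of r] d2(2)[of r] that \<delta> i by auto
  have "W \<delta> < W 0"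
  proof (rule W_dec)
    fix r assume "0 < r" "r < \<delta>"
    then have s: "\<bar>\<rho>1 r\<bar> < pi / 4" "\<bar>\<rho>2 r\<bar> < pi / 4" using small[of r] by auto
    have "cos (\<rho>1 r) > 0" "cos (\<rho>2 r) > 0" by (intro cos_gt_zero_pi; use s in linarith)+
    then show "cos (\<rho>1 r) * cos (\<rho>2 r) > 0" by simp
  qed (use \<delta> in auto)
  moreover obtain K where K: "K > 0" "W \<delta> = - (K * sin (\<rho>1 \<delta> - \<rho>2 \<delta>))" using W_sin[of \<delta>] \<delta> by auto
  ultimately have "sin (\<rho>1 \<delta> - \<rho>2 \<delta>) > 0" using W0 by (simp add: zero_less_mult_iff)
  moreover have "\<bar>\<rho>1 \<delta> - \<rho>2 \<delta>\<bar> < pi"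
  proof -
    have "\<bar>\<rho>1 \<delta>\<bar> < pi / 4" "\<bar>\<rho>2 \<delta>\<bar> < pi / 4" using small[of \<delta>] \<delta>(1) by simp_all
    then have "\<bar>\<rho>1 \<delta> - \<rho>2 \<delta>\<bar> < pi / 4 + pi / 4" by (intro le_less_trans[OF abs_triangle_ineq4] add_strict_mono)
    also have "\<dots> \<le> pi" using pi_gt_zero by simp
    finally show ?thesis .
  qed
  ultimately have start: "\<rho>1 \<delta> - \<rho>2 \<delta> > 0" using sin_pos_small by blast
  have "continuous_on {\<delta>..1} (\<lambda>r. \<rho>1 r - \<rho>2 r)"
    by (intro continuous_intros continuous_on_subset[OF c1] continuous_on_subset[OF c2]) (use \<delta> in auto)
  then obtain z where z: "\<delta> < z" "z \<le> 1" "\<rho>1 z - \<rho>2 z = 0" "\<And>x. \<delta> \<le> x \<Longrightarrow> x < z \<Longrightarrow> \<rho>1 x - \<rho>2 x > 0"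
    using first_point[of \<delta> 1 "\<lambda>r. \<rho>1 r - \<rho>2 r" 0] \<delta> start contra by blast
  have zz: "z \<in> {0<..1}" "z \<in> {0..1}" "\<rho>1 z = \<rho>2 z" using z \<delta> by auto
  obtain d where d: "d > 0" "\<And>r. r \<in> {0..1} \<Longrightarrow> z - d < r \<Longrightarrow> r < z \<Longrightarrow> cos (\<rho>1 r) * cos (\<rho>2 r) > 0"
    by (rule cos_product_pos_before_meeting[OF ang1 ang2 S1(1) S2(1) zz(1,3)]) (assumption, assumption, rule that)
  have "continuous_on {0..1} (\<lambda>r. \<rho>1 r - \<rho>2 r)" by (intro continuous_intros c1 c2)
  then obtain d' where d': "d' > 0" "\<And>r. r \<in> {0..1} \<Longrightarrow> \<bar>r - z\<bar> < d' \<Longrightarrow> \<bar>(\<rho>1 r - \<rho>2 r) - (\<rho>1 z - \<rho>2 z)\<bar> < pi"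
    by (rule continuous_near[OF _ zz(2) pi_gt_zero]) (rule that)
  define x where "x = max \<delta> (z - min d d' / 2)"
  have x: "\<delta> \<le> x" "x < z" "z - d < x" "z - d' < x" "x \<in> {0<..1}" "x \<in> {0..1}"
    using z \<delta> d(1) d'(1) by (auto simp: x_def max_def min_def)
  have "W z < W x"
    by (rule W_dec) (use x z d(2) in auto)
  moreover have "W z = 0" using W_sin[OF zz(1)] z(3) by auto
  moreover have "W x < 0"
  proof -
    have "\<bar>x - z\<bar> < d'" using x by simp
    then have "\<rho>1 x - \<rho>2 x < pi" using d'(2)[OF x(6)] z(3) by auto
    then have "sin (\<rho>1 x - \<rho>2 x) > 0" using z(4)[OF x(1,2)] by (intro sin_gt_zero)
    then show ?thesis using W_sin[OF x(5)] by auto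
  qed
  ultimately show False by simp
qed

text \<open>
  Coefficients, in powers of the height \<open>t\<close>, of the zonal (Gegenbauer) polynomial of degree \<open>j\<close>, the axially symmetric
  spherical harmonic of eigenvalue \<open>nu N j\<close>.  The recursion stops at \<open>m = j\<close> and the starting values
  select the parity of \<open>j\<close>.
\<close>

fun zonal_coeff :: "nat \<Rightarrow> nat \<Rightarrow> nat \<Rightarrow> real" where
  "zonal_coeff N j 0 = (if even j then 1 else 0)"
| "zonal_coeff N j (Suc 0) = (if even j then 0 else 1)"
| "zonal_coeff N j (Suc (Suc m)) = (nu N m - nu N j) / (real (m + 2) * real (m + 1)) * zonal_coeff N j m"

lemma zonal_coeff_parity: "even m \<noteq> even j \<Longrightarrow> zonal_coeff N j m = 0"
  by (induction N j m rule: zonal_coeff.induct) auto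

lemma zonal_coeff_eq_0: "m > j \<Longrightarrow> zonal_coeff N j m = 0"
proof (induction N j m rule: zonal_coeff.induct)
  case (2 N j)
  then show ?case by auto
next
  case (3 N j m)
  consider "m < j" | "m = j" | "m > j" by linarith
  then show ?case
  proof cases
    case 1
    then have "j = Suc m" using 3 by auto
    then show ?thesis by (simp add: zonal_coeff_parity)
  qed (use 3 in auto)
qed auto

definition zonal_poly :: "nat \<Rightarrow> nat \<Rightarrow> real poly" where
  "zonal_poly N j = (\<Sum>m\<le>j. monom (zonal_coeff N j m) m)"

lemma coeff_zonal_poly: "coeff (zonal_poly N j) m = zonal_coeff N j m"
proof -
  have "coeff (zonal_poly N j) m = (\<Sum>i\<le>j. if i = m then zonal_coeff N j m else 0)"
    unfolding zonal_poly_def coeff_sum coeff_monom by (rule sum.cong) auto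
  also have "\<dots> = (if m \<le> j then zonal_coeff N j m else 0)" by (simp add: sum.delta)
  finally show ?thesis using zonal_coeff_eq_0[of j m N] by (auto simp: not_le)
qed

lemma zonal_poly_ode:
  fixes N j :: nat and t :: real
  defines "P \<equiv> zonal_poly N j"
  assumes N: "N \<ge> 1"
  shows "(1 - t\<^sup>2) * poly (pderiv (pderiv P)) t - real N * t * poly (pderiv P) t + nu N j * poly P t = 0"
proof -
  let ?R = "pderiv (pderiv P) - pCons 0 (pCons 0 (pderiv (pderiv P)))
    - smult (real N) (pCons 0 (pderiv P)) + smult (nu N j) P"
  have step: "real (m + 2) * real (m + 1) * zonal_coeff N j (Suc (Suc m)) = (nu N m - nu N j) * zonal_coeff N j m" for m
  proof -
    have "x \<noteq> 0 \<Longrightarrow> x * (d / x * a) = d * a" for x d a :: real by simp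
    then show ?thesis unfolding zonal_coeff.simps by simp
  qed
  have "?R = 0"
  proof (rule poly_eqI)
    fix n
    consider "n = 0" | "n = Suc 0" | m where "n = Suc (Suc m)" by (metis not0_implies_Suc)
    then show "coeff ?R n = coeff 0 n"
    proof cases
      case 1
      then show ?thesis using step[of 0] by (simp add: coeff_pderiv P_def coeff_zonal_poly nu_def del: zonal_coeff.simps(3))
    next
      case 2
      then show ?thesis using step[of 1] N
        by (simp add: coeff_pderiv P_def coeff_zonal_poly nu_def algebra_simps del: zonal_coeff.simps)
    next
      case (3 m)
      have "nu N (m + 2) = real (m + 2) * real (m + 1) + real N * real (m + 2)"
        by (simp add: nu_def algebra_simps)
      then show ?thesis using step[of "Suc (Suc m)"]
        by (simp add: 3 coeff_pderiv P_def coeff_zonal_poly algebra_simps del: zonal_coeff.simps)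
    qed
  qed
  then have "poly ?R t = 0" by (simp only: poly_0)
  then show ?thesis by (simp add: algebra_simps power2_eq_square)
qed

text \<open>
  By parity a zonal polynomial or its derivative vanishes on the equator \<open>t = 0\<close>.  It does not vanish at the
  pole, since otherwise uniqueness at the pole would make it identically 0.
\<close>

lemma zonal_solution:
  assumes N: "N \<ge> 2"
  obtains y y' \<rho> where "axial_solution N (\<lambda>w. nu N j * w) y y'" "phase_angle y y' \<rho>" "y 1 = 0 \<or> y' 1 = 0"
proof -
  define P where "P = zonal_poly N j"
  define y where "y = (\<lambda>c r. c * poly P (1 - r))"
  define y' where "y' = (\<lambda>c r. - c * poly (pderiv P) (1 - r))"
  have sol: "axial_solution N (\<lambda>w. nu N j * w) (y c) (y' c)" for c
    unfolding axial_solution_def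
  proof (intro conjI ballI)
    have l: "((\<lambda>r. 1 - r) has_real_derivative -1) (at r within S)" for r :: real and S
      by (auto intro!: derivative_eq_intros)
    have p: "((\<lambda>r. poly R (1 - r)) has_real_derivative - poly (pderiv R) (1 - r)) (at r within S)" for R and r :: real and S
      using DERIV_chain2[OF poly_DERIV l, of R] by simp
    show "(y c has_real_derivative y' c r) (at r within {0..1})" for r
      unfolding y_def y'_def by (rule DERIV_cong[OF DERIV_cmult[OF p]]) simp
    show "continuous_on {0..1} (y' c)"
      unfolding y'_def by (intro continuous_intros)
    fix r :: real assume r: "r \<in> {0<..1}"
    have "(1 - (1 - r)\<^sup>2) * poly (pderiv (pderiv P)) (1 - r)
        = real N * (1 - r) * poly (pderiv P) (1 - r) - nu N j * poly P (1 - r)"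
      using zonal_poly_ode[of N "1 - r" j] N by (simp add: P_def)
    then have "r * (2 - r) * poly (pderiv (pderiv P)) (1 - r)
        = real N * (1 - r) * poly (pderiv P) (1 - r) - nu N j * poly P (1 - r)"
      by (simp add: power2_eq_square algebra_simps)
    then have "poly (pderiv (pderiv P)) (1 - r)
       = (real N * (1 - r) * poly (pderiv P) (1 - r) - nu N j * poly P (1 - r)) / (r * (2 - r))"
      using r by (simp add: field_simps)
    moreover have "- (nu N j * y c r + real N * (1 - r) * y' c r)
       = c * (real N * (1 - r) * poly (pderiv P) (1 - r) - nu N j * poly P (1 - r))"
      by (simp add: y_def y'_def algebra_simps)
    ultimately have "- c * - poly (pderiv (pderiv P)) (1 - r)
       = - (nu N j * y c r + real N * (1 - r) * y' c r) / (r * (2 - r))"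
      by simp
    with DERIV_cmult[OF p, of "-c" "pderiv P" r]
    show "(y' c has_real_derivative - (nu N j * y c r + real N * (1 - r) * y' c r) / (r * (2 - r)))
       (at r within {0..1})" unfolding y'_def by simp
  qed
  have lip: "\<bar>nu N j * w\<bar> \<le> \<bar>nu N j\<bar> * \<bar>w - 0\<bar>" for w by (simp add: abs_mult)
  have c01: "poly P 0 = zonal_coeff N j 0" "poly (pderiv P) 0 = zonal_coeff N j 1"
    by (simp_all add: poly_0_coeff_0 P_def coeff_zonal_poly coeff_pderiv)
  have P1: "poly P 1 \<noteq> 0"
  proof
    assume "poly P 1 = 0"
    then have y0: "y 1 0 = 0" by (simp add: y_def)
    have "1 \<le> N" "(1::real) \<in> {0<..1}" using N by auto
    have lip0: "\<bar>nu N j * w\<bar> \<le> \<bar>nu N j\<bar> * \<bar>w - y 1 0\<bar>" for w using lip[of w] y0 by simp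
    \<comment> \<open>The constant term or the linear coefficient of the polynomial is 1.\<close>
    from solution_unique_forward[OF \<open>1 \<le> N\<close> sol lip0 \<open>1 \<in> {0<..1}\<close>] y0
    show False using c01 by (auto simp: y_def y'_def split: if_splits)
  qed
  define z where "z = y (1 / poly P 1)"
  define z' where "z' = y' (1 / poly P 1)"
  have solz: "axial_solution N (\<lambda>w. nu N j * w) z z'" unfolding z_def z'_def by (rule sol)
  note S = axial_solutionD[OF solz]
  have z0: "z 0 = 1" using P1 by (simp add: z_def y_def)
  have "z' r \<noteq> 0" if "r \<in> {0<..1}" "z r = 0" for r
    using solution_unique_backward[OF solz lip, of r] that z0 by auto
  from phase_angle_exists[OF S(2,3) z0 this] obtain \<rho> where "phase_angle z z' \<rho>" by blast
  moreover have "z 1 = 0 \<or> z' 1 = 0" using c01 by (auto simp: z_def z'_def y_def y'_def)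
  ultimately show ?thesis using that solz by blast
qed

text \<open>
  Reaching \<open>- pi / 2\<close> from above would be a downward crossing.
\<close>

lemma phase_angle_gt:
  assumes ang: "phase_angle y y' \<rho>"
    and y: "\<And>r. r \<in> {0..1} \<Longrightarrow> (y has_real_derivative y' r) (at r within {0..1})"
  shows "\<rho> 1 > - (pi / 2)"
proof (rule ccontr)
  assume "\<not> \<rho> 1 > - (pi / 2)"
  moreover have c: "continuous_on {0..1} \<rho>" "\<rho> 0 = 0" using ang by (auto simp: phase_angle_def)
  ultimately obtain z where z: "0 < z" "z \<le> 1" "\<rho> z = - (pi / 2)" "\<And>x. 0 \<le> x \<Longrightarrow> x < z \<Longrightarrow> \<rho> x > - (pi / 2)"
    using first_point[of 0 1 \<rho> "- (pi / 2)"] by auto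
  have zz: "z \<in> {0<..1}" "z \<in> {0..1}" using z(1,2) by simp_all
  have "cos (\<rho> z) = 0" unfolding z(3) by simp
  obtain d where d: "d > 0" "\<And>r. r \<in> {0..1} \<Longrightarrow> z - d < r \<Longrightarrow> r < z \<Longrightarrow> \<rho> r < \<rho> z"
    by (rule phase_angle_crossing[OF ang zz(1) \<open>cos (\<rho> z) = 0\<close> y[OF zz(2)]]) (rule that)
  define x where "x = max 0 (z - d / 2)"
  have "x \<in> {0..1}" "z - d < x" "x < z" "0 \<le> x" using z d(1) by (auto simp: x_def)
  then show False using d(2)[of x] z(4)[of x] z(3) by auto
qed

text \<open>
  The angle at the equator is a multiple of \<open>pi / 2\<close>, because the polynomial or its derivative vanishes there, and it increases
  strictly with \<open>j\<close> by Sturm comparison; so it grows by at least \<open>pi / 2\<close> in each step.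
\<close>

lemma zonal_rotation:
  assumes N: "N \<ge> 2"
  shows "\<exists>y y' \<rho>. axial_solution N (\<lambda>w. nu N j * w) y y' \<and> phase_angle y y' \<rho> \<and> \<rho> 1 \<ge> real j * (pi / 2)"
proof (induction j)
  have quarter: "\<exists>n::int. \<rho> 1 = of_int n * (pi / 2)" if ang: "phase_angle y y' \<rho>" and e: "y 1 = 0 \<or> y' 1 = 0" for y y' \<rho>
  proof -
    obtain R where "R > 0" "y 1 = R * cos (\<rho> 1)" "- Q 1 * y' 1 = R * sin (\<rho> 1)"
      by (rule phase_angleE[OF ang, of 1]) auto
    then have "cos (\<rho> 1) = 0 \<or> sin (\<rho> 1) = 0" using e by auto
    then show ?thesis by (auto simp: cos_zero_iff_int sin_zero_iff_int)
  qed
  {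
    case 0
    obtain y y' \<rho> where *: "axial_solution N (\<lambda>w. nu N 0 * w) y y'" "phase_angle y y' \<rho>" "y 1 = 0 \<or> y' 1 = 0"
      using zonal_solution[OF N] by blast
    obtain n :: int where n: "\<rho> 1 = of_int n * (pi / 2)" using quarter[OF *(2,3)] by blast
    have "\<rho> 1 > (-1) * (pi / 2)" using phase_angle_gt[OF *(2) axial_solutionD(1)[OF *(1)]] by simp
    then have "(-1) < real_of_int n" unfolding n using pi_gt_zero by (subst (asm) mult_less_cancel_right) auto
    then have "\<rho> 1 \<ge> 0" unfolding n by simp
    then show ?case using * by auto
  next
    case (Suc j)
    then obtain x x' \<sigma> where x: "axial_solution N (\<lambda>w. nu N j * w) x x'" "phase_angle x x' \<sigma>" "\<sigma> 1 \<ge> real j * (pi / 2)"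
      by blast
    obtain y y' \<rho> where *: "axial_solution N (\<lambda>w. nu N (Suc j) * w) y y'" "phase_angle y y' \<rho>" "y 1 = 0 \<or> y' 1 = 0"
      using zonal_solution[OF N] by blast
    obtain n :: int where n: "\<rho> 1 = of_int n * (pi / 2)" using quarter[OF *(2,3)] by blast
    have "nu N j < nu N (Suc j)" using N by (simp add: nu_def algebra_simps)
    then have "\<sigma> 1 < \<rho> 1" by (rule sturm_rotation[OF N *(1) x(1) *(2) x(2)])
    with x(3) have "real j * (pi / 2) < of_int n * (pi / 2)" unfolding n by linarith
    then have "real j < of_int n" using pi_gt_zero by (subst (asm) mult_less_cancel_right) auto
    then have "real_of_int (int j) < of_int n" by simp
    then have "int (Suc j) \<le> n" unfolding of_int_less_iff by simp
    then have "real_of_int (int (Suc j)) \<le> of_int n" unfolding of_int_le_iff .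
    then have "real (Suc j) \<le> of_int n" by simp
    then have "\<rho> 1 \<ge> real (Suc j) * (pi / 2)" unfolding n by (intro mult_right_mono) auto
    then show ?case using * by blast
  }
qed

lemma linear_rotation:
  assumes N: "N \<ge> 2" and sol: "axial_solution N (\<lambda>w. m * w) y y'" and ang: "phase_angle y y' \<rho>"
    and m: "nu N j < m"
  shows "\<rho> 1 > real j * (pi / 2)"
proof -
  obtain x x' \<sigma> where x: "axial_solution N (\<lambda>w. nu N j * w) x x'" "phase_angle x x' \<sigma>" "\<sigma> 1 \<ge> real j * (pi / 2)"
    using zonal_rotation[OF N] by blast
  from sturm_rotation[OF N sol x(1) ang x(2) m] x(3) show ?thesis by simp
qed

section \<open>Subcriticality: large initial values lead to a sign change\<close>

lemma nondecreasing_from_deriv: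
  assumes "continuous_on {a..b} (g :: real \<Rightarrow> real)" "a \<le> b"
    and "\<And>x. a < x \<Longrightarrow> x < b \<Longrightarrow> (g has_real_derivative g' x) (at x)"
    and "\<And>x. a < x \<Longrightarrow> x < b \<Longrightarrow> g' x \<ge> 0"
  shows "g a \<le> g b"
  by (rule DERIV_nonneg_imp_increasing_open) (use assms in blast)+

text \<open>
  The condition \<open>sub\<close> says that \<open>p\<close> is below the critical exponent, in a form that includes dimension 2.
  The constant \<open>K\<close> will be a lower bound \<open>- K\<close> for the nonlinearity.
\<close>

locale subcritical =
  fixes N :: nat and p lam K :: real
  assumes N: "N \<ge> 2" and p: "1 < p" and lam: "lam > 0" and K: "K \<ge> 0"
    and sub: "(real N - 2) * (p + 1) < 2 * real N"
begin

text \<open>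
  The Pohozaev quantity \<open>P\<close> below contains the term \<open>\<sigma> y y'\<close>, and \<open>\<kappa>\<close> is half the margin left by subcriticality.  For
  \<open>r \<le> r1\<close> the factor \<open>1 - r\<close> costs at most half of this margin.  Above the threshold \<open>Y\<close> the power dominates the
  linear term both in the equation and in \<open>P\<close>; the last summand of \<open>A\<close> makes the time that a solution can
  spend above \<open>Y\<close> less than \<open>r1\<close>, independently of the starting value.
\<close>

definition "\<sigma> = (real N - 2) / 2"
definition "\<kappa> = (real N / (p + 1) - \<sigma>) / 2"
definition "r1 = min (1 / 2) (\<kappa> * (p + 1) / real N)"
definition "A = 1 + 2 * lam + 2 * lam / \<kappa> + 2 * real N / ((p - 1) * r1)"
definition "Y = A powr (1 / (p - 1))"

lemma \<sigma>: "\<sigma> \<ge> 0" using N by (simp add: \<sigma>_def)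

lemma \<kappa>: "\<kappa> > 0"
proof -
  have "\<sigma> < real N / (p + 1)" using sub p by (simp add: \<sigma>_def field_simps)
  then show ?thesis by (simp add: \<kappa>_def)
qed

lemma r1: "0 < r1" "r1 \<le> 1 / 2"
proof -
  have "0 < \<kappa> * (p + 1) / real N" using \<kappa> p N by simp
  then show "0 < r1" by (simp add: r1_def)
  show "r1 \<le> 1 / 2" unfolding r1_def by (rule min.cobounded1)
qed

lemma A: "A > 1" "2 * lam \<le> A" "2 * lam / \<kappa> \<le> A" "2 * real N / ((p - 1) * r1) < A"
proof -
  have "2 * lam / \<kappa> \<ge> 0" "2 * real N / ((p - 1) * r1) \<ge> 0" using lam \<kappa> r1 p by auto
  then show "A > 1" "2 * lam \<le> A" "2 * lam / \<kappa> \<le> A" "2 * real N / ((p - 1) * r1) < A"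
    using lam unfolding A_def by linarith+
qed

lemma Y_pos: "Y > 0" using A by (simp add: Y_def)

lemma Y_powr: "Y powr (p - 1) = A"
  using A p by (simp add: Y_def powr_powr)

lemma powr_split: "w > 0 \<Longrightarrow> w powr p = w powr (p - 1) * w"
  by (simp add: powr_mult_base[of w "p - 1"] mult.commute)

lemma large_powr:
  assumes "w \<ge> Y"
  shows "w powr (p - 1) \<ge> A"
  using powr_mono2[of "p - 1" Y w] assms p Y_pos Y_powr by simp

lemma source_large:
  assumes "w \<ge> Y"
  shows "w powr p / 2 \<le> w powr p - lam * w" "lam * w\<^sup>2 \<le> \<kappa> / 2 * w powr (p + 1)"
proof -
  have w: "w > 0" using assms Y_pos by simp
  have "2 * lam \<le> w powr (p - 1)" using large_powr[OF assms] A by simp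
  then have "2 * lam * w \<le> w powr p" unfolding powr_split[OF w] using w by (intro mult_right_mono) auto
  then show "w powr p / 2 \<le> w powr p - lam * w" by simp
  have "2 * lam / \<kappa> \<le> w powr (p - 1)" using large_powr[OF assms] A by simp
  then have "lam \<le> \<kappa> / 2 * w powr (p - 1)" using \<kappa> by (simp add: field_simps)
  then have "lam * w\<^sup>2 \<le> \<kappa> / 2 * w powr (p - 1) * w\<^sup>2" using w by (intro mult_right_mono) auto
  also have "\<dots> = \<kappa> / 2 * w powr (p + 1)"
  proof -
    have "p + 1 = (p - 1) + real 2" by simp
    then have "w powr (p + 1) = w powr ((p - 1) + real 2)" by (rule arg_cong)
    also have "\<dots> = w powr (p - 1) * w\<^sup>2" unfolding powr_add using w by (simp only: powr_realpow)
    finally show ?thesis by simp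
  qed
  finally show "lam * w\<^sup>2 \<le> \<kappa> / 2 * w powr (p + 1)" .
qed

end

text \<open>
  A solution starting at a large value \<open>B\<close> and assumed to stay positive up to the equator.  The aim is a
  bound on \<open>B\<close>.
\<close>

locale large_solution = subcritical +
  fixes f y y' :: "real \<Rightarrow> real" and B :: real
  assumes sol: "axial_solution N f y y'" and y0: "y 0 = B"
    and f_eq: "\<And>w. 0 < w \<Longrightarrow> w \<le> B \<Longrightarrow> f w = w powr p - lam * w"
    and f_above: "\<And>w. B \<le> w \<Longrightarrow> 0 \<le> f w"
    and f_below: "\<And>w. - K \<le> f w"
    and B: "2 * Y < B"
    and y_pos: "\<And>r. r \<in> {0..1} \<Longrightarrow> 0 < y r"
begin

lemmas S = axial_solutionD[OF sol]

text \<open>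
  The flux, whose derivative is \<open>Q\<^bsup>N-2\<^esup> f y\<close>.
\<close>

definition "M r = - (Q r ^ N * y' r)"

lemma M_continuous: "continuous_on {0..1} M"
  unfolding M_def by (intro continuous_intros S)

lemma M_0: "M 0 = 0" using N by (simp add: M_def Q_def)

lemma Q_0_pow: "Q 0 ^ N = 0" using N by (simp add: Q_def)

lemma Q_pow_nonneg: "0 \<le> r \<Longrightarrow> r \<le> 1 \<Longrightarrow> 0 \<le> Q r ^ k"
  by (intro zero_le_power Q_nonneg)

lemma Q_N: "Q r ^ N = Q r ^ (N - 2) * (Q r)\<^sup>2"
  using two_le_Suc_Suc[OF N] by (auto simp: power2_eq_square)

lemma M_deriv:
  assumes r: "0 < r" "r < 1"
  shows "(M has_real_derivative Q r ^ (N - 2) * f (y r)) (at r)"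
proof -
  define y2 where "y2 = - (f (y r) + real N * (1 - r) * y' r) / (r * (2 - r))"
  have y2: "(y' has_real_derivative y2) (at r)" unfolding y2_def by (rule S(6)[OF r])
  have Qy2: "(Q r)\<^sup>2 * y2 = - (f (y r) + real N * (1 - r) * y' r)"
    using r by (simp add: Q_sq y2_def)
  have "(M has_real_derivative - (real N * (1 - r) * Q r ^ (N - 2) * y' r + y2 * Q r ^ N)) (at r)"
    unfolding M_def using r N by (intro DERIV_minus DERIV_mult Q_power_deriv y2) auto
  also have "- (real N * (1 - r) * Q r ^ (N - 2) * y' r + y2 * Q r ^ N)
     = - (Q r ^ (N - 2) * (real N * (1 - r) * y' r + (Q r)\<^sup>2 * y2))"
    unfolding Q_N by (simp add: algebra_simps)
  also have "\<dots> = Q r ^ (N - 2) * f (y r)" unfolding Qy2 by simp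
  finally show ?thesis .
qed

lemma f_large_nonneg: "w \<ge> Y \<Longrightarrow> f w \<ge> 0"
proof (cases "w \<le> B")
  assume w: "w \<ge> Y" "w \<le> B"
  then have "f w = w powr p - lam * w" using f_eq Y_pos by auto
  then show "f w \<ge> 0" using source_large(1)[OF w(1)] powr_ge_zero[of w p] by linarith
qed (use f_above in auto)

lemma Q_pow_deriv_div:
  assumes "0 < r" "r < 1"
  shows "((\<lambda>r. C * Q r ^ N / real N) has_real_derivative C * ((1 - r) * Q r ^ (N - 2))) (at r)"
proof -
  have "((\<lambda>r. C * Q r ^ N / real N) has_real_derivative C * (real N * (1 - r) * Q r ^ (N - 2)) / real N) (at r)"
    using assms N by (intro DERIV_cdivide DERIV_cmult Q_power_deriv) auto
  then show ?thesis using N by simp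
qed

text \<open>
  The Pohozaev quantity for the sphere.  In its derivative the terms with \<open>y'\<^sup>2\<close> combine to \<open>\<sigma> r Q\<^sup>2 y'\<^sup>2\<close>, which is nonnegative,
  and the remaining ones are bounded below by \<open>\<kappa> / 2\<close> times \<open>y\<^bsup>p+1\<^esup>\<close> while \<open>y \<ge> Y\<close>, thanks to the
  margin \<open>\<kappa>\<close>.
\<close>

definition "P r = Q r ^ N * ((Q r)\<^sup>2 * (y' r)\<^sup>2 / 2 + (y r powr (p + 1) / (p + 1) - lam * (y r)\<^sup>2 / 2)
  + \<sigma> * (y r * y' r))"

lemma P_continuous: "continuous_on {0..1} P"
  unfolding P_def by (intro continuous_intros S) (use y_pos p in force)+

lemma P_0: "P 0 = 0" using N by (simp add: P_def Q_def)

context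
  fixes s :: real
  assumes s: "0 < s" "s \<le> r1" and above: "\<And>r. 0 \<le> r \<Longrightarrow> r \<le> s \<Longrightarrow> y r \<ge> Y"
begin

lemma s_lt_1: "s < 1" "s \<le> 1 / 2" using s r1 by auto

lemma M_nonneg: "0 \<le> r \<Longrightarrow> r \<le> s \<Longrightarrow> M r \<ge> 0"
proof -
  assume r: "0 \<le> r" "r \<le> s"
  have "M 0 \<le> M r"
  proof (rule nondecreasing_from_deriv[OF _ r(1)])
    show "continuous_on {0..r} M" by (rule continuous_on_subset[OF M_continuous]) (use r s_lt_1 in auto)
    fix x assume x: "0 < x" "x < r"
    then show "(M has_real_derivative Q x ^ (N - 2) * f (y x)) (at x)"
      using r s_lt_1 by (intro M_deriv) auto
    show "0 \<le> Q x ^ (N - 2) * f (y x)"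
      using x r s_lt_1 by (intro mult_nonneg_nonneg zero_le_power Q_nonneg f_large_nonneg above) auto
  qed
  then show ?thesis by (simp add: M_0)
qed

lemma y'_nonpos: "0 < r \<Longrightarrow> r \<le> s \<Longrightarrow> y' r \<le> 0"
  using M_nonneg[of r] zero_less_power[OF Q_pos[of r], of N] s_lt_1 by (auto simp: M_def mult_le_0_iff)

lemma y_decreasing: "0 \<le> x \<Longrightarrow> x \<le> r \<Longrightarrow> r \<le> s \<Longrightarrow> y r \<le> y x"
proof -
  assume xr: "0 \<le> x" "x \<le> r" "r \<le> s"
  have "- y x \<le> - y r"
  proof (rule nondecreasing_from_deriv[OF _ xr(2)])
    show "continuous_on {x..r} (\<lambda>r. - y r)"
      by (intro continuous_intros continuous_on_subset[OF S(2)]) (use xr s_lt_1 in auto)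
    fix u assume u: "x < u" "u < r"
    then show "((\<lambda>r. - y r) has_real_derivative - y' u) (at u)"
      using xr s_lt_1 by (intro DERIV_minus S(5)) auto
    show "0 \<le> - y' u" using y'_nonpos[of u] u xr by simp
  qed
  then show ?thesis by simp
qed

lemma f_y: "0 \<le> r \<Longrightarrow> r \<le> s \<Longrightarrow> f (y r) = y r powr p - lam * y r"
  using y_decreasing[of 0 r] above[of r] Y_pos y0 by (intro f_eq) auto

lemma y_le_B: "0 \<le> r \<Longrightarrow> r \<le> s \<Longrightarrow> y r \<le> B"
  using y_decreasing[of 0 r] y0 by simp

text \<open>
  While \<open>y\<close> decreases, the flux at \<open>r\<close> is at least the value that a source frozen at its smallest value \<open>y r\<close>
  would produce.  The comparison function uses \<open>(Q\<^sup>N / N)' = (1 - r) Q\<^bsup>N-2\<^esup>\<close>.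
\<close>

lemma decay: "0 < r \<Longrightarrow> r \<le> s \<Longrightarrow> y r powr p / (2 * real N) \<le> - y' r"
proof -
  assume r: "0 < r" "r \<le> s"
  let ?C = "y r powr p / 2"
  have "M 0 - ?C * Q 0 ^ N / real N \<le> M r - ?C * Q r ^ N / real N"
  proof (rule nondecreasing_from_deriv[where g = "\<lambda>x. M x - ?C * Q x ^ N / real N"
        and g' = "\<lambda>x. Q x ^ (N - 2) * f (y x) - ?C * ((1 - x) * Q x ^ (N - 2))"])
    show "continuous_on {0..r} (\<lambda>x. M x - ?C * Q x ^ N / real N)"
      using N by (intro continuous_intros continuous_on_subset[OF M_continuous]) (use r s_lt_1 in auto)
    fix x assume x: "0 < x" "x < r"
    then show "((\<lambda>x. M x - ?C * Q x ^ N / real N) has_real_derivative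
        Q x ^ (N - 2) * f (y x) - ?C * ((1 - x) * Q x ^ (N - 2))) (at x)"
      using r s_lt_1 by (intro DERIV_diff M_deriv Q_pow_deriv_div) auto
    have "y r powr p \<le> y x powr p"
      using y_decreasing[of x r] above[of r] Y_pos x r p by (intro powr_mono2) auto
    then have "?C * 1 \<le> f (y x)"
      using source_large(1)[OF above[of x]] f_y[of x] x r by simp
    moreover have "?C * (1 - x) \<le> ?C * 1" using x by (intro mult_left_mono) auto
    ultimately have "Q x ^ (N - 2) * (?C * (1 - x)) \<le> Q x ^ (N - 2) * f (y x)"
      using x r s_lt_1 by (intro mult_left_mono) (auto intro: Q_pow_nonneg)
    then show "0 \<le> Q x ^ (N - 2) * f (y x) - ?C * ((1 - x) * Q x ^ (N - 2))" by (simp add: mult_ac)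
  qed (use r in auto)
  then have "?C * Q r ^ N / real N \<le> M r" by (simp add: M_0 Q_0_pow)
  then have "Q r ^ N * (?C / real N) \<le> Q r ^ N * (- y' r)" by (simp add: M_def mult_ac)
  moreover have "Q r ^ N > 0" using Q_pos[of r] r s_lt_1 by simp
  ultimately have "?C / real N \<le> - y' r" by (simp only: mult_le_cancel_left_pos)
  then show ?thesis by simp
qed

text \<open>
  The converse comparison, with the source frozen at its largest value; \<open>1 - r \<ge> 1 / 2\<close> accounts for the factor 2.
\<close>

lemma slope_bound: "0 < r \<Longrightarrow> r \<le> s \<Longrightarrow> - y' r \<le> B powr p"
proof -
  assume r: "0 < r" "r \<le> s"
  let ?C = "2 * B powr p"
  have "?C * Q 0 ^ N / real N - M 0 \<le> ?C * Q r ^ N / real N - M r"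
  proof (rule nondecreasing_from_deriv[where g = "\<lambda>x. ?C * Q x ^ N / real N - M x"
        and g' = "\<lambda>x. ?C * ((1 - x) * Q x ^ (N - 2)) - Q x ^ (N - 2) * f (y x)"])
    show "continuous_on {0..r} (\<lambda>x. ?C * Q x ^ N / real N - M x)"
      using N by (intro continuous_intros continuous_on_subset[OF M_continuous]) (use r s_lt_1 in auto)
    fix x assume x: "0 < x" "x < r"
    then show "((\<lambda>x. ?C * Q x ^ N / real N - M x) has_real_derivative
        ?C * ((1 - x) * Q x ^ (N - 2)) - Q x ^ (N - 2) * f (y x)) (at x)"
      using r s_lt_1 by (intro DERIV_diff M_deriv Q_pow_deriv_div) auto
    have "f (y x) \<le> y x powr p" using f_y[of x] x r lam above[of x] Y_pos by simp
    also have "\<dots> \<le> B powr p"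
      using y_le_B[of x] above[of x] Y_pos x r p by (intro powr_mono2) auto
    also have "\<dots> \<le> B powr p * (2 * (1 - x))"
      using mult_left_mono[of 1 "2 * (1 - x)" "B powr p"] x r s_lt_1 by simp
    finally have "Q x ^ (N - 2) * f (y x) \<le> Q x ^ (N - 2) * (B powr p * (2 * (1 - x)))"
      using x r s_lt_1 by (intro mult_left_mono) (auto intro: Q_pow_nonneg)
    then show "0 \<le> ?C * ((1 - x) * Q x ^ (N - 2)) - Q x ^ (N - 2) * f (y x)" by (simp add: algebra_simps)
  qed (use r in auto)
  then have "M r \<le> ?C * Q r ^ N / real N" by (simp add: M_0 Q_0_pow)
  also have "\<dots> = B powr p * Q r ^ N * (2 / real N)" by simp
  also have "\<dots> \<le> B powr p * Q r ^ N * 1"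
    using N r s_lt_1 by (intro mult_left_mono mult_nonneg_nonneg) (auto intro: Q_pow_nonneg)
  finally have "Q r ^ N * (- y' r) \<le> Q r ^ N * (B powr p)" by (simp add: M_def mult_ac)
  moreover have "Q r ^ N > 0" using Q_pos[of r] r s_lt_1 by simp
  ultimately show ?thesis by (simp only: mult_le_cancel_left_pos)
qed

lemma stays_large: "0 \<le> r \<Longrightarrow> r \<le> s \<Longrightarrow> B - B powr p * r \<le> y r"
proof -
  assume r: "0 \<le> r" "r \<le> s"
  have "y 0 + B powr p * 0 \<le> y r + B powr p * r"
  proof (rule nondecreasing_from_deriv[where g' = "\<lambda>x. y' x + B powr p", OF _ r(1)])
    show "continuous_on {0..r} (\<lambda>r. y r + B powr p * r)"
      by (intro continuous_intros continuous_on_subset[OF S(2)]) (use r s_lt_1 in auto)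
    fix x assume x: "0 < x" "x < r"
    then have "(y has_real_derivative y' x) (at x)" using r s_lt_1 by (intro S(5)) auto
    then show "((\<lambda>r. y r + B powr p * r) has_real_derivative y' x + B powr p) (at x)"
      by (auto intro!: derivative_eq_intros)
    show "0 \<le> y' x + B powr p" using slope_bound[of x] x r by simp
  qed
  then show ?thesis by (simp add: y0)
qed

text \<open>
  By \<open>decay\<close> the function \<open>y powr (1 - p)\<close> grows at least linearly, at a rate independent of the starting value.
\<close>

lemma time_bound: "Y powr (1 - p) * (2 * real N) \<ge> (p - 1) * s"
proof -
  let ?g = "\<lambda>r. y r powr (1 - p) - (p - 1) / (2 * real N) * r"
  have y_pos': "0 < y r" if "0 \<le> r" "r \<le> s" for r using above[OF that] Y_pos by simp
  have "?g 0 \<le> ?g s"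
  proof (rule nondecreasing_from_deriv[where g = ?g and g' = "\<lambda>x. (1 - p) * y x powr (- p) * y' x - (p - 1) / (2 * real N)"])
    show "continuous_on {0..s} ?g"
      by (intro continuous_intros continuous_on_subset[OF S(2)]) (use s s_lt_1 y_pos' in force)+
    fix x assume x: "0 < x" "x < s"
    have yx: "y x > 0" using y_pos'[of x] x by simp
    have "(y has_real_derivative y' x) (at x)" using x s_lt_1 by (intro S(5)) auto
    then have "((\<lambda>r. y r powr (1 - p)) has_real_derivative (1 - p) * y x powr (1 - p - 1) * y' x) (at x)"
      using DERIV_fun_powr[of y "y' x" x "1 - p"] yx by simp
    moreover have "((\<lambda>r. (p - 1) / (2 * real N) * r) has_real_derivative (p - 1) / (2 * real N)) (at x)"
      by (rule DERIV_cmult_Id)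
    ultimately show "(?g has_real_derivative (1 - p) * y x powr (- p) * y' x - (p - 1) / (2 * real N)) (at x)"
      using DERIV_diff by fastforce
    have "y x powr (- p) * (y x powr p / (2 * real N)) \<le> y x powr (- p) * (- y' x)"
      using decay[of x] x by (intro mult_left_mono) auto
    also have "y x powr (- p) * (y x powr p / (2 * real N)) = 1 / (2 * real N)"
      using yx by (simp add: powr_minus)
    finally have "(p - 1) * (1 / (2 * real N)) \<le> (p - 1) * (y x powr (- p) * (- y' x))"
      using p by (intro mult_left_mono) auto
    then show "0 \<le> (1 - p) * y x powr (- p) * y' x - (p - 1) / (2 * real N)"
      by (simp add: algebra_simps)
  qed (use s in auto)
  then have "(p - 1) / (2 * real N) * s \<le> y s powr (1 - p)"
    using powr_ge_zero[of "y 0" "1 - p"] by linarith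
  also have "\<dots> \<le> Y powr (1 - p)"
    using above[of s] s Y_pos p by (intro powr_mono2') auto
  finally show ?thesis using N by (simp add: field_simps)
qed

lemma P_deriv:
  assumes r: "0 < r" "r < s"
  obtains d where "(P has_real_derivative d) (at r)" "d \<ge> Q r ^ (N - 2) * (\<kappa> / 2 * y r powr (p + 1))"
proof -
  have r': "r < 1" "r \<le> 1" using r s_lt_1 by auto
  have yr: "y r > 0" using y_pos[of r] r r' by simp
  define fy where "fy = f (y r)"
  have fy: "fy = y r powr p - lam * y r" unfolding fy_def using f_y[of r] r by simp
  define y2 where "y2 = - (fy + real N * (1 - r) * y' r) / (r * (2 - r))"
  have y2: "(y' has_real_derivative y2) (at r)" unfolding y2_def fy_def by (rule S(6)[OF r(1) r'(1)])
  have y1: "(y has_real_derivative y' r) (at r)" by (rule S(5)[OF r(1) r'(1)])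
  define q where "q = (Q r)\<^sup>2"
  have qy2: "q * y2 = - (fy + real N * (1 - r) * y' r)"
    using r r' by (simp add: Q_sq y2_def q_def)
  have dq: "((\<lambda>r. (Q r)\<^sup>2) has_real_derivative 2 * (1 - r)) (at r)"
    using Q_power_deriv[OF r(1) r'(2), of 2 UNIV] by simp
  have dF: "((\<lambda>r. y r powr (p + 1) / (p + 1) - lam * (y r)\<^sup>2 / 2) has_real_derivative fy * y' r) (at r)"
  proof -
    have "((\<lambda>r. y r powr (p + 1)) has_real_derivative (p + 1) * y r powr p * y' r) (at r)"
      using DERIV_fun_powr[OF y1 yr, of "p + 1"] by simp
    moreover have "((\<lambda>r. (y r)\<^sup>2) has_real_derivative 2 * y r * y' r) (at r)"
      by (auto intro!: derivative_eq_intros y1)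
    ultimately have "((\<lambda>r. y r powr (p + 1) / (p + 1) - lam * (y r)\<^sup>2 / 2) has_real_derivative
        (p + 1) * y r powr p * y' r / (p + 1) - lam * (2 * y r * y' r) / 2) (at r)"
      by (intro DERIV_diff DERIV_cdivide DERIV_cmult)
    then show ?thesis using p by (simp add: fy left_diff_distrib mult.assoc)
  qed
  define E where "E = q * (y' r)\<^sup>2 / 2 + (y r powr (p + 1) / (p + 1) - lam * (y r)\<^sup>2 / 2) + \<sigma> * (y r * y' r)"
  define E' where "E' = (2 * (1 - r) * (y' r)\<^sup>2 + 2 * y' r * y2 * q) / 2 + fy * y' r + \<sigma> * (y' r * y' r + y2 * y r)"
  have "((\<lambda>r. (y' r)\<^sup>2) has_real_derivative 2 * y' r * y2) (at r)"
    by (auto intro!: derivative_eq_intros y2)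
  then have "((\<lambda>r. (Q r)\<^sup>2 * (y' r)\<^sup>2 / 2 + (y r powr (p + 1) / (p + 1) - lam * (y r)\<^sup>2 / 2) + \<sigma> * (y r * y' r))
      has_real_derivative E') (at r)"
    unfolding E'_def q_def by (intro DERIV_add DERIV_cdivide DERIV_cmult DERIV_mult dq dF y1 y2)
  then have dP: "(P has_real_derivative real N * (1 - r) * Q r ^ (N - 2) * E + E' * Q r ^ N) (at r)"
    unfolding P_def E_def q_def using r r' N by (intro DERIV_mult Q_power_deriv) auto
  have "real N * (1 - r) * Q r ^ (N - 2) * E + E' * Q r ^ N
     = Q r ^ (N - 2) * (real N * (1 - r) * E + E' * q)"
    unfolding Q_N q_def by (simp add: algebra_simps)
  also have "real N * (1 - r) * E + E' * q = \<sigma> * r * (q * (y' r)\<^sup>2)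
     + (real N * (1 - r) * (y r powr (p + 1) / (p + 1) - lam * (y r)\<^sup>2 / 2) - \<sigma> * (fy * y r))"
  proof -
    have "E' * q = q * (1 - r) * (y' r)\<^sup>2 + q * y' r * (q * y2) + q * fy * y' r + \<sigma> * (q * (y' r)\<^sup>2 + (q * y2) * y r)"
      by (simp add: E'_def power2_eq_square field_simps)
    then show ?thesis
      unfolding qy2 by (simp add: E_def \<sigma>_def power2_eq_square field_simps)
  qed
  also have "Q r ^ (N - 2) * \<dots> \<ge> Q r ^ (N - 2) * (\<kappa> / 2 * y r powr (p + 1))"
  proof (rule mult_left_mono)
    have pow: "y r powr p * y r = y r powr (p + 1)" using yr by (simp add: powr_add)
    have "r \<le> \<kappa> * (p + 1) / real N" using r s unfolding r1_def by simp
    then have "real N * r \<le> \<kappa> * (p + 1)" using N by (simp add: field_simps)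
    then have "real N * r / (p + 1) \<le> \<kappa>" using p by (simp add: field_simps)
    moreover have "real N / (p + 1) - \<sigma> = 2 * \<kappa>" by (simp add: \<kappa>_def)
    moreover have "real N * (1 - r) / (p + 1) = real N / (p + 1) - real N * r / (p + 1)"
      by (simp add: diff_divide_distrib right_diff_distrib)
    ultimately have "\<kappa> \<le> real N * (1 - r) / (p + 1) - \<sigma>" by linarith
    then have a: "\<kappa> * y r powr (p + 1) \<le> (real N * (1 - r) / (p + 1) - \<sigma>) * y r powr (p + 1)"
      by (intro mult_right_mono) auto
    have "real N * (1 - r) / 2 - \<sigma> \<le> 1"
    proof -
      have "real N * (1 - r) \<le> real N * 1" using r by (intro mult_left_mono) auto
      moreover have "X / 2 - (real N - 2) / 2 \<le> 1" if "X \<le> real N" for X :: real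
        using that by (simp add: field_simps)
      ultimately show ?thesis unfolding \<sigma>_def by simp
    qed
    then have b: "(real N * (1 - r) / 2 - \<sigma>) * (lam * (y r)\<^sup>2) \<le> 1 * (lam * (y r)\<^sup>2)"
      using lam by (intro mult_right_mono) auto
    have c: "lam * (y r)\<^sup>2 \<le> \<kappa> / 2 * y r powr (p + 1)"
      by (rule source_large) (use above[of r] r in auto)
    have d: "0 \<le> \<sigma> * r * (q * (y' r)\<^sup>2)"
      using \<sigma> r by (simp add: q_def)
    have "real N * (1 - r) * (y r powr (p + 1) / (p + 1) - lam * (y r)\<^sup>2 / 2) - \<sigma> * (fy * y r)
      = (real N * (1 - r) / (p + 1) - \<sigma>) * y r powr (p + 1) - (real N * (1 - r) / 2 - \<sigma>) * (lam * (y r)\<^sup>2)"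
      unfolding fy pow[symmetric] by (simp add: power2_eq_square algebra_simps)
    with a b c d show "\<kappa> / 2 * y r powr (p + 1) \<le> \<sigma> * r * (q * (y' r)\<^sup>2)
       + (real N * (1 - r) * (y r powr (p + 1) / (p + 1) - lam * (y r)\<^sup>2 / 2) - \<sigma> * (fy * y r))"
      by linarith
  next
    show "0 \<le> Q r ^ (N - 2)" using r r' by (simp add: Q_nonneg)
  qed
  finally show ?thesis using that dP by blast
qed

lemma P_increasing: "0 \<le> x \<Longrightarrow> x \<le> r \<Longrightarrow> r \<le> s \<Longrightarrow> P x \<le> P r"
proof (rule DERIV_nonneg_imp_increasing_open[where f = P])
  assume xr: "0 \<le> x" "x \<le> r" "r \<le> s"
  show "continuous_on {x..r} P" by (rule continuous_on_subset[OF P_continuous]) (use xr s_lt_1 in auto)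
  fix u assume "x < u" "u < r"
  then have u: "0 < u" "u < s" using xr by auto
  have "0 \<le> Q u ^ (N - 2) * (\<kappa> / 2 * y u powr (p + 1))"
    using u s_lt_1 \<kappa> Q_nonneg[of u] by simp
  moreover obtain d where "(P has_real_derivative d) (at u)" "d \<ge> Q u ^ (N - 2) * (\<kappa> / 2 * y u powr (p + 1))"
    using P_deriv[OF u] .
  ultimately show "\<exists>d. (P has_real_derivative d) (at u) \<and> 0 \<le> d"
    by (intro exI[of _ d]) simp
qed

lemma P_lower:
  assumes x: "0 \<le> x" "x \<le> s" and C: "0 \<le> C" "\<And>r. 0 \<le> r \<Longrightarrow> r \<le> x \<Longrightarrow> C \<le> y r"
  shows "\<kappa> / 2 * C powr (p + 1) * Q x ^ N / real N \<le> P x"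
proof -
  let ?D = "\<kappa> / 2 * C powr (p + 1)"
  have "P 0 - ?D * Q 0 ^ N / real N \<le> P x - ?D * Q x ^ N / real N"
  proof (rule DERIV_nonneg_imp_increasing_open[where f = "\<lambda>x. P x - ?D * Q x ^ N / real N", OF x(1)])
    show "continuous_on {0..x} (\<lambda>x. P x - ?D * Q x ^ N / real N)"
      using N by (intro continuous_intros continuous_on_subset[OF P_continuous]) (use x s_lt_1 in auto)
    fix u assume u': "0 < u" "u < x"
    then have u: "0 < u" "u < s" "u < 1" using x s_lt_1 by auto
    obtain d where d: "(P has_real_derivative d) (at u)" "d \<ge> Q u ^ (N - 2) * (\<kappa> / 2 * y u powr (p + 1))"
      using P_deriv[OF u(1,2)] .
    have "C powr (p + 1) \<le> y u powr (p + 1)" using C(1) C(2)[of u] u' p by (intro powr_mono2) auto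
    then have "?D \<le> \<kappa> / 2 * y u powr (p + 1)" using \<kappa> by simp
    moreover have "?D * (1 - u) \<le> ?D * 1" using u \<kappa> by (intro mult_left_mono) auto
    ultimately have "Q u ^ (N - 2) * (?D * (1 - u)) \<le> Q u ^ (N - 2) * (\<kappa> / 2 * y u powr (p + 1))"
      using u by (intro mult_left_mono) (auto intro: Q_pow_nonneg)
    with d(2) have "0 \<le> d - ?D * ((1 - u) * Q u ^ (N - 2))" by (simp add: mult_ac)
    then show "\<exists>d. ((\<lambda>x. P x - ?D * Q x ^ N / real N) has_real_derivative d) (at u) \<and> 0 \<le> d"
      using DERIV_diff[OF d(1) Q_pow_deriv_div[OF u(1,3), of ?D]] by blast
  qed
  then show ?thesis by (simp add: P_0 Q_0_pow)
qed

end

end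

context large_solution
begin

lemma hitting:
  obtains s where "0 < s" "s \<le> r1" "y s = Y" "\<And>r. 0 \<le> r \<Longrightarrow> r \<le> s \<Longrightarrow> Y \<le> y r"
proof -
  have "\<exists>x. 0 \<le> x \<and> x \<le> r1 \<and> y x < Y"
  proof (rule ccontr)
    assume "\<not> ?thesis"
    then have "(p - 1) * r1 \<le> Y powr (1 - p) * (2 * real N)"
      by (intro time_bound r1) (auto simp: not_less)
    also have "Y powr (1 - p) = 1 / A"
      using powr_minus_divide[of Y "p - 1"] by (simp add: Y_powr)
    finally have "A \<le> 2 * real N / ((p - 1) * r1)"
      using A(1) p r1 by (simp add: field_simps)
    then show False using A(4) by simp
  qed
  then obtain x where x: "0 \<le> x" "x \<le> r1" "y x < Y" by blast
  have "Y < y 0" using B Y_pos by (simp add: y0)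
  moreover have "continuous_on {0..x} y" by (rule continuous_on_subset[OF S(2)]) (use x r1 in auto)
  ultimately obtain z where z: "0 < z" "z \<le> x" "y z = Y" "\<And>r. 0 \<le> r \<Longrightarrow> r < z \<Longrightarrow> y r > Y"
    using first_point[of 0 x y Y] x by auto
  show ?thesis
  proof (rule that[of z])
    show "Y \<le> y r" if "0 \<le> r" "r \<le> z" for r
      using z(3) z(4)[of r] that by (cases "r = z") auto
  qed (use z x in auto)
qed

text \<open>
  If the flux at \<open>s\<close> were larger, then \<open>y\<close> would keep falling on \<open>{s..2 * s}\<close> too fast to remain positive
  up to \<open>2 * s \<le> 1\<close>: there \<open>Q \<le> 2 sqrt s\<close>, and the lower bound \<open>- K\<close> for the nonlinearity limits
  how much of the flux can be lost.
\<close>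

lemma M_upper:
  assumes s: "0 < s" "s \<le> r1" "y s = Y" "\<And>r. 0 \<le> r \<Longrightarrow> r \<le> s \<Longrightarrow> Y \<le> y r"
  shows "M s \<le> (4 * Y + K) * (2 * sqrt s) ^ (N - 2)"
proof (rule ccontr)
  define h where "h = 2 * sqrt s"
  have h: "h > 0" "h\<^sup>2 = 4 * s" using s by (auto simp: h_def power_mult_distrib)
  have s2: "2 * s \<le> 1" "s \<le> 1" using s r1 by auto
  define H where "H = h ^ (N - 2)"
  have H: "H > 0" using h by (simp add: H_def)
  have hN: "h ^ N = H * (4 * s)" using two_le_Suc_Suc[OF N] h(2) by (auto simp: H_def power2_eq_square)
  define m0 where "m0 = M s - K * H * s"
  assume "\<not> M s \<le> (4 * Y + K) * (2 * sqrt s) ^ (N - 2)"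
  then have big: "(4 * Y + K) * H < M s" by (simp add: H_def h_def)
  have KHs: "K * H * s \<le> K * H * 1" using K H s2 by (intro mult_left_mono) auto
  have m0: "4 * Y * H < m0" using big KHs by (simp add: m0_def algebra_simps)
  have "4 * Y * H > 0" using Y_pos H by simp
  then have m0_pos: "m0 > 0" using m0 by linarith
  have Qh: "Q x \<le> h" if "0 \<le> x" "x \<le> 2 * s" for x
  proof -
    have "x * (2 - x) \<le> 4 * s"
      using mult_left_mono[of "2 - x" 2 x] that by simp
    then have "(Q x)\<^sup>2 \<le> h\<^sup>2" using that s2 by (simp add: Q_sq h(2))
    then show ?thesis using h(1) by (simp add: abs_le_square_iff[symmetric])
  qed
  have M_ge: "m0 \<le> M r" if r: "s \<le> r" "r \<le> 2 * s" for r
  proof -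
    have "M s + K * H * s \<le> M r + K * H * r"
    proof (rule nondecreasing_from_deriv[where g = "\<lambda>r. M r + K * H * r" and g' = "\<lambda>x. Q x ^ (N - 2) * f (y x) + K * H", OF _ r(1)])
      show "continuous_on {s..r} (\<lambda>r. M r + K * H * r)"
        by (intro continuous_intros continuous_on_subset[OF M_continuous]) (use r s s2 in auto)
      fix x assume x: "s < x" "x < r"
      then have x': "0 < x" "x < 1" "x \<le> 2 * s" using s s2 r by auto
      show "((\<lambda>r. M r + K * H * r) has_real_derivative Q x ^ (N - 2) * f (y x) + K * H) (at x)"
        by (intro DERIV_add M_deriv[OF x'(1,2)] DERIV_cmult_Id)
      have "Q x ^ (N - 2) * - K \<le> Q x ^ (N - 2) * f (y x)"
        using f_below x' by (intro mult_left_mono Q_pow_nonneg) auto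
      moreover have "Q x ^ (N - 2) * K \<le> H * K"
        unfolding H_def using Qh[of x] x' K by (intro mult_right_mono power_mono Q_nonneg) auto
      ultimately show "0 \<le> Q x ^ (N - 2) * f (y x) + K * H" by (simp add: mult_ac)
    qed
    moreover have "K * H * r \<le> K * H * (2 * s)" using K H r by (intro mult_left_mono) auto
    ultimately show ?thesis by (simp add: m0_def)
  qed
  have "- y s - m0 / h ^ N * s \<le> - y (2 * s) - m0 / h ^ N * (2 * s)"
  proof (rule nondecreasing_from_deriv[where g = "\<lambda>r. - y r - m0 / h ^ N * r" and g' = "\<lambda>x. - y' x - m0 / h ^ N"])
    show "continuous_on {s..2 * s} (\<lambda>r. - y r - m0 / h ^ N * r)"
      by (intro continuous_intros continuous_on_subset[OF S(2)]) (use s s2 in auto)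
    fix x assume x: "s < x" "x < 2 * s"
    then have x': "0 < x" "x < 1" using s s2 by auto
    show "((\<lambda>r. - y r - m0 / h ^ N * r) has_real_derivative - y' x - m0 / h ^ N) (at x)"
      by (intro DERIV_diff DERIV_minus S(5)[OF x'] DERIV_cmult_Id)
    have Qx: "0 < Q x ^ N" using Q_pos[of x] x' by simp
    have "m0 \<le> Q x ^ N * (- y' x)" using M_ge[of x] x by (simp add: M_def)
    then have a: "m0 / Q x ^ N \<le> - y' x" using Qx by (simp add: field_simps)
    have "Q x ^ N \<le> h ^ N" using Qh[of x] x x' by (intro power_mono Q_nonneg) auto
    then have "m0 / h ^ N \<le> m0 / Q x ^ N" using m0_pos Qx by (intro divide_left_mono) auto
    with a show "0 \<le> - y' x - m0 / h ^ N" by simp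
  qed (use s in auto)
  then have "m0 / h ^ N * s \<le> Y - y (2 * s)" by (simp add: s(3))
  also have "\<dots> < Y" using y_pos[of "2 * s"] s s2 by simp
  finally have "m0 / (4 * H) < Y" using s H by (simp add: hN field_simps)
  then show False using m0 H by (simp add: field_simps)
qed

text \<open>
  Two estimates of \<open>P s\<close> at the time \<open>s\<close> when \<open>y\<close> comes down to \<open>Y\<close>.  From below: \<open>y \<ge> B / 2\<close> as long as
  \<open>r \<le> rB\<close>, and \<open>P\<close> integrates \<open>y\<^bsup>p+1\<^esup>\<close> over that time.  From above: the flux bound and \<open>y s = Y\<close>.
\<close>

lemma initial_value_bound:
  "\<kappa> / 2 * (B / 2) powr (p + 1) * (B powr (1 - p) / 2) powr (real N / 2) / real N
     \<le> ((4 * Y + K) * 2 ^ (N - 2))\<^sup>2 / 2 + Y powr (p + 1) / (p + 1)"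
proof -
  obtain s where s: "0 < s" "s \<le> r1" "y s = Y" "\<And>r. 0 \<le> r \<Longrightarrow> r \<le> s \<Longrightarrow> Y \<le> y r"
    using hitting by blast
  have s1: "s < 1" using s r1 by auto
  have B0: "B > 0" using B Y_pos by simp
  \<comment> \<open>At a slope of at most \<open>B powr p\<close>, falling from \<open>B\<close> to \<open>B / 2\<close> takes at least \<open>rB\<close>.\<close>
  define rB where "rB = B powr (1 - p) / 2"
  have rB: "rB > 0" using B0 by (simp add: rB_def)
  have "B powr p * B powr (1 - p) = B powr (p + (1 - p))" by (simp only: powr_add)
  then have BrB: "B powr p * rB = B / 2" using B0 by (simp add: rB_def)
  have rBs: "rB \<le> s"
  proof (rule ccontr)
    assume "\<not> rB \<le> s"
    then have "B powr p * s \<le> B powr p * rB" by (intro mult_left_mono) auto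
    then have "B / 2 \<le> y s" using stays_large[OF s(1,2,4), of s] s(1) BrB by simp
    then show False using s(3) B by simp
  qed
  have y_half: "B / 2 \<le> y r" if "0 \<le> r" "r \<le> rB" for r
  proof -
    have "B powr p * r \<le> B powr p * rB" using that by (intro mult_left_mono) auto
    then show ?thesis using stays_large[OF s(1,2,4), of r] that rBs BrB by simp
  qed
  have "rB powr (real N / 2) = sqrt rB ^ N"
    using rB by (simp add: powr_half_sqrt[symmetric] powr_powr powr_realpow[symmetric])
  also have "\<dots> \<le> Q rB ^ N"
  proof (rule power_mono)
    have "rB * 1 \<le> rB * (2 - rB)" using rB rBs s1 by (intro mult_left_mono) auto
    then show "sqrt rB \<le> Q rB" by (simp add: Q_def)
  qed (use rB in simp)
  finally have "\<kappa> / 2 * (B / 2) powr (p + 1) * rB powr (real N / 2) / real N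
      \<le> \<kappa> / 2 * (B / 2) powr (p + 1) * Q rB ^ N / real N"
    using \<kappa> by (intro divide_right_mono mult_left_mono) auto
  also have "\<dots> \<le> P rB"
    by (rule P_lower[OF s(1,2,4) _ rBs]) (use rB B0 y_half in auto)
  also have "\<dots> \<le> P s"
    by (rule P_increasing[OF s(1,2,4) _ rBs]) (use rB in auto)
  also have "P s \<le> ((4 * Y + K) * 2 ^ (N - 2))\<^sup>2 / 2 + Y powr (p + 1) / (p + 1)"
  proof -
    let ?X = "(4 * Y + K) * 2 ^ (N - 2)"
    have Qs: "Q s > 0" using Q_pos[of s] s s1 by simp
    have Qs1: "Q s \<le> 1"
    proof -
      have "s * (2 - s) \<le> 1" using zero_le_power2[of "1 - s"] by (simp add: power2_eq_square algebra_simps)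
      then have "(Q s)\<^sup>2 \<le> 1\<^sup>2" using s(1) s1 by (simp add: Q_sq)
      then show ?thesis by (rule power2_le_imp_le) simp
    qed
    have "s * 1 \<le> s * (2 - s)" using s s1 by (intro mult_left_mono) auto
    then have sq: "sqrt s \<le> Q s" by (simp add: Q_def)
    have y's: "y' s \<le> 0" by (rule y'_nonpos[OF s(1,2,4) s(1)]) auto
    have "M s \<le> (4 * Y + K) * (2 * sqrt s) ^ (N - 2)" by (rule M_upper[OF s])
    also have "\<dots> \<le> (4 * Y + K) * (2 * Q s) ^ (N - 2)"
      using sq s Y_pos K by (intro mult_left_mono power_mono) auto
    finally have "Q s ^ (N - 2) * ((Q s)\<^sup>2 * - y' s) \<le> Q s ^ (N - 2) * ?X"
      unfolding M_def Q_N by (simp add: power_mult_distrib mult_ac)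
    then have "(Q s)\<^sup>2 * - y' s \<le> ?X" using Qs by (simp only: mult_le_cancel_left_pos zero_less_power)
    then have "((Q s)\<^sup>2 * - y' s)\<^sup>2 \<le> ?X\<^sup>2" using y's by (intro power_mono) (auto simp: mult_le_0_iff)
    then have sq2: "((Q s)\<^sup>2 * y' s)\<^sup>2 \<le> ?X\<^sup>2" by simp
    have "Q s ^ N * ((Q s)\<^sup>2 * (y' s)\<^sup>2 / 2) = Q s ^ (N - 2) * (((Q s)\<^sup>2 * y' s)\<^sup>2 / 2)"
      unfolding Q_N by (simp add: power_mult_distrib power2_eq_square)
    also have "\<dots> \<le> 1 * (((Q s)\<^sup>2 * y' s)\<^sup>2 / 2)"
      using Qs Qs1 by (intro mult_right_mono power_le_one) auto
    finally have 1: "Q s ^ N * ((Q s)\<^sup>2 * (y' s)\<^sup>2 / 2) \<le> ?X\<^sup>2 / 2" using sq2 by simp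
    have "Q s ^ N * (Y powr (p + 1) / (p + 1) - lam * Y\<^sup>2 / 2) \<le> Q s ^ N * (Y powr (p + 1) / (p + 1))"
      using Qs lam by (intro mult_left_mono) auto
    also have "\<dots> \<le> 1 * (Y powr (p + 1) / (p + 1))"
      using Qs Qs1 p by (intro mult_right_mono power_le_one) auto
    finally have 2: "Q s ^ N * (Y powr (p + 1) / (p + 1) - lam * Y\<^sup>2 / 2) \<le> Y powr (p + 1) / (p + 1)" by simp
    have "Y * y' s \<le> 0" using Y_pos y's by (simp add: mult_le_0_iff)
    then have "\<sigma> * (Y * y' s) \<le> 0" by (rule mult_nonneg_nonpos[OF \<sigma>])
    then have 3: "Q s ^ N * (\<sigma> * (Y * y' s)) \<le> 0" by (rule mult_nonneg_nonpos[rotated]) (use Qs in simp)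
    have "P s = Q s ^ N * ((Q s)\<^sup>2 * (y' s)\<^sup>2 / 2) + Q s ^ N * (Y powr (p + 1) / (p + 1) - lam * Y\<^sup>2 / 2)
       + Q s ^ N * (\<sigma> * (Y * y' s))"
      unfolding P_def s(3) by (simp add: distrib_left)
    with 1 2 3 show ?thesis by linarith
  qed
  finally show ?thesis unfolding rB_def .
qed

end

text \<open>
  The left-hand side of \<open>initial_value_bound\<close> is a multiple of \<open>B powr \<gamma>\<close>, where \<open>\<gamma> > 0\<close> is just another form of
  subcriticality, and the right-hand side does not depend on \<open>B\<close>.
\<close>

lemma (in subcritical) reaches_zero:
  "\<exists>B0. \<forall>B\<ge>B0. \<forall>f y y'. (\<forall>w. 0 < w \<and> w \<le> B \<longrightarrow> f w = w powr p - lam * w) \<longrightarrow>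
    (\<forall>w\<ge>B. 0 \<le> f w) \<longrightarrow> (\<forall>w. - K \<le> f w) \<longrightarrow>
    axial_solution N f y y' \<longrightarrow> y 0 = B \<longrightarrow> (\<exists>r\<in>{0..1}. y r \<le> 0)"
proof -
  define \<gamma> where "\<gamma> = (p + 1) + (1 - p) * (real N / 2)"
  have \<gamma>: "\<gamma> > 0" using sub by (simp add: \<gamma>_def field_simps)
  define C1 where "C1 = \<kappa> / 2 / (2 powr (p + 1)) / (2 powr (real N / 2)) / real N"
  have C1: "C1 > 0" using \<kappa> N by (simp add: C1_def)
  define C2 where "C2 = ((4 * Y + K) * 2 ^ (N - 2))\<^sup>2 / 2 + Y powr (p + 1) / (p + 1)"
  have C2: "C2 \<ge> 0" using p by (simp add: C2_def)
  \<comment> \<open>The first entry gives \<open>2 * Y < B\<close>, the second makes \<open>C1 * B powr \<gamma>\<close> exceed \<open>C2\<close>.\<close>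
  define B0 where "B0 = max (2 * Y + 1) ((C2 / C1 + 1) powr (1 / \<gamma>))"
  have "B0 > 0" using Y_pos by (simp add: B0_def)
  show ?thesis
  proof (intro exI[of _ B0] allI impI)
    fix B f y y'
    assume ge: "B0 \<le> B" and f: "\<forall>w. 0 < w \<and> w \<le> B \<longrightarrow> f w = w powr p - lam * w"
      "\<forall>w\<ge>B. 0 \<le> f w" "\<forall>w. - K \<le> f w" and sol: "axial_solution N f y y'" and y0: "y 0 = B"
    show "\<exists>r\<in>{0..1}. y r \<le> 0"
    proof (rule ccontr)
      assume "\<not> ?thesis"
      then interpret large_solution N p lam K f y y' B
        by unfold_locales (use ge f sol y0 in \<open>auto simp: B0_def not_le\<close>)
      have B_pos: "B > 0" using ge \<open>B0 > 0\<close> by simp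
      have "C1 * B powr \<gamma> = \<kappa> / 2 * (B / 2) powr (p + 1) * (B powr (1 - p) / 2) powr (real N / 2) / real N"
        using B_pos by (simp add: C1_def \<gamma>_def powr_add powr_divide powr_powr)
      also have "\<dots> \<le> C2" unfolding C2_def by (rule initial_value_bound)
      finally have "B powr \<gamma> \<le> C2 / C1" using C1 by (simp add: field_simps)
      moreover have "C2 / C1 + 1 \<le> B powr \<gamma>"
      proof -
        have pos: "C2 / C1 + 1 > 0" using C1 C2 by (intro add_nonneg_pos) auto
        have "((C2 / C1 + 1) powr (1 / \<gamma>)) powr \<gamma> \<le> B powr \<gamma>"
          using ge \<gamma> by (intro powr_mono2) (auto simp: B0_def)
        then show ?thesis using \<gamma> pos by (simp add: powr_powr)
      qed
      ultimately show False by simp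
    qed
  qed
qed

section \<open>Matching the two hemispheres\<close>

text \<open>
  Brouwer's theorem for the map that moves a point along \<open>(V1, V2)\<close> and then clips it to the rectangle.  At a
  fixed point the field vanishes, or the point is on the boundary and the field points outwards.
\<close>

lemma rectangle_variational_inequality:
  fixes V1 V2 :: "real \<times> real \<Rightarrow> real"
  assumes c1: "continuous_on ({a0..a1} \<times> {b0..b1}) V1" and c2: "continuous_on ({a0..a1} \<times> {b0..b1}) V2"
    and le: "a0 \<le> a1" "b0 \<le> b1"
  obtains a b where "a \<in> {a0..a1}" "b \<in> {b0..b1}"
    "V1 (a, b) = 0 \<or> a = a1 \<and> V1 (a, b) \<ge> 0 \<or> a = a0 \<and> V1 (a, b) \<le> 0"
    "V2 (a, b) = 0 \<or> b = b1 \<and> V2 (a, b) \<ge> 0 \<or> b = b0 \<and> V2 (a, b) \<le> 0"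
proof -
  let ?S = "{a0..a1} \<times> {b0..b1}"
  define T where "T = (\<lambda>x. (max a0 (min (fst x + V1 x) a1), max b0 (min (snd x + V2 x) b1)))"
  have "continuous_on ?S T"
    unfolding T_def by (intro continuous_intros c1 c2)
  moreover have "T \<in> ?S \<rightarrow> ?S" using le by (auto simp: T_def)
  moreover have "compact ?S" "convex ?S" by (auto intro: compact_Times convex_Times)
  moreover have "?S \<noteq> {}" using le by auto
  ultimately obtain x where x: "x \<in> ?S" "T x = x" using brouwer[of ?S T] by blast
  show ?thesis
  proof (rule that[of "fst x" "snd x"])
    have "fst (T x) = fst x" "snd (T x) = snd x" using x(2) by simp_all
    then have f: "max a0 (min (fst x + V1 x) a1) = fst x" "max b0 (min (snd x + V2 x) b1) = snd x"
      by (simp_all add: T_def)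
    have bd: "a0 \<le> fst x" "fst x \<le> a1" "b0 \<le> snd x" "snd x \<le> b1" using x(1) by (auto simp: mem_Times_iff)
    show "V1 (fst x, snd x) = 0 \<or> fst x = a1 \<and> V1 (fst x, snd x) \<ge> 0 \<or> fst x = a0 \<and> V1 (fst x, snd x) \<le> 0"
      using f(1) bd by (auto simp: max_def min_def split: if_splits)
    show "V2 (fst x, snd x) = 0 \<or> snd x = b1 \<and> V2 (fst x, snd x) \<ge> 0 \<or> snd x = b0 \<and> V2 (fst x, snd x) \<le> 0"
      using f(2) bd by (auto simp: max_def min_def split: if_splits)
  qed (use x in auto)
qed

text \<open>
  The features of \<open>w powr p - lam * w\<close> that matter, after truncation to a Lipschitz function: a
  rest state \<open>c\<close> that is the minimum of the potential \<open>F\<close>, and a starting value \<open>B\<close> from which every solution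
  reaches 0 before the equator.
\<close>

locale shooting =
  fixes N :: nat and f F :: "real \<Rightarrow> real" and c m L B :: real
  assumes N: "N \<ge> 2" and c: "0 < c" "c < B"
    and lip: "\<And>w w'. \<bar>f w - f w'\<bar> \<le> L * \<bar>w - w'\<bar>"
    and F: "\<And>w. (F has_real_derivative f w) (at w)" and F_0: "F 0 = 0"
    and f_nonpos: "\<And>w. w \<le> 0 \<Longrightarrow> f w = 0"
    and f_neg: "\<And>w. 0 < w \<Longrightarrow> w < c \<Longrightarrow> f w < 0"
    and f_c: "f c = 0"
    and f_pos: "\<And>w. c < w \<Longrightarrow> f w > 0"
    and f'_c: "(f has_real_derivative m) (at c)"
    and hits: "\<And>y y'. axial_solution N f y y' \<Longrightarrow> y 0 = B \<Longrightarrow> \<exists>r\<in>{0..1}. y r \<le> 0"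
begin

lemma F_cont: "continuous_on S F"
  using F by (meson DERIV_isCont continuous_at_imp_continuous_on)

lemma f_cont: "continuous_on S f"
proof (rule continuous_onI)
  fix x e :: real assume e: "e > 0"
  have "0 \<le> L" using order_trans[OF abs_ge_zero lip[of 1 0]] by simp
  show "\<exists>d>0. \<forall>x'\<in>S. dist x' x < d \<longrightarrow> dist (f x') (f x) \<le> e"
  proof (intro exI[of _ "e / (L + 1)"] conjI ballI impI)
    show "0 < e / (L + 1)" using e \<open>0 \<le> L\<close> by simp
    fix x' assume "dist x' x < e / (L + 1)"
    then have "L * \<bar>x' - x\<bar> \<le> (L + 1) * (e / (L + 1))"
      using \<open>0 \<le> L\<close> by (intro mult_mono) (auto simp: dist_real_def)
    then show "dist (f x') (f x) \<le> e" using lip[of x' x] \<open>0 \<le> L\<close> by (simp add: dist_real_def)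
  qed
qed

lemma F_nonpos: "w \<le> 0 \<Longrightarrow> F w = 0"
proof (cases "w = 0")
  case False
  assume "w \<le> 0"
  have "F 0 = F w"
    by (rule DERIV_isconst_end[OF _ F_cont]) (use False \<open>w \<le> 0\<close> F f_nonpos in \<open>auto, metis less_imp_le\<close>)
  then show ?thesis by (simp add: F_0)
qed (simp add: F_0)

lemma F_dec: "0 \<le> w \<Longrightarrow> w < w' \<Longrightarrow> w' \<le> c \<Longrightarrow> F w' < F w"
  by (rule DERIV_neg_imp_decreasing_open[OF _ _ F_cont]) (use F f_neg in force)+

lemma F_inc: "c \<le> w \<Longrightarrow> w < w' \<Longrightarrow> F w < F w'"
  by (rule DERIV_pos_imp_increasing_open[OF _ _ F_cont]) (use F f_pos in force)+

lemma F_neg: "0 < w \<Longrightarrow> w \<le> c \<Longrightarrow> F w < 0"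
  using F_dec[of 0 w] by (simp add: F_0)

lemma F_min: "w \<noteq> c \<Longrightarrow> F c < F w"
  using F_neg[of c] F_nonpos[of w] F_dec[of w c] F_inc[of c w] c by (cases "w \<le> 0"; cases "w < c") auto

lemma lip_zero: "f y1 = 0 \<Longrightarrow> \<bar>f w\<bar> \<le> L * \<bar>w - y1\<bar>"
  using lip[of w y1] by simp

lemma rest_point:
  assumes sol: "axial_solution N f y y'" and r: "0 < r" "r \<le> 1" and rest: "f (y r) = 0" "y' r = 0"
  shows "y 0 = y r"
  by (rule solution_unique_backward[OF sol lip_zero[OF rest(1)] r refl rest(2)])

text \<open>
  As \<open>F\<close> vanishes on negative numbers, negative energy at the equator implies \<open>y 1 > 0\<close>.  So a nonpositive value would give a nonpositive
  interior minimum.  That is a rest point, which \<open>rest_point\<close> excludes.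
\<close>

lemma positive_of_negative_energy:
  assumes sol: "axial_solution N f y y'" and y0: "y 0 > 0" and E: "energy F y y' 1 < 0" and r: "r \<in> {0..1}"
  shows "y r > 0"
proof (rule ccontr)
  assume "\<not> y r > 0"
  note S = axial_solutionD[OF sol]
  obtain x where x: "x \<in> {0..1}" "\<And>t. t \<in> {0..1} \<Longrightarrow> y x \<le> y t"
    using continuous_attains_inf[OF _ _ S(2)] by auto
  have yx: "y x \<le> 0" using x(2)[OF r] \<open>\<not> y r > 0\<close> by simp
  have "y 1 > 0"
  proof (rule ccontr)
    assume "\<not> y 1 > 0"
    then have "F (y 1) = 0" by (intro F_nonpos) simp
    then show False using E by (simp add: energy_def)
  qed
  then have x01: "0 < x" "x < 1" using yx y0 x(1) by (auto simp: less_le)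
  have "y' x = 0"
  proof (rule DERIV_local_min[OF S(5)[OF x01]])
    show "0 < min x (1 - x)" using x01 by simp
    show "\<forall>t. \<bar>x - t\<bar> < min x (1 - x) \<longrightarrow> y x \<le> y t" by (intro allI impI x(2)) auto
  qed
  then have "y 0 = y x" using rest_point[OF sol x01(1)] x01 f_nonpos[OF yx] by simp
  then show False using yx y0 by simp
qed

text \<open>
  Energy increases strictly along rays from the rest state \<open>(c, 0)\<close>, so angle and energy determine a
  point of the half-plane.
\<close>

lemma energy_ray:
  assumes k: "k > 1" and w: "0 \<le> c + d" "0 \<le> c + k * d" and nz: "d \<noteq> 0 \<or> p \<noteq> 0"
  shows "p\<^sup>2 / 2 + F (c + d) < (k * p)\<^sup>2 / 2 + F (c + k * d)"
proof -
  have kk: "k\<^sup>2 > 1" using k by (simp add: one_less_power)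
  have p: "p\<^sup>2 \<le> (k * p)\<^sup>2" "p \<noteq> 0 \<Longrightarrow> p\<^sup>2 < (k * p)\<^sup>2"
    using kk mult_right_mono[of 1 "k\<^sup>2" "p\<^sup>2"] by (auto simp: power_mult_distrib)
  consider "d = 0" | "d > 0" | "d < 0" by linarith
  then show ?thesis
  proof cases
    case 1
    then show ?thesis using p nz by simp
  next
    case 2
    then have "F (c + d) < F (c + k * d)" using k by (intro F_inc) auto
    then show ?thesis using p(1) by simp
  next
    case 3
    then have "F (c + d) < F (c + k * d)" using k w by (intro F_dec) auto
    then show ?thesis using p(1) by simp
  qed
qed

text \<open>
  A positive solution \<open>c + e * \<phi>\<close> on one hemisphere.  Factoring out the amplitude \<open>e\<close> keeps the angle meaningful
  in the limit \<open>e = 0\<close>, where \<open>\<phi>\<close> solves the linearized equation.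
\<close>

definition branch :: "real \<Rightarrow> (real \<Rightarrow> real) \<Rightarrow> (real \<Rightarrow> real) \<Rightarrow> (real \<Rightarrow> real) \<Rightarrow> bool" where
  "branch e \<phi> \<phi>' \<rho> \<longleftrightarrow> e \<noteq> 0 \<and> axial_solution N f (\<lambda>r. c + e * \<phi> r) (\<lambda>r. e * \<phi>' r) \<and>
     phase_angle \<phi> \<phi>' \<rho> \<and> (\<forall>r\<in>{0..1}. (\<phi> has_real_derivative \<phi>' r) (at r within {0..1})) \<and>
     (\<forall>r\<in>{0..1}. 0 < c + e * \<phi> r \<and> c + e * \<phi> r \<le> B)"

text \<open>
  Writing \<open>f w = G w * (w - c)\<close> with \<open>G\<close> continuous, also at \<open>c\<close> where \<open>G c = m\<close>, the equation for
  \<open>\<phi> = (y - c) / e\<close> becomes one with nonlinearity \<open>G (c + e * \<phi>) * \<phi>\<close>, which is meaningful and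
  continuous at \<open>e = 0\<close>.
\<close>

lemma shooting_curve:
  obtains \<phi> \<phi>' \<rho> :: "real \<Rightarrow> real \<Rightarrow> real" where
    "continuous_on ({- c..B - c} \<times> {0..1}) (\<lambda>(e, r). \<phi> e r)"
    "continuous_on ({- c..B - c} \<times> {0..1}) (\<lambda>(e, r). \<phi>' e r)"
    "continuous_on ({- c..B - c} \<times> {0..1}) (\<lambda>(e, r). \<rho> e r)"
    "\<And>e. e \<in> {- c..B - c} \<Longrightarrow> axial_solution N f (\<lambda>r. c + e * \<phi> e r) (\<lambda>r. e * \<phi>' e r)"
    "\<And>e. e \<in> {- c..B - c} \<Longrightarrow> \<phi> e 0 = 1"
    "\<And>e. e \<in> {- c..B - c} \<Longrightarrow> phase_angle (\<phi> e) (\<phi>' e) (\<rho> e)"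
    "\<And>e r. e \<in> {- c..B - c} \<Longrightarrow> r \<in> {0..1} \<Longrightarrow> (\<phi> e has_real_derivative \<phi>' e r) (at r within {0..1})"
    "axial_solution N (\<lambda>w. m * w) (\<phi> 0) (\<phi>' 0)"
proof -
  obtain G where G: "\<And>w. f w = G w * (w - c)" "isCont G c" "G c = m"
    using f'_c f_c unfolding CARAT_DERIV by auto
  have G_cont: "continuous_on UNIV G"
    unfolding continuous_on_eq_continuous_within
  proof
    fix w :: real
    show "continuous (at w) G"
    proof (cases "w = c")
      case False
      have "isCont (\<lambda>w. f w / (w - c)) w"
        using f_cont[of UNIV] False by (auto intro!: continuous_intros simp: continuous_on_eq_continuous_within)
      moreover have "eventually (\<lambda>w. f w / (w - c) = G w) (nhds w)"
        using t1_space_nhds[OF False] by eventually_elim (simp add: G(1))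
      ultimately show ?thesis using isCont_cong[of "\<lambda>w. f w / (w - c)" G w] by simp
    qed (use G in simp)
  qed
  define H where "H = (\<lambda>e x. G (c + e * x) * x)"
  have H_f: "e * H e x = f (c + e * x)" for e x by (simp add: H_def G(1))
  have H_lip: "\<bar>H e x - H e x'\<bar> \<le> max L \<bar>m\<bar> * \<bar>x - x'\<bar>" for e x x'
  proof (cases "e = 0")
    case True
    then have "\<bar>H e x - H e x'\<bar> = \<bar>m\<bar> * \<bar>x - x'\<bar>"
      by (simp add: H_def G(3) right_diff_distrib[symmetric] abs_mult)
    also have "\<dots> \<le> max L \<bar>m\<bar> * \<bar>x - x'\<bar>" by (intro mult_right_mono) auto
    finally show ?thesis .
  next
    case False
    have "\<bar>e\<bar> * \<bar>H e x - H e x'\<bar> = \<bar>f (c + e * x) - f (c + e * x')\<bar>"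
      by (simp add: H_f[symmetric] right_diff_distrib[symmetric] abs_mult)
    also have "\<dots> \<le> L * \<bar>(c + e * x) - (c + e * x')\<bar>" by (rule lip)
    also have "\<dots> = \<bar>e\<bar> * (L * \<bar>x - x'\<bar>)" by (simp add: right_diff_distrib[symmetric] abs_mult)
    finally have "\<bar>H e x - H e x'\<bar> \<le> L * \<bar>x - x'\<bar>" using False by simp
    also have "\<dots> \<le> max L \<bar>m\<bar> * \<bar>x - x'\<bar>" by (intro mult_right_mono) auto
    finally show ?thesis .
  qed
  have H_cont: "continuous_on ({- c..B - c} \<times> UNIV) (\<lambda>(e, w). H e w)"
    unfolding H_def case_prod_unfold by (intro continuous_intros continuous_on_compose2[OF G_cont]) auto
  have le: "- c \<le> B - c" using c by simp
  obtain \<phi> \<phi>' where \<phi>: "continuous_on ({- c..B - c} \<times> {0..1}) (\<lambda>(e, r). \<phi> e r)"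
    "continuous_on ({- c..B - c} \<times> {0..1}) (\<lambda>(e, r). \<phi>' e r)"
    and sol: "\<And>e. e \<in> {- c..B - c} \<Longrightarrow> axial_solution N (H e) (\<phi> e) (\<phi>' e) \<and> \<phi> e 0 = 1"
    using shooting_family[OF N le H_cont H_lip] by blast
  have nz: "\<phi>' e r \<noteq> 0" if e: "e \<in> {- c..B - c}" and r: "r \<in> {0<..1}" and z: "\<phi> e r = 0" for e r
  proof
    assume "\<phi>' e r = 0"
    have l: "\<bar>H e w\<bar> \<le> max L \<bar>m\<bar> * \<bar>w - 0\<bar>" for w using H_lip[of e w 0] by (simp add: H_def)
    have "\<phi> e 0 = 0"
      by (rule solution_unique_backward[OF conjunct1[OF sol[OF e]] l, of r])
        (use r z \<open>\<phi>' e r = 0\<close> in auto)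
    then show False using sol[OF e] by simp
  qed
  obtain \<rho> where \<rho>: "continuous_on ({- c..B - c} \<times> {0..1}) (\<lambda>(e, r). \<rho> e r)"
    "\<And>e. e \<in> {- c..B - c} \<Longrightarrow> phase_angle (\<phi> e) (\<phi>' e) (\<rho> e)"
    using phase_angle_family[OF \<phi> _ nz] sol by blast
  show ?thesis
  proof (rule that[OF \<phi> \<rho>(1)])
    fix e assume e: "e \<in> {- c..B - c}"
    note S = axial_solutionD[OF conjunct1[OF sol[OF e]]]
    show "axial_solution N f (\<lambda>r. c + e * \<phi> e r) (\<lambda>r. e * \<phi>' e r)"
      unfolding axial_solution_def
    proof (intro conjI ballI)
      show "((\<lambda>r. c + e * \<phi> e r) has_real_derivative e * \<phi>' e r) (at r within {0..1})" if "r \<in> {0..1}" for r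
        using DERIV_add[OF DERIV_const DERIV_cmult[OF S(1)[OF that]]] by simp
      show "continuous_on {0..1} (\<lambda>r. e * \<phi>' e r)" by (intro continuous_intros S)
      show "((\<lambda>r. e * \<phi>' e r) has_real_derivative
          - (f (c + e * \<phi> e r) + real N * (1 - r) * (e * \<phi>' e r)) / (r * (2 - r))) (at r within {0..1})"
        if "r \<in> {0<..1}" for r
        by (rule DERIV_cong[OF DERIV_cmult[OF S(4)[OF that]]]) (simp add: H_f[symmetric] algebra_simps)
    qed
    show "\<phi> e 0 = 1" using sol[OF e] by simp
    show "phase_angle (\<phi> e) (\<phi>' e) (\<rho> e)" by (rule \<rho>(2)[OF e])
    show "(\<phi> e has_real_derivative \<phi>' e r) (at r within {0..1})" if "r \<in> {0..1}" for r
      by (rule S(1)[OF that])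
  next
    have "0 \<in> {- c..B - c}" using c by simp
    moreover have "H 0 = (\<lambda>w. m * w)" by (simp add: H_def G(3) fun_eq_iff)
    ultimately show "axial_solution N (\<lambda>w. m * w) (\<phi> 0) (\<phi>' 0)" using sol by fastforce
  qed
qed

lemma phase_angle_zero:
  assumes ang: "phase_angle y y' \<rho>" and pos: "\<And>r. r \<in> {0<..1} \<Longrightarrow> y r > 0" and "y' 1 = 0"
  shows "\<rho> 1 = 0"
proof -
  have cont: "continuous_on {0..1} \<rho>" "\<rho> 0 = 0" using ang by (auto simp: phase_angle_def)
  have nz: "cos (\<rho> r) \<noteq> 0" if r: "r \<in> {0..1}" for r
  proof (cases "r = 0")
    case False
    obtain R where "R > 0" "y r = R * cos (\<rho> r)" using phase_angleE[OF ang r] by blast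
    then show ?thesis using pos[of r] r False by auto
  qed (simp add: cont)
  have lt: "\<bar>\<rho> 1\<bar> < pi / 2"
  proof (rule ccontr)
    assume "\<not> \<bar>\<rho> 1\<bar> < pi / 2"
    then have "\<rho> 1 \<ge> pi / 2 \<or> \<rho> 1 \<le> - (pi / 2)" by linarith
    then obtain r where "r \<in> {0..1}" "\<rho> r = pi / 2 \<or> \<rho> r = - (pi / 2)"
      using IVT'[of \<rho> 0 "pi / 2" 1] IVT2'[of \<rho> 1 "- (pi / 2)" 0] cont by force
    moreover from this have "cos (\<rho> r) = 0" by (elim conjE disjE) (simp_all only: cos_minus cos_pi_half)
    ultimately show False using nz[of r] by blast
  qed
  obtain R where "R > 0" "- Q 1 * y' 1 = R * sin (\<rho> 1)" by (rule phase_angleE[OF ang, of 1]) auto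
  then have "sin (\<rho> 1) = 0" using \<open>y' 1 = 0\<close> by simp
  moreover have "- pi < \<rho> 1" "\<rho> 1 < pi" using lt pi_gt_zero by (auto simp: abs_less_iff)
  ultimately show ?thesis by (simp add: sin_eq_0_pi)
qed

end

context shooting begin

text \<open>
  Solutions are labelled by \<open>e\<close>, their starting value being \<open>c + e\<close>; \<open>En e 1\<close> and \<open>\<rho> e 1\<close> are energy
  and angle on the equator.  For \<open>e = - c\<close> the solution is identically 0, with zero energy and angle.  For \<open>e = 0\<close> the energy
  is minimal and the angle exceeds \<open>j * pi / 2\<close>.  At the first positive \<open>e = z\<close> of zero energy on the equator
  the angle is still below \<open>pi\<close>: at angle \<open>pi\<close> the solution would be at rest below \<open>c\<close> with nonnegative
  energy, hence nonpositive, contrary to \<open>rest_point\<close>.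
  
  If \<open>j\<close> is even, some \<open>e\<close> between \<open>- c\<close> and \<open>0\<close> has angle \<open>j * pi / 2\<close>, that is, horizontal slope on the
  equator, and the solution matches itself.  If \<open>j\<close> is odd, one looks for \<open>a\<close> in \<open>{- c..0}\<close> and \<open>b\<close> in
  \<open>{0..z}\<close> with equal energies and angles adding up to \<open>j * pi\<close>.  Since \<open>a\<close> is negative and \<open>b\<close> positive, the two
  points on the equator then lie on rays that are mirror images in the horizontal axis, and \<open>energy_ray\<close> makes the points
  mirror images as well.
\<close>

theorem matched_branches:
  assumes m: "nu N j < m" and j: "j \<ge> 1"
  obtains a b \<phi>a \<phi>a' \<phi>b \<phi>b' \<rho>a \<rho>b where
    "branch a \<phi>a \<phi>a' \<rho>a" "branch b \<phi>b \<phi>b' \<rho>b" "\<rho>a 1 + \<rho>b 1 = real j * pi"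
    "a * \<phi>a 1 = b * \<phi>b 1" "a * \<phi>a' 1 = - (b * \<phi>b' 1)"
proof -
  obtain \<phi> \<phi>' \<rho> where c\<phi>: "continuous_on ({- c..B - c} \<times> {0..1}) (\<lambda>(e, r). \<phi> e r)"
    and c\<phi>': "continuous_on ({- c..B - c} \<times> {0..1}) (\<lambda>(e, r). \<phi>' e r)"
    and c\<rho>: "continuous_on ({- c..B - c} \<times> {0..1}) (\<lambda>(e, r). \<rho> e r)"
    and sol: "\<And>e. e \<in> {- c..B - c} \<Longrightarrow> axial_solution N f (\<lambda>r. c + e * \<phi> e r) (\<lambda>r. e * \<phi>' e r)"
    and init: "\<And>e. e \<in> {- c..B - c} \<Longrightarrow> \<phi> e 0 = 1"
    and ang: "\<And>e. e \<in> {- c..B - c} \<Longrightarrow> phase_angle (\<phi> e) (\<phi>' e) (\<rho> e)"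
    and der: "\<And>e r. e \<in> {- c..B - c} \<Longrightarrow> r \<in> {0..1} \<Longrightarrow> (\<phi> e has_real_derivative \<phi>' e r) (at r within {0..1})"
    and lin: "axial_solution N (\<lambda>w. m * w) (\<phi> 0) (\<phi>' 0)"
    using shooting_curve by blast
  define En where "En = (\<lambda>e. energy F (\<lambda>r. c + e * \<phi> e r) (\<lambda>r. e * \<phi>' e r))"
  have at1: "continuous_on {- c..B - c} (\<lambda>e. g e 1)"
    if "continuous_on ({- c..B - c} \<times> {0..1}) (\<lambda>(e, r). g e r)" for g :: "real \<Rightarrow> real \<Rightarrow> real"
    using continuous_on_compose2[OF that, of "{- c..B - c}" "\<lambda>e. (e, 1)"] by (force intro!: continuous_intros)
  have cE: "continuous_on {- c..B - c} (\<lambda>e. En e 1)"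
    unfolding En_def energy_def
    by (intro continuous_intros at1[OF c\<phi>] at1[OF c\<phi>'] continuous_on_compose2[OF F_cont]) auto
  have c\<rho>1: "continuous_on {- c..B - c} (\<lambda>e. \<rho> e 1)" by (rule at1[OF c\<rho>])
  have E_mono: "En e s \<le> En e r" if "e \<in> {- c..B - c}" "0 \<le> r" "r \<le> s" "s \<le> 1" for e r s
    unfolding En_def by (rule energy_antimono[OF N sol[OF that(1)] F that(2-4)])
  have E_0: "En e 0 = F (c + e)" if "e \<in> {- c..B - c}" for e
    by (simp add: En_def energy_def init[OF that])
  have E_ge: "F (c + e * \<phi> e r) \<le> En e r" if "r \<in> {0..1}" for e r
    using that by (simp add: En_def energy_def)
  have E_zero: "En 0 1 = F c" by (simp add: En_def energy_def)
  have E_gt: "F c < En e 1" if e: "e \<in> {- c..B - c}" "e \<noteq> 0" for e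
  proof (rule ccontr)
    assume "\<not> F c < En e 1"
    then have le: "(e * \<phi>' e 1)\<^sup>2 / 2 + F (c + e * \<phi> e 1) \<le> F c" by (simp add: En_def energy_def)
    have eq: "c + e * \<phi> e 1 = c"
    proof (rule ccontr)
      assume "c + e * \<phi> e 1 \<noteq> c"
      from F_min[OF this] le show False using zero_le_power2[of "e * \<phi>' e 1"] by linarith
    qed
    have "e * \<phi>' e 1 = 0" using le unfolding eq by simp
    moreover have "f (c + e * \<phi> e 1) = 0" by (simp only: eq f_c)
    ultimately have "c + e * \<phi> e 0 = c + e * \<phi> e 1"
      by (intro rest_point[OF sol[OF e(1)], of 1]) simp_all
    then show False using init[OF e(1)] \<open>c + e * \<phi> e 1 = c\<close> e(2) by simp
  qed
  have E_neg: "En e r < 0" if e: "e \<in> {- c<..0}" and r: "r \<in> {0..1}" for e r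
  proof -
    have e': "e \<in> {- c..B - c}" using e c by auto
    have "En e r \<le> F (c + e)" using E_mono[OF e', of 0 r] E_0[OF e'] r by simp
    also have "\<dots> < 0" using e by (intro F_neg) auto
    finally show ?thesis .
  qed
  have south: "En (- c) 1 = 0" "\<rho> (- c) 1 = 0"
  proof -
    have e': "- c \<in> {- c..B - c}" using c by auto
    have "f 0 = 0" by (rule f_nonpos) simp
    then have l: "\<bar>f w\<bar> \<le> L * \<bar>w - (c + - c * \<phi> (- c) 0)\<bar>" for w
      using lip_zero[of 0 w] init[OF e'] by simp
    have "1 \<le> N" using N by simp
    note u = solution_unique_forward[OF this sol[OF e'] l]
    have one: "\<phi> (- c) r = 1" "\<phi>' (- c) r = 0" if "r \<in> {0<..1}" for r
      using u[OF that] c init[OF e'] by auto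
    show "En (- c) 1 = 0" using one[of 1] by (simp add: En_def energy_def F_0)
    show "\<rho> (- c) 1 = 0" using one by (intro phase_angle_zero[OF ang[OF e']]) auto
  qed
  have "En (B - c) 1 \<ge> 0"
  proof (rule ccontr)
    assume "\<not> En (B - c) 1 \<ge> 0"
    then have neg: "energy F (\<lambda>r. c + (B - c) * \<phi> (B - c) r) (\<lambda>r. (B - c) * \<phi>' (B - c) r) 1 < 0"
      by (simp add: En_def)
    have e': "B - c \<in> {- c..B - c}" using c by auto
    have "\<exists>r\<in>{0..1}. c + (B - c) * \<phi> (B - c) r \<le> 0"
      by (rule hits[OF sol[OF e']]) (simp add: init[OF e'])
    moreover have "c + (B - c) * \<phi> (B - c) r > 0" if "r \<in> {0..1}" for r
      by (rule positive_of_negative_energy[OF sol[OF e'] _ neg that]) (use init[OF e'] c in simp)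
    ultimately show False by force
  qed
  moreover have "continuous_on {0..B - c} (\<lambda>e. - En e 1)"
    by (intro continuous_intros continuous_on_subset[OF cE]) (use c in auto)
  moreover have "F c < 0" using F_neg[of c] c by simp
  ultimately obtain z where z: "0 < z" "z \<le> B - c" "En z 1 = 0" "\<And>x. 0 \<le> x \<Longrightarrow> x < z \<Longrightarrow> En x 1 < 0"
    using first_point[of 0 "B - c" "\<lambda>e. - En e 1" 0] c E_zero by auto
  have z': "z \<in> {- c..B - c}" using z c by auto
  have \<rho>z: "\<rho> z 1 < pi"
  proof (rule ccontr)
    assume "\<not> \<rho> z 1 < pi"
    moreover have "continuous_on {0..1} (\<rho> z)" "\<rho> z 0 = 0" using ang[OF z'] by (auto simp: phase_angle_def)
    ultimately obtain r where r: "0 \<le> r" "r \<le> 1" "\<rho> z r = pi"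
      using IVT'[of "\<rho> z" 0 pi 1] by auto
    then have "r \<noteq> 0" using \<open>\<rho> z 0 = 0\<close> by auto
    then have r': "r \<in> {0<..1}" "r \<in> {0..1}" using r by auto
    obtain R where R: "R > 0" "\<phi> z r = R * cos (\<rho> z r)" "- Q r * \<phi>' z r = R * sin (\<rho> z r)"
      using phase_angleE[OF ang[OF z'] r'(2)] by blast
    have "Q r > 0" using Q_pos r' by auto
    then have d: "\<phi>' z r = 0" using R(3) r(3) by simp
    have "0 \<le> En z r" using E_mono[OF z', of r 1] r z(3) by simp
    then have "0 \<le> F (c + z * \<phi> z r)" by (simp add: En_def energy_def d)
    moreover have "c + z * \<phi> z r < c" using R r(3) z(1) by simp
    ultimately have le: "c + z * \<phi> z r \<le> 0" using F_neg[of "c + z * \<phi> z r"] by linarith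
    have "c + z * \<phi> z 0 = c + z * \<phi> z r"
      using rest_point[OF sol[OF z'], of r] r' d f_nonpos[OF le] by simp
    then show False using le init[OF z'] z(1) c by simp
  qed
  have zero: "0 \<in> {- c..B - c}" using c by auto
  have \<rho>0: "real j * (pi / 2) < \<rho> 0 1" by (rule linear_rotation[OF N lin ang[OF zero] m])
  have br: "branch e (\<phi> e) (\<phi>' e) (\<rho> e)" if e: "- c < e" "e < z" "e \<noteq> 0" for e
  proof -
    have e': "e \<in> {- c..B - c}" using e z by auto
    have Ee: "En e 1 < 0"
      using z(4)[of e] E_neg[of e 1] e by (cases "e \<ge> 0") auto
    have "0 < c + e * \<phi> e r \<and> c + e * \<phi> e r \<le> B" if r: "r \<in> {0..1}" for r
    proof
      show "0 < c + e * \<phi> e r"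
        by (rule positive_of_negative_energy[OF sol[OF e'] _ _ r])
          (use init[OF e'] e Ee in \<open>auto simp: En_def\<close>)
      have "F (c + e * \<phi> e r) \<le> F (c + e)"
        using E_ge[OF r, of e] E_mono[OF e', of 0 r] E_0[OF e'] r by simp
      also have "\<dots> \<le> F (c + z)"
      proof (cases "e \<ge> 0")
        case True
        then show ?thesis using F_inc[of "c + e" "c + z"] e by simp
      next
        case False
        then have "F (c + e) < 0" using F_neg[of "c + e"] e by simp
        also have "0 \<le> F (c + z)" using E_mono[OF z', of 0 1] E_0[OF z'] z(3) by simp
        finally show ?thesis by simp
      qed
      finally have "c + e * \<phi> e r \<le> c + z"
        using F_inc[of "c + z" "c + e * \<phi> e r"] z(1) by (auto simp: not_less[symmetric])
      then show "c + e * \<phi> e r \<le> B" using z by simp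
    qed
    then show ?thesis unfolding branch_def using sol[OF e'] ang[OF e'] der[OF e'] e by simp
  qed
  show ?thesis
  proof (cases "even j")
    case True
    have "continuous_on {- c..0} (\<lambda>e. \<rho> e 1)" by (rule continuous_on_subset[OF c\<rho>1]) (use c in auto)
    then obtain a where a: "- c \<le> a" "a \<le> 0" "\<rho> a 1 = real j * (pi / 2)"
      using IVT'[of "\<lambda>e. \<rho> e 1" "- c" "real j * (pi / 2)" 0] c south(2) \<rho>0 by auto
    have "real j * (pi / 2) > 0" using j by simp
    then have "a \<noteq> - c" "a \<noteq> 0" using a south \<rho>0 by auto
    then have a': "- c < a" "a < z" "a \<noteq> 0" "a \<in> {- c..B - c}" using a z c by auto
    obtain i where i: "j = 2 * i" using True by (elim evenE)
    obtain R where "R > 0" "- Q 1 * \<phi>' a 1 = R * sin (\<rho> a 1)"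
      by (rule phase_angleE[OF ang[OF a'(4)], of 1]) auto
    moreover have "sin (\<rho> a 1) = 0" unfolding a(3) i by (simp add: mult.commute)
    ultimately have "\<phi>' a 1 = 0" by (simp add: Q_def)
    then show ?thesis
      by (intro that[OF br[OF a'(1-3)] br[OF a'(1-3)]]) (use a(3) in auto)
  next
    case False
    \<comment> \<open>The angle excess \<open>h1\<close> is positive at the corner \<open>(0, 0)\<close> and negative at the corner \<open>(- c, z)\<close>.
      Away from these corners the energy difference \<open>h2\<close> is negative on the sides \<open>a = 0\<close> and \<open>b = z\<close> and
      positive on the other two.  So the field \<open>(h2 - h1, h2 + h1)\<close> never points outwards and has to
      vanish somewhere.\<close>
    define h1 where "h1 = (\<lambda>p. \<rho> (fst p) 1 + \<rho> (snd p) 1 - real j * pi)"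
    define h2 where "h2 = (\<lambda>p. En (fst p) 1 - En (snd p) 1)"
    let ?R = "{- c..0} \<times> {0..z}"
    have sub: "{- c..0} \<subseteq> {- c..B - c}" "{0..z} \<subseteq> {- c..B - c}" using z c by auto
    have lift: "continuous_on ?R (\<lambda>p. g (fst p))" "continuous_on ?R (\<lambda>p. g (snd p))"
      if "continuous_on {- c..B - c} g" for g :: "real \<Rightarrow> real"
      by (rule continuous_on_compose2[OF that]; use sub in \<open>auto intro!: continuous_intros\<close>)+
    have ch: "continuous_on ?R h1" "continuous_on ?R h2"
      unfolding h1_def h2_def by (intro continuous_intros lift c\<rho>1 cE lift(1)[OF c\<rho>1] lift(2)[OF c\<rho>1] lift(1)[OF cE] lift(2)[OF cE])+
    have cV: "continuous_on ?R (\<lambda>p. h2 p - h1 p)" "continuous_on ?R (\<lambda>p. h2 p + h1 p)"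
      by (intro continuous_intros ch)+
    have les: "- c \<le> 0" "0 \<le> z" using c z by auto
    obtain a b where ab: "a \<in> {- c..0}" "b \<in> {0..z}"
      and V1: "h2 (a, b) - h1 (a, b) = 0 \<or> a = 0 \<and> h2 (a, b) - h1 (a, b) \<ge> 0 \<or> a = - c \<and> h2 (a, b) - h1 (a, b) \<le> 0"
      and V2: "h2 (a, b) + h1 (a, b) = 0 \<or> b = z \<and> h2 (a, b) + h1 (a, b) \<ge> 0 \<or> b = 0 \<and> h2 (a, b) + h1 (a, b) \<le> 0"
      using rectangle_variational_inequality[OF cV les] by blast
    have ab': "a \<in> {- c..B - c}" "b \<in> {- c..B - c}" using ab z c by auto
    have Ea0: "a = 0 \<Longrightarrow> En a 1 = F c" and Ea: "a \<noteq> 0 \<Longrightarrow> F c < En a 1"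
      and Eac: "a = - c \<Longrightarrow> En a 1 = 0" and Eac': "a \<noteq> - c \<Longrightarrow> En a 1 < 0"
      using E_zero E_gt[OF ab'(1)] south(1) E_neg[of a 1] ab by auto
    have Eb0: "b = 0 \<Longrightarrow> En b 1 = F c" and Eb: "b \<noteq> 0 \<Longrightarrow> F c < En b 1"
      and Ebz: "b = z \<Longrightarrow> En b 1 = 0" and Ebz': "b \<noteq> z \<Longrightarrow> En b 1 < 0"
      using E_zero E_gt[OF ab'(2)] z ab by auto
    have jpi: "real j * pi \<ge> pi" using mult_right_mono[of 1 "real j" pi] j by simp
    have \<rho>a0: "a = 0 \<Longrightarrow> 2 * \<rho> a 1 > real j * pi" and \<rho>b0: "b = 0 \<Longrightarrow> 2 * \<rho> b 1 > real j * pi"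
      and \<rho>ac: "a = - c \<Longrightarrow> \<rho> a 1 = 0" and \<rho>bz: "b = z \<Longrightarrow> \<rho> b 1 < pi"
      using \<rho>0 south(2) \<rho>z by auto
    define X where "X = h1 (a, b)"
    define Y where "Y = h2 (a, b)"
    have XY: "X = \<rho> a 1 + \<rho> b 1 - real j * pi" "Y = En a 1 - En b 1"
      by (simp_all add: X_def Y_def h1_def h2_def)
    note V = V1[folded X_def Y_def] V2[folded X_def Y_def]
    have az: "a \<noteq> 0"
    proof
      assume a0: "a = 0"
      have a: "a \<noteq> - c" using a0 c by simp
      show False
      proof (cases "b = 0")
        case True
        have "Y = 0" "X > 0" using Ea0[OF a0] Eb0[OF True] \<rho>a0[OF a0] \<rho>b0[OF True] unfolding XY by linarith+
        then show False using V(1) a by auto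
      next
        case False
        have "Y < 0" using Ea0[OF a0] Eb[OF False] unfolding XY by linarith
        then show False using V a False by auto
      qed
    qed
    have bz0: "b \<noteq> 0"
    proof
      assume b0: "b = 0"
      have "b \<noteq> z" using b0 z by simp
      moreover have "Y > 0" using Eb0[OF b0] Ea[OF az] unfolding XY by linarith
      ultimately show False using V az by auto
    qed
    have ac: "a \<noteq> - c"
    proof
      assume a: "a = - c"
      show False
      proof (cases "b = z")
        case True
        have "Y = 0" "X < 0" using Eac[OF a] Ebz[OF True] \<rho>ac[OF a] \<rho>bz[OF True] jpi unfolding XY by linarith+
        then show False using V bz0 by auto
      next
        case False
        have "Y > 0" using Eac[OF a] Ebz'[OF False] unfolding XY by linarith
        then show False using V az bz0 False by auto
      qed
    qed
    have bz: "b \<noteq> z"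
    proof
      assume b: "b = z"
      have "Y < 0" using Eac'[OF ac] Ebz[OF b] unfolding XY by linarith
      then show False using V az ac bz0 by auto
    qed
    have XY0: "X = 0" "Y = 0" using V az ac bz0 bz by auto
    have sum: "\<rho> a 1 + \<rho> b 1 = real j * pi" and Eeq: "En a 1 = En b 1" using XY0 unfolding XY by auto
    have bra: "branch a (\<phi> a) (\<phi>' a) (\<rho> a)" and brb: "branch b (\<phi> b) (\<phi>' b) (\<rho> b)"
      using ab az ac bz0 bz z c by (auto intro!: br)
    have signs: "a < 0" "b > 0" using ab az bz0 by auto
    obtain Ra where Ra: "Ra > 0" "\<phi> a 1 = Ra * cos (\<rho> a 1)" "- Q 1 * \<phi>' a 1 = Ra * sin (\<rho> a 1)"
      by (rule phase_angleE[OF ang[OF ab'(1)], of 1]) auto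
    obtain Rb where Rb: "Rb > 0" "\<phi> b 1 = Rb * cos (\<rho> b 1)" "- Q 1 * \<phi>' b 1 = Rb * sin (\<rho> b 1)"
      by (rule phase_angleE[OF ang[OF ab'(2)], of 1]) auto
    have \<rho>b: "\<rho> b 1 = real j * pi - \<rho> a 1" using sum by simp
    have cosb: "cos (\<rho> b 1) = - cos (\<rho> a 1)" and sinb: "sin (\<rho> b 1) = sin (\<rho> a 1)"
      unfolding \<rho>b cos_diff sin_diff using False by simp_all
    define k where "k = b * Rb / (- a * Ra)"
    have k: "k > 0" unfolding k_def using signs Ra(1) Rb(1) by (intro divide_pos_pos mult_pos_pos) auto
    define d where "d = a * \<phi> a 1"
    define p where "p = a * \<phi>' a 1"
    have kd: "b * \<phi> b 1 = k * d" and kp: "b * \<phi>' b 1 = - (k * p)"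
    proof -
      have bR: "b * Rb = k * (- a * Ra)" using signs Ra(1) by (simp add: k_def)
      have \<phi>': "\<phi>' a 1 = - (Ra * sin (\<rho> a 1))" "\<phi>' b 1 = - (Rb * sin (\<rho> b 1))"
        using Ra(3) Rb(3) by (simp_all add: Q_def)
      have "b * \<phi> b 1 = (b * Rb) * - cos (\<rho> a 1)" unfolding Rb(2) cosb by simp
      also have "\<dots> = k * d" unfolding bR d_def Ra(2) by simp
      finally show "b * \<phi> b 1 = k * d" .
      have "b * \<phi>' b 1 = (b * Rb) * - sin (\<rho> a 1)" unfolding \<phi>' sinb by simp
      also have "\<dots> = - (k * p)" unfolding bR p_def \<phi>' by simp
      finally show "b * \<phi>' b 1 = - (k * p)" .
    qed
    have En_eq: "p\<^sup>2 / 2 + F (c + d) = (k * p)\<^sup>2 / 2 + F (c + k * d)"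
      using Eeq by (simp add: En_def energy_def kd kp flip: d_def p_def)
    have pos: "0 \<le> c + d" "0 \<le> c + k * d"
      using bra brb unfolding branch_def kd[symmetric] by (auto simp: d_def intro: less_imp_le)
    have nz: "d \<noteq> 0 \<or> p \<noteq> 0"
    proof -
      have "cos (\<rho> a 1) \<noteq> 0 \<or> sin (\<rho> a 1) \<noteq> 0" using sin_zero_norm_cos_one[of "\<rho> a 1"] by auto
      then show ?thesis using Ra signs by (auto simp: d_def p_def Q_def)
    qed
    \<comment> \<open>For \<open>k \<noteq> 1\<close> one of the two points would lie strictly further out on its ray than the mirror image of the other.\<close>
    have "k = 1"
    proof (rule linorder_cases[of k 1])
      assume "k > 1"
      from energy_ray[OF this pos nz] En_eq show ?thesis by simp
    next
      assume k1: "k < 1"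
      have "1 / k > 1" using k k1 by simp
      moreover have "0 \<le> c + 1 / k * (k * d)" using pos k by simp
      moreover have "k * d \<noteq> 0 \<or> k * p \<noteq> 0" using nz k by auto
      ultimately have "(k * p)\<^sup>2 / 2 + F (c + k * d) < (1 / k * (k * p))\<^sup>2 / 2 + F (c + 1 / k * (k * d))"
        using pos(2) by (intro energy_ray)
      then show ?thesis using En_eq k by simp
    qed
    then show ?thesis
      by (intro that[OF bra brb sum]) (use kd kp in \<open>auto simp: d_def p_def\<close>)
  qed
qed

end

section \<open>The truncated nonlinearity\<close>

text \<open>
  The nonlinearity is frozen outside \<open>{0..B}\<close> to make it globally Lipschitz; the solutions used in the end take their
  values in this interval.
\<close>

locale nonlinearity =
  fixes p lam B c :: real
  assumes p: "1 < p" and lam: "0 < lam" and c_def: "c = lam powr (1 / (p - 1))" and cB: "c < B"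
begin

definition g :: "real \<Rightarrow> real" where "g w = w powr p - lam * w"

definition clip :: "real \<Rightarrow> real" where "clip w = max 0 (min w B)"

lemma c_pos: "c > 0" using lam by (simp add: c_def)

lemma B_pos: "B > 0" using c_pos cB by simp

lemma c_powr: "c powr (p - 1) = lam"
  using p lam by (simp add: c_def powr_powr)

lemma g_factor: "w \<ge> 0 \<Longrightarrow> g w = w * (w powr (p - 1) - lam)"
  using powr_mult_base[of w "p - 1"] by (cases "w = 0") (simp_all add: g_def algebra_simps)

lemma g_c: "g c = 0" using g_factor[of c] c_pos c_powr by simp

lemma g_neg: "0 < w \<Longrightarrow> w < c \<Longrightarrow> g w < 0"
  using powr_less_mono2[of "p - 1" w c] p by (simp add: g_factor c_powr mult_pos_neg)

lemma g_pos: "c < w \<Longrightarrow> g w > 0"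
  using powr_less_mono2[of "p - 1" c w] p c_pos by (simp add: g_factor c_powr)

lemma g_deriv: "w > 0 \<Longrightarrow> (g has_real_derivative p * w powr (p - 1) - lam) (at w)"
  unfolding g_def by (auto intro!: derivative_eq_intros simp: powr_diff)

lemma g'_deriv: "w > 0 \<Longrightarrow> ((\<lambda>w. p * w powr (p - 1) - lam) has_real_derivative p * ((p - 1) * w powr (p - 2))) (at w)"
  using DERIV_diff[OF DERIV_cmult[OF DERIV_fun_powr[OF DERIV_ident, of w "p - 1"]] DERIV_const, of p lam]
  by simp

lemma g_cont: "continuous_on {0..} g"
  unfolding g_def using p by (intro continuous_intros continuous_on_powr') auto

text \<open>
  Adding \<open>\<plusminus> g\<close> to the linear function of slope \<open>p * B powr (p - 1) + lam\<close> gives nondecreasing functions.  Only the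
  derivative in the interior is used, since \<open>w powr p\<close> is not covered by the power rule at 0.
\<close>

lemma g_lipschitz:
  assumes "0 \<le> u" "u \<le> v" "v \<le> B"
  shows "\<bar>g u - g v\<bar> \<le> (p * B powr (p - 1) + lam) * (v - u)"
proof -
  let ?L = "p * B powr (p - 1) + lam"
  have bound: "\<bar>p * x powr (p - 1) - lam\<bar> \<le> ?L" if "u < x" "x < v" for x
  proof -
    have "x powr (p - 1) \<le> B powr (p - 1)" using that assms p by (intro powr_mono2) auto
    then have "p * x powr (p - 1) \<le> p * B powr (p - 1)" using p by simp
    moreover have "0 \<le> p * x powr (p - 1)" using p by simp
    ultimately show ?thesis using lam by linarith
  qed
  have cont: "continuous_on {u..v} g" by (rule continuous_on_subset[OF g_cont]) (use assms in auto)
  have "?L * u - g u \<le> ?L * v - g v"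
  proof (rule DERIV_nonneg_imp_increasing_open[where f = "\<lambda>x. ?L * x - g x", OF assms(2)])
    fix x assume x: "u < x" "x < v"
    then have "((\<lambda>x. ?L * x - g x) has_real_derivative ?L - (p * x powr (p - 1) - lam)) (at x)"
      using assms by (intro DERIV_diff g_deriv DERIV_cmult_Id) auto
    then show "\<exists>d. ((\<lambda>x. ?L * x - g x) has_real_derivative d) (at x) \<and> 0 \<le> d"
      using bound[OF x] by (intro exI conjI) auto
  qed (intro continuous_intros cont)
  moreover have "?L * u + g u \<le> ?L * v + g v"
  proof (rule DERIV_nonneg_imp_increasing_open[where f = "\<lambda>x. ?L * x + g x", OF assms(2)])
    fix x assume x: "u < x" "x < v"
    then have "((\<lambda>x. ?L * x + g x) has_real_derivative ?L + (p * x powr (p - 1) - lam)) (at x)"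
      using assms by (intro DERIV_add g_deriv DERIV_cmult_Id) auto
    then show "\<exists>d. ((\<lambda>x. ?L * x + g x) has_real_derivative d) (at x) \<and> 0 \<le> d"
      using bound[OF x] by (intro exI conjI) auto
  qed (intro continuous_intros cont)
  ultimately show ?thesis by (simp add: abs_le_iff right_diff_distrib)
qed

definition f :: "real \<Rightarrow> real" where "f w = g (clip w)"

lemma clip_range: "0 \<le> clip w" "clip w \<le> B" using B_pos by (auto simp: clip_def)

lemma f_lipschitz: "\<bar>f w - f w'\<bar> \<le> (p * B powr (p - 1) + lam) * \<bar>w - w'\<bar>"
proof -
  let ?L = "p * B powr (p - 1) + lam"
  have L: "?L \<ge> 0" using p lam by simp
  have *: "\<bar>f w - f w'\<bar> \<le> ?L * \<bar>w - w'\<bar>" if "w \<le> w'" for w w'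
  proof -
    have "clip w \<le> clip w'" "clip w' - clip w \<le> \<bar>w - w'\<bar>" using that by (auto simp: clip_def)
    then have "\<bar>f w - f w'\<bar> \<le> ?L * (clip w' - clip w)"
      unfolding f_def by (intro g_lipschitz clip_range)
    also have "\<dots> \<le> ?L * \<bar>w - w'\<bar>" using L \<open>clip w' - clip w \<le> _\<close> by (intro mult_left_mono)
    finally show ?thesis .
  qed
  show ?thesis using *[of w w'] *[of w' w] by (cases "w \<le> w'") (auto simp: abs_minus_commute)
qed

lemma f_eq_g: "0 \<le> w \<Longrightarrow> w \<le> B \<Longrightarrow> f w = g w"
  by (simp add: f_def clip_def)

lemma f_ge_B: "B \<le> w \<Longrightarrow> f w = g B"
  using B_pos by (simp add: f_def clip_def)

lemma f_nonpos: "w \<le> 0 \<Longrightarrow> f w = 0"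
  using B_pos by (simp add: f_def clip_def g_def)

lemma f_neg: "0 < w \<Longrightarrow> w < c \<Longrightarrow> f w < 0"
  using f_eq_g[of w] g_neg[of w] cB by simp

lemma f_pos: "c < w \<Longrightarrow> f w > 0"
  using f_eq_g[of w] f_ge_B[of w] g_pos[of w] g_pos[of B] cB c_pos by (cases "w \<le> B") auto

lemma f_c: "f c = 0"
  using f_eq_g[of c] g_c cB c_pos by simp

lemma f_ge: "- (lam * c) \<le> f w"
proof (cases "0 < w \<and> w < c")
  case True
  then have "lam * w \<le> lam * c" using lam by simp
  moreover have "0 \<le> w powr p" by simp
  moreover have "f w = w powr p - lam * w" using True cB f_eq_g[of w] by (simp add: g_def)
  ultimately show ?thesis by linarith
next
  case False
  have "0 \<le> lam * c" using lam c_pos by simp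
  moreover have "0 \<le> f w" using False f_nonpos[of w] f_pos[of w] f_c by (cases "w = c") auto
  ultimately show ?thesis by linarith
qed

lemma f_deriv_c: "(f has_real_derivative (p - 1) * lam) (at c)"
proof -
  have "(g has_real_derivative (p - 1) * lam) (at c)"
    using g_deriv[OF c_pos] by (simp add: c_powr algebra_simps)
  moreover have "eventually (\<lambda>w. g w = f w) (nhds c)"
    by (rule eventually_nhds_in_open[of "{0<..<B}" c, THEN eventually_mono])
      (use c_pos cB in \<open>auto simp: f_eq_g\<close>)
  ultimately show ?thesis using DERIV_cong_ev[of c c g f] by auto
qed

lemma f_antiderivative: obtains F where "\<And>w. (F has_real_derivative f w) (at w)" "F 0 = 0"
proof -
  have "continuous_on UNIV f"
  proof -
    have "continuous_on UNIV clip" unfolding clip_def by (intro continuous_intros)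
    then show ?thesis unfolding f_def
      by (rule continuous_on_compose2[OF g_cont]) (use clip_range in auto)
  qed
  then have "\<exists>F. \<forall>x::real. - \<infinity> < ereal x \<longrightarrow> ereal x < \<infinity> \<longrightarrow> (F has_vector_derivative f x) (at x)"
    by (intro einterval_antiderivative) (auto simp: continuous_on_eq_continuous_at)
  then obtain F where F: "\<And>w. (F has_real_derivative f w) (at w)"
    by (auto simp: has_real_derivative_iff_has_vector_derivative)
  have "((\<lambda>w. F w - F 0) has_real_derivative f w) (at w)" for w
    using DERIV_diff[OF F[of w] DERIV_const[of "F 0"]] by simp
  then show ?thesis by (rule that) simp
qed

end

section \<open>Gluing the two hemispheres\<close>

lemma glue_has_derivative:
  fixes u v :: "real \<Rightarrow> real"
  assumes u: "\<And>t. t \<in> {0..1} \<Longrightarrow> (u has_real_derivative u' t) (at t within {0..1})"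
    and v: "\<And>t. t \<in> {-1..0} \<Longrightarrow> (v has_real_derivative v' t) (at t within {-1..0})"
    and eq: "u 0 = v 0" "u' 0 = v' 0" and t: "t \<in> {-1..1}"
  shows "((\<lambda>t. if 0 \<le> t then u t else v t) has_real_derivative (if 0 \<le> t then u' t else v' t))
    (at t within {-1..1})"
proof -
  let ?S = "{0..1::real}" and ?T = "{-1..<0::real}"
  have cl: "closure ?S = {0..1}" "closure ?T = {-1..0}" by auto
  have un: "?S \<union> (closure ?S \<inter> closure ?T) = {0..1}" "?T \<union> (closure ?S \<inter> closure ?T) = {-1..0}" "?S \<union> ?T = {-1..1}"
    unfolding cl by auto
  have "((\<lambda>x. if x \<in> ?S then u x else v x) has_vector_derivative (if t \<in> ?S then u' t else v' t)) (at t within ?S \<union> ?T)"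
  proof (rule has_vector_derivative_If_within_closures)
    show "t \<in> ?S \<union> (closure ?S \<inter> closure ?T) \<Longrightarrow> (u has_vector_derivative u' t) (at t within ?S \<union> (closure ?S \<inter> closure ?T))"
      unfolding un using u by (simp add: has_real_derivative_iff_has_vector_derivative)
    show "t \<in> ?T \<union> (closure ?S \<inter> closure ?T) \<Longrightarrow> (v has_vector_derivative v' t) (at t within ?T \<union> (closure ?S \<inter> closure ?T))"
      unfolding un using v by (simp add: has_real_derivative_iff_has_vector_derivative)
  qed (use eq t in \<open>auto simp: cl\<close>)
  then have "((\<lambda>x. if x \<in> ?S then u x else v x) has_real_derivative (if t \<in> ?S then u' t else v' t)) (at t within {-1..1})"
    unfolding un by (simp add: has_real_derivative_iff_has_vector_derivative)
  then have "((\<lambda>x. if x \<in> ?S then u x else v x) has_real_derivative (if 0 \<le> t then u' t else v' t)) (at t within {-1..1})"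
    using t by auto
  then show ?thesis
    by (rule has_field_derivative_transform_within[OF _ zero_less_one t]) auto
qed

lemma deriv_north:
  assumes "\<And>r. r \<in> {0..1} \<Longrightarrow> (y has_real_derivative y' r) (at r within {0..1})" "t \<in> {0..1}"
  shows "((\<lambda>t. y (1 - t)) has_real_derivative - y' (1 - t)) (at t within {0..1::real})"
proof -
  have "(\<lambda>t. 1 - t) ` {0..1::real} \<subseteq> {0..1}" by auto
  then have "(y has_real_derivative y' (1 - t)) (at (1 - t) within (\<lambda>t. 1 - t) ` {0..1})"
    by (rule has_field_derivative_subset[OF assms(1), rotated]) (use assms(2) in auto)
  moreover have "((\<lambda>t::real. 1 - t) has_real_derivative - 1) (at t within {0..1})"
    by (auto intro!: derivative_eq_intros)
  ultimately show ?thesis using DERIV_image_chain[of y "y' (1 - t)" "\<lambda>t. 1 - t" t "{0..1}" "-1"] by (simp add: o_def)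
qed

lemma deriv_south:
  assumes "\<And>r. r \<in> {0..1} \<Longrightarrow> (y has_real_derivative y' r) (at r within {0..1})" "t \<in> {-1..0}"
  shows "((\<lambda>t. y (1 + t)) has_real_derivative y' (1 + t)) (at t within {-1..0::real})"
proof -
  have "(\<lambda>t. 1 + t) ` {-1..0::real} \<subseteq> {0..1}" by auto
  then have "(y has_real_derivative y' (1 + t)) (at (1 + t) within (\<lambda>t. 1 + t) ` {-1..0})"
    by (rule has_field_derivative_subset[OF assms(1), rotated]) (use assms(2) in auto)
  moreover have "((\<lambda>t::real. 1 + t) has_real_derivative 1) (at t within {-1..0})"
    by (auto intro!: derivative_eq_intros)
  ultimately show ?thesis using DERIV_image_chain[of y "y' (1 + t)" "\<lambda>t. 1 + t" t "{-1..0}" 1] by (simp add: o_def)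
qed

lemma glue_lipschitz:
  fixes y z :: "real \<Rightarrow> real"
  assumes y: "\<And>r s. r \<in> {0..1} \<Longrightarrow> s \<in> {0..1} \<Longrightarrow> \<bar>y r - y s\<bar> \<le> L * \<bar>r - s\<bar>"
    and z: "\<And>r s. r \<in> {0..1} \<Longrightarrow> s \<in> {0..1} \<Longrightarrow> \<bar>z r - z s\<bar> \<le> M * \<bar>r - s\<bar>"
    and eq: "y 1 = z 1"
  defines "w \<equiv> \<lambda>t. if 0 \<le> t then y (1 - t) else z (1 + t)"
  shows "s \<in> {-1..1} \<Longrightarrow> t \<in> {-1..1} \<Longrightarrow> \<bar>w s - w t\<bar> \<le> (\<bar>L\<bar> + \<bar>M\<bar>) * \<bar>s - t\<bar>"
proof -
  have y': "\<bar>y r - y s\<bar> \<le> (\<bar>L\<bar> + \<bar>M\<bar>) * \<bar>r - s\<bar>" if "r \<in> {0..1}" "s \<in> {0..1}" for r s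
    by (rule order_trans[OF y[OF that]], rule mult_right_mono) auto
  have z': "\<bar>z r - z s\<bar> \<le> (\<bar>L\<bar> + \<bar>M\<bar>) * \<bar>r - s\<bar>" if "r \<in> {0..1}" "s \<in> {0..1}" for r s
    by (rule order_trans[OF z[OF that]], rule mult_right_mono) auto
  have *: "\<bar>w s - w t\<bar> \<le> (\<bar>L\<bar> + \<bar>M\<bar>) * \<bar>s - t\<bar>" if st: "s \<in> {-1..1}" "t \<in> {-1..1}" "s \<le> t" for s t
  proof -
    consider "0 \<le> s" | "t < 0" | "s < 0" "0 \<le> t" by linarith
    then show ?thesis
    proof cases
      case 1
      then show ?thesis using y'[of "1 - s" "1 - t"] st by (simp add: w_def abs_minus_commute)
    next
      case 2
      then show ?thesis using z'[of "1 + s" "1 + t"] st by (simp add: w_def)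
    next
      case 3
      have "\<bar>z (1 + s) - z 1\<bar> \<le> (\<bar>L\<bar> + \<bar>M\<bar>) * (- s)" using z'[of "1 + s" 1] 3 st by simp
      moreover have "\<bar>y 1 - y (1 - t)\<bar> \<le> (\<bar>L\<bar> + \<bar>M\<bar>) * t" using y'[of 1 "1 - t"] 3 st by simp
      ultimately have "\<bar>z (1 + s) - y (1 - t)\<bar> \<le> (\<bar>L\<bar> + \<bar>M\<bar>) * (- s) + (\<bar>L\<bar> + \<bar>M\<bar>) * t"
        unfolding eq by linarith
      also have "\<dots> = (\<bar>L\<bar> + \<bar>M\<bar>) * \<bar>s - t\<bar>" using 3 by (simp add: algebra_simps)
      finally show ?thesis using 3 by (simp add: w_def)
    qed
  qed
  show "s \<in> {-1..1} \<Longrightarrow> t \<in> {-1..1} \<Longrightarrow> ?thesis"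
    using *[of s t] *[of t s] by (cases "s \<le> t") (auto simp: abs_minus_commute)
qed

text \<open>
  The angle of the northern solution, continued beyond the equator by \<open>j * pi\<close> minus the angle of the
  southern one, is a continuous function on \<open>{0..2}\<close> that runs from \<open>0\<close> to \<open>j * pi\<close>.  Its cosine vanishes exactly at
  the zeros of the glued function, and every such point is an upward crossing because on the southern side both the
  angle and the direction are reversed.
\<close>

lemma glued_zero_count:
  assumes a1: "phase_angle y1 y1' \<rho>1" and a2: "phase_angle y2 y2' \<rho>2"
    and d1: "\<And>r. r \<in> {0..1} \<Longrightarrow> (y1 has_real_derivative y1' r) (at r within {0..1})"
    and d2: "\<And>r. r \<in> {0..1} \<Longrightarrow> (y2 has_real_derivative y2' r) (at r within {0..1})"
    and sum: "\<rho>1 1 + \<rho>2 1 = real j * pi"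
  defines "Z \<equiv> {t \<in> {-1..1}. (if 0 \<le> t then y1 (1 - t) else y2 (1 + t)) = 0}"
  shows "finite Z \<and> card Z = j"
proof -
  have c1: "continuous_on {0..1} \<rho>1" "\<rho>1 0 = 0" and c2: "continuous_on {0..1} \<rho>2" "\<rho>2 0 = 0"
    using a1 a2 by (auto simp: phase_angle_def)
  define \<Omega> where "\<Omega> = (\<lambda>x. if x \<le> 1 then \<rho>1 x else real j * pi - \<rho>2 (2 - x))"
  have \<Omega>2: "\<Omega> x = real j * pi - \<rho>2 (2 - x)" if "1 \<le> x" for x
    using sum that by (cases "x = 1") (auto simp: \<Omega>_def)
  have un: "{0..2} = {0..1} \<union> {1..2::real}" by auto
  have cont: "continuous_on {0..2} \<Omega>"
    unfolding un
  proof (rule continuous_on_closed_Un)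
    show "continuous_on {0..1} \<Omega>" by (rule continuous_on_eq[OF c1(1)]) (simp add: \<Omega>_def)
    have "continuous_on {1..2} (\<lambda>x. real j * pi - \<rho>2 (2 - x))"
      by (intro continuous_intros continuous_on_compose2[OF c2(1)]) auto
    then show "continuous_on {1..2} \<Omega>" by (rule continuous_on_eq) (simp add: \<Omega>2)
  qed auto
  have cosj: "cos (real j * pi - x) = 0 \<longleftrightarrow> cos x = 0" for x
    by (simp add: cos_diff)
  have up: "\<exists>d>0. (\<forall>y\<in>{0..2}. x - d < y \<and> y < x \<longrightarrow> \<Omega> y < \<Omega> x) \<and> (\<forall>y\<in>{0..2}. x < y \<and> y < x + d \<longrightarrow> \<Omega> x < \<Omega> y)"
    if x: "0 < x" "x < 2" and z: "cos (\<Omega> x) = 0" for x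
  proof -
    have L: "\<exists>d>0. \<forall>y\<in>{0..2}. x - d < y \<and> y < x \<longrightarrow> \<Omega> y < \<Omega> x"
    proof (cases "x \<le> 1")
      case True
      then have x1: "x \<in> {0<..1}" "x \<in> {0..1}" and e: "\<Omega> x = \<rho>1 x" using x by (auto simp: \<Omega>_def)
      have z1: "cos (\<rho>1 x) = 0" using z e by simp
      obtain d where d: "d > 0" "\<And>r. r \<in> {0..1} \<Longrightarrow> x - d < r \<Longrightarrow> r < x \<Longrightarrow> \<rho>1 r < \<rho>1 x"
        by (rule phase_angle_crossing[OF a1 x1(1) z1 d1[OF x1(2)]]) (rule that)
      have "\<Omega> y < \<Omega> x" if "y \<in> {0..2}" "x - d < y" "y < x" for y
        using d(2)[of y] that True e by (simp add: \<Omega>_def)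
      then show ?thesis using d(1) by blast
    next
      case False
      then have x1: "2 - x \<in> {0<..1}" "2 - x \<in> {0..1}" and e: "\<Omega> x = real j * pi - \<rho>2 (2 - x)" using x by (auto simp: \<Omega>_def)
      have z1: "cos (\<rho>2 (2 - x)) = 0" using z e cosj by simp
      obtain d where d: "d > 0" "\<And>r. r \<in> {0..1} \<Longrightarrow> 2 - x < r \<Longrightarrow> r < 2 - x + d \<Longrightarrow> \<rho>2 (2 - x) < \<rho>2 r"
        by (rule phase_angle_crossing[OF a2 x1(1) z1 d2[OF x1(2)]]) (rule that)
      have "\<Omega> y < \<Omega> x" if "y \<in> {0..2}" "x - min d (x - 1) < y" "y < x" for y
      proof -
        have "x - min d (x - 1) \<ge> 1" "x - min d (x - 1) \<ge> x - d" by auto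
        then have y: "1 \<le> y" "x - d < y" using that by linarith+
        have "\<rho>2 (2 - x) < \<rho>2 (2 - y)" by (rule d(2)) (use y that in auto)
        then show ?thesis using \<Omega>2[OF y(1)] e by simp
      qed
      then show ?thesis using d(1) False by (intro exI[of _ "min d (x - 1)"]) auto
    qed
    have R: "\<exists>d>0. \<forall>y\<in>{0..2}. x < y \<and> y < x + d \<longrightarrow> \<Omega> x < \<Omega> y"
    proof (cases "x < 1")
      case True
      then have x1: "x \<in> {0<..1}" "x \<in> {0..1}" and e: "\<Omega> x = \<rho>1 x" using x by (auto simp: \<Omega>_def)
      have z1: "cos (\<rho>1 x) = 0" using z e by simp
      obtain d where d: "d > 0" "\<And>r. r \<in> {0..1} \<Longrightarrow> x < r \<Longrightarrow> r < x + d \<Longrightarrow> \<rho>1 x < \<rho>1 r"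
        by (rule phase_angle_crossing[OF a1 x1(1) z1 d1[OF x1(2)]]) (rule that)
      have "\<Omega> x < \<Omega> y" if "y \<in> {0..2}" "x < y" "y < x + min d (1 - x)" for y
      proof -
        have "x + min d (1 - x) \<le> 1" "x + min d (1 - x) \<le> x + d" by auto
        then have "y \<le> 1" "y < x + d" using that by linarith+
        then show ?thesis using d(2)[of y] that e by (simp add: \<Omega>_def)
      qed
      then show ?thesis using d(1) True by (intro exI[of _ "min d (1 - x)"]) auto
    next
      case False
      then have x1: "2 - x \<in> {0<..1}" "2 - x \<in> {0..1}" and e: "\<Omega> x = real j * pi - \<rho>2 (2 - x)" using x \<Omega>2[of x] by auto
      have z1: "cos (\<rho>2 (2 - x)) = 0" using z e cosj by simp
      obtain d where d: "d > 0" "\<And>r. r \<in> {0..1} \<Longrightarrow> 2 - x - d < r \<Longrightarrow> r < 2 - x \<Longrightarrow> \<rho>2 r < \<rho>2 (2 - x)"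
        by (rule phase_angle_crossing[OF a2 x1(1) z1 d2[OF x1(2)]]) (rule that)
      have "\<Omega> x < \<Omega> y" if "y \<in> {0..2}" "x < y" "y < x + d" for y
        using d(2)[of "2 - y"] that \<Omega>2[of y] e False by simp
      then show ?thesis using d(1) by blast
    qed
    obtain dl where dl: "dl > 0" "\<forall>y\<in>{0..2}. x - dl < y \<and> y < x \<longrightarrow> \<Omega> y < \<Omega> x" using L by blast
    obtain dr where dr: "dr > 0" "\<forall>y\<in>{0..2}. x < y \<and> y < x + dr \<longrightarrow> \<Omega> x < \<Omega> y" using R by blast
    show ?thesis using dl dr by (intro exI[of _ "min dl dr"]) auto
  qed
  have "\<Omega> 0 = 0" "\<Omega> 2 = real j * pi" using c1(2) c2(2) by (auto simp: \<Omega>_def)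
  then have count: "finite {x\<in>{0..2}. cos (\<Omega> x) = 0} \<and> card {x\<in>{0..2}. cos (\<Omega> x) = 0} = j"
    by (intro count_upward_crossings[OF cont] up) simp_all
  have y1z: "y1 r = 0 \<longleftrightarrow> cos (\<rho>1 r) = 0" if r: "r \<in> {0..1}" for r
    by (rule phase_angleE[OF a1 r]) simp
  have y2z: "y2 r = 0 \<longleftrightarrow> cos (\<rho>2 r) = 0" if r: "r \<in> {0..1}" for r
    by (rule phase_angleE[OF a2 r]) simp
  have "bij_betw (\<lambda>t. 1 - t) Z {x\<in>{0..2}. cos (\<Omega> x) = 0}"
  proof (rule bij_betwI[where g = "\<lambda>x. 1 - x"])
    have key: "((if 0 \<le> t then y1 (1 - t) else y2 (1 + t)) = 0) \<longleftrightarrow> cos (\<Omega> (1 - t)) = 0" if "t \<in> {-1..1}" for t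
    proof (cases "0 \<le> t")
      case True
      then show ?thesis using y1z[of "1 - t"] that by (simp add: \<Omega>_def)
    next
      case False
      then show ?thesis using y2z[of "1 + t"] that cosj by (simp add: \<Omega>_def)
    qed
    show "(\<lambda>t. 1 - t) \<in> Z \<rightarrow> {x\<in>{0..2}. cos (\<Omega> x) = 0}"
    proof
      fix t assume "t \<in> Z"
      then show "1 - t \<in> {x\<in>{0..2}. cos (\<Omega> x) = 0}" using key[of t] by (simp add: Z_def)
    qed
    show "(\<lambda>x. 1 - x) \<in> {x\<in>{0..2}. cos (\<Omega> x) = 0} \<rightarrow> Z"
    proof
      fix x assume "x \<in> {x\<in>{0..2}. cos (\<Omega> x) = 0}"
      then show "1 - x \<in> Z" using key[of "1 - x"] by (simp add: Z_def)
    qed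
  qed auto
  from bij_betw_finite[OF this] bij_betw_same_card[OF this] count show ?thesis by simp
qed

section \<open>Nodal solutions on the sphere\<close>

lemma axial_solution_cong:
  assumes "axial_solution N f y y'" "\<And>r. r \<in> {0<..1} \<Longrightarrow> f (y r) = h (y r)"
  shows "axial_solution N h y y'"
  using assms unfolding axial_solution_def by auto

lemma inner_pole: "\<theta> \<bullet> ((0, 1) :: (real ^ 'n) \<times> real) = snd \<theta>"
  by (cases \<theta>) simp

lemma axis_group_height:
  assumes "T \<in> axis_group"
  shows "snd (T \<theta>) = snd \<theta>"
proof -
  have T: "T v \<bullet> T w = v \<bullet> w" "T (0, 1) = (0, 1)" for v w
    using assms unfolding axis_group_def orthogonal_transformation_def by blast+
  have "snd (T \<theta>) = T \<theta> \<bullet> T (0, 1)" unfolding T(2) by (rule inner_pole[symmetric])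
  also have "\<dots> = snd \<theta>" unfolding T(1) by (rule inner_pole)
  finally show ?thesis .
qed

lemma sphere_of_height:
  assumes "t \<in> {-1..1}"
  obtains \<theta> :: "(real ^ 'n) \<times> real" where "\<theta> \<in> sphere 0 1" "snd \<theta> = t"
proof -
  have "t\<^sup>2 \<le> 1" using assms by (simp add: abs_square_le_1 abs_le_iff)
  then have "(sqrt (1 - t\<^sup>2) *\<^sub>R axis undefined 1, t) \<in> sphere (0 :: (real ^ 'n) \<times> real) 1"
    by (simp add: norm_Pair)
  then show ?thesis using that by fastforce
qed

lemma nodal_set_profile:
  assumes "v \<in> nodal_set \<alpha> k"
  obtains w where "\<And>\<theta>. \<theta> \<in> sphere 0 1 \<Longrightarrow> v \<theta> = w (snd \<theta>)"
    "finite {t \<in> {-1..1}. w t = 0}" "card {t \<in> {-1..1}. w t = 0} = k"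
  using assms unfolding nodal_set_def by blast

lemma nodal_sets_disjoint:
  fixes v v' :: "(real ^ 'n) \<times> real \<Rightarrow> real"
  assumes "v \<in> nodal_set \<alpha> i" "v' \<in> nodal_set \<alpha> j" "\<And>\<theta>. \<theta> \<in> sphere 0 1 \<Longrightarrow> v \<theta> = v' \<theta>"
  shows "i = j"
proof -
  obtain w where w: "\<And>\<theta>. \<theta> \<in> sphere 0 1 \<Longrightarrow> v \<theta> = w (snd \<theta>)" "card {t \<in> {-1..1}. w t = 0} = i"
    using nodal_set_profile[OF assms(1)] by metis
  obtain w' where w': "\<And>\<theta>. \<theta> \<in> sphere 0 1 \<Longrightarrow> v' \<theta> = w' (snd \<theta>)" "card {t \<in> {-1..1}. w' t = 0} = j"
    using nodal_set_profile[OF assms(2)] by metis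
  have "w t = w' t" if t: "t \<in> {-1..1}" for t
  proof -
    obtain \<theta> :: "(real ^ 'n) \<times> real" where "\<theta> \<in> sphere 0 1" "snd \<theta> = t" using sphere_of_height[OF t] .
    then show ?thesis using w(1) w'(1) assms(3) by metis
  qed
  then have "{t \<in> {-1..1}. w t = 0} = {t \<in> {-1..1}. w' t = 0}" by auto
  then show ?thesis using w(2) w'(2) by simp
qed

lemma nodal_set_not_constant:
  fixes v :: "(real ^ 'n) \<times> real \<Rightarrow> real"
  assumes v: "v \<in> nodal_set \<alpha> k" and k: "k \<ge> 1"
  shows "\<not> v constant_on sphere 0 1"
proof
  assume "v constant_on sphere 0 1"
  then obtain q where q: "\<And>\<theta>. \<theta> \<in> sphere 0 1 \<Longrightarrow> v \<theta> = q" unfolding constant_on_def by blast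
  obtain w where w: "\<And>\<theta>. \<theta> \<in> sphere 0 1 \<Longrightarrow> v \<theta> = w (snd \<theta>)"
    "finite {t \<in> {-1..1}. w t = 0}" "card {t \<in> {-1..1}. w t = 0} = k"
    by (rule nodal_set_profile[OF v]) (rule that)
  have "w t = q" if t: "t \<in> {-1..1}" for t
  proof -
    obtain \<theta> :: "(real ^ 'n) \<times> real" where "\<theta> \<in> sphere 0 1" "snd \<theta> = t" using sphere_of_height[OF t] .
    then show ?thesis using w(1) q by metis
  qed
  then have Z: "{t \<in> {-1..1}. w t = 0} = (if q = 0 then {-1..1} else {})" by auto
  show False
  proof (cases "q = 0")
    case True
    then have "finite {-1..1::real}" using w(2) unfolding Z by simp
    then show False using infinite_Icc[of "-1" "1::real"] by simp
  next
    case False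
    then show False using w(3) k unfolding Z by simp
  qed
qed

text \<open>
  The two branches are placed on the hemispheres.  As values agree and slopes are opposite on the equator, the
  profile \<open>W\<close> is continuously differentiable, and by the equation itself its second derivatives agree there too.
\<close>

lemma nodal_solution:
  fixes N j :: nat and p \<alpha> lam :: real
  assumes card: "CARD('n::finite) = N" and N: "N \<ge> 2" and p: "1 < p"
    and sub: "(real N - 2) * (p + 1) < 2 * real N"
    and \<alpha>: "0 < \<alpha>" "\<alpha> < 1" and j: "j \<ge> 1" and nu: "nu N j < (p - 1) * lam"
  shows "\<exists>v :: (real ^ 'n) \<times> real \<Rightarrow> real.
    (\<forall>\<theta>\<in>sphere 0 1. - sphere_laplacian v \<theta> = v \<theta> powr p - lam * v \<theta> \<and> v \<theta> > 0) \<and>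
    (\<lambda>\<theta>. v \<theta> - lam powr (1 / (p - 1))) \<in> nodal_set \<alpha> j"
proof -
  define c where "c = lam powr (1 / (p - 1))"
  have "0 \<le> nu N j" using N by (simp add: nu_def)
  then have "0 < (p - 1) * lam" using nu by simp
  then have lam: "lam > 0" using p by (simp add: zero_less_mult_iff)
  interpret sc: subcritical N p lam "lam * c"
    by unfold_locales (use N p lam sub in \<open>auto simp: c_def\<close>)
  obtain B0 where B0: "\<forall>B\<ge>B0. \<forall>f y y'. (\<forall>w. 0 < w \<and> w \<le> B \<longrightarrow> f w = w powr p - lam * w) \<longrightarrow>
    (\<forall>w\<ge>B. 0 \<le> f w) \<longrightarrow> (\<forall>w. - (lam * c) \<le> f w) \<longrightarrow>
    axial_solution N f y y' \<longrightarrow> y 0 = B \<longrightarrow> (\<exists>r\<in>{0..1}. y r \<le> 0)"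
    using sc.reaches_zero by (rule exE)
  define B where "B = max B0 (c + 1)"
  have cB: "c < B" "B0 \<le> B" by (auto simp: B_def)
  interpret nl: nonlinearity p lam B c
    by unfold_locales (use p lam c_def cB in auto)
  obtain F where F: "\<And>w. (F has_real_derivative nl.f w) (at w)" "F 0 = 0"
    by (rule nl.f_antiderivative) (rule that)
  have hits: "\<exists>r\<in>{0..1}. y r \<le> 0" if "axial_solution N nl.f y y'" "y 0 = B" for y y'
  proof (rule B0[rule_format, OF cB(2) _ _ nl.f_ge that])
    show "nl.f w = w powr p - lam * w" if "0 < w \<and> w \<le> B" for w
      using that by (simp add: nl.f_eq_g nl.g_def)
    show "0 \<le> nl.f w" if "B \<le> w" for w
      using nl.f_pos[of w] that cB by simp
  qed
  interpret sh: shooting N nl.f F c "(p - 1) * lam" "p * B powr (p - 1) + lam" B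
    by unfold_locales
      (rule N nl.c_pos cB nl.f_lipschitz F nl.f_nonpos nl.f_neg nl.f_c nl.f_pos nl.f_deriv_c hits | assumption)+
  obtain a b \<phi>a \<phi>a' \<phi>b \<phi>b' \<rho>a \<rho>b where
    bra: "sh.branch a \<phi>a \<phi>a' \<rho>a" and brb: "sh.branch b \<phi>b \<phi>b' \<rho>b" and sum: "\<rho>a 1 + \<rho>b 1 = real j * pi"
    and meet: "a * \<phi>a 1 = b * \<phi>b 1" "a * \<phi>a' 1 = - (b * \<phi>b' 1)"
    by (rule sh.matched_branches[OF nu j]) (rule that)
  have regular: "\<exists>y2 L. (\<forall>r\<in>{0..1}. ((\<lambda>r. e * \<phi>' r) has_real_derivative y2 r) (at r within {0..1})) \<and>
      (\<forall>r\<in>{0..1}. r * (2 - r) * y2 r + real N * (1 - r) * (e * \<phi>' r) + nl.g (c + e * \<phi> r) = 0) \<and>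
      (\<forall>r\<in>{0..1}. \<forall>s\<in>{0..1}. \<bar>y2 r - y2 s\<bar> \<le> L * \<bar>r - s\<bar>)"
    if br: "sh.branch e \<phi> \<phi>' \<rho>" for e \<phi> \<phi>' \<rho>
  proof -
    have sol: "axial_solution N nl.f (\<lambda>r. c + e * \<phi> r) (\<lambda>r. e * \<phi>' r)"
      and range: "\<And>r. r \<in> {0..1} \<Longrightarrow> 0 < c + e * \<phi> r \<and> c + e * \<phi> r \<le> B"
      using br unfolding sh.branch_def by auto
    have solg: "axial_solution N nl.g (\<lambda>r. c + e * \<phi> r) (\<lambda>r. e * \<phi>' r)"
    proof (rule axial_solution_cong[OF sol])
      fix r :: real assume "r \<in> {0<..1}"
      then show "nl.f (c + e * \<phi> r) = nl.g (c + e * \<phi> r)"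
        using range[of r] by (intro nl.f_eq_g) auto
    qed
    note S = axial_solutionD[OF solg]
    obtain y2 L where "\<And>r. r \<in> {0..1} \<Longrightarrow> ((\<lambda>r. e * \<phi>' r) has_real_derivative y2 r) (at r within {0..1})"
      "\<And>r. r \<in> {0..1} \<Longrightarrow> r * (2 - r) * y2 r + real N * (1 - r) * (e * \<phi>' r) + nl.g (c + e * \<phi> r) = 0"
      "\<And>r s. r \<in> {0..1} \<Longrightarrow> s \<in> {0..1} \<Longrightarrow> \<bar>y2 r - y2 s\<bar> \<le> L * \<bar>r - s\<bar>"
    proof (rule axial_solution_regular[OF N solg])
      show "(nl.g has_real_derivative p * (c + e * \<phi> r) powr (p - 1) - lam) (at (c + e * \<phi> r))" if "r \<in> {0..1}" for r
        using range[OF that] by (intro nl.g_deriv) auto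
      show "((\<lambda>w. p * w powr (p - 1) - lam) has_real_derivative p * ((p - 1) * (c + e * \<phi> r) powr (p - 2)))
          (at (c + e * \<phi> r))" if "r \<in> {0..1}" for r
        using range[OF that] by (intro nl.g'_deriv) auto
      show "continuous_on {0..1} (\<lambda>r. p * ((p - 1) * (c + e * \<phi> r) powr (p - 2)))"
        by (intro continuous_on_mult continuous_on_const continuous_on_powr S(2)) (use range in force)
    qed (rule that)
    then show ?thesis by blast
  qed
  obtain a2 La where a2: "\<And>r. r \<in> {0..1} \<Longrightarrow> ((\<lambda>r. a * \<phi>a' r) has_real_derivative a2 r) (at r within {0..1})"
    "\<And>r. r \<in> {0..1} \<Longrightarrow> r * (2 - r) * a2 r + real N * (1 - r) * (a * \<phi>a' r) + nl.g (c + a * \<phi>a r) = 0"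
    "\<And>r s. r \<in> {0..1} \<Longrightarrow> s \<in> {0..1} \<Longrightarrow> \<bar>a2 r - a2 s\<bar> \<le> La * \<bar>r - s\<bar>"
    using regular[OF bra] by blast
  obtain b2 Lb where b2: "\<And>r. r \<in> {0..1} \<Longrightarrow> ((\<lambda>r. b * \<phi>b' r) has_real_derivative b2 r) (at r within {0..1})"
    "\<And>r. r \<in> {0..1} \<Longrightarrow> r * (2 - r) * b2 r + real N * (1 - r) * (b * \<phi>b' r) + nl.g (c + b * \<phi>b r) = 0"
    "\<And>r s. r \<in> {0..1} \<Longrightarrow> s \<in> {0..1} \<Longrightarrow> \<bar>b2 r - b2 s\<bar> \<le> Lb * \<bar>r - s\<bar>"
    using regular[OF brb] by blast
  have ang: "phase_angle \<phi>a \<phi>a' \<rho>a" "phase_angle \<phi>b \<phi>b' \<rho>b"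
    and der: "\<And>r. r \<in> {0..1} \<Longrightarrow> (\<phi>a has_real_derivative \<phi>a' r) (at r within {0..1})"
      "\<And>r. r \<in> {0..1} \<Longrightarrow> (\<phi>b has_real_derivative \<phi>b' r) (at r within {0..1})"
    and range: "\<And>r. r \<in> {0..1} \<Longrightarrow> 0 < c + a * \<phi>a r" "\<And>r. r \<in> {0..1} \<Longrightarrow> 0 < c + b * \<phi>b r"
    and nz: "a \<noteq> 0" "b \<noteq> 0"
    using bra brb unfolding sh.branch_def by auto
  have yder: "((\<lambda>r. k + a * \<phi>a r) has_real_derivative a * \<phi>a' r) (at r within {0..1})"
    "((\<lambda>r. k + b * \<phi>b r) has_real_derivative b * \<phi>b' r) (at r within {0..1})" if "r \<in> {0..1}" for k r
    using DERIV_add[OF DERIV_const DERIV_cmult[OF der(1)[OF that]]]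
      DERIV_add[OF DERIV_const DERIV_cmult[OF der(2)[OF that]]] by simp_all
  define W where "W = (\<lambda>k t. if 0 \<le> t then k + a * \<phi>a (1 - t) else k + b * \<phi>b (1 + t))"
  define W1 where "W1 = (\<lambda>t. if 0 \<le> t then - (a * \<phi>a' (1 - t)) else b * \<phi>b' (1 + t))"
  define W2 where "W2 = (\<lambda>t. if 0 \<le> t then a2 (1 - t) else b2 (1 + t))"
  have eq2: "a2 1 = b2 1" using a2(2)[of 1] b2(2)[of 1] meet(1) by simp
  have Wd: "(W k has_real_derivative W1 t) (at t within {-1..1})" if "t \<in> {-1..1}" for k t
    unfolding W_def W1_def
  proof (rule glue_has_derivative[OF _ _ _ _ that])
    show "((\<lambda>t. k + a * \<phi>a (1 - t)) has_real_derivative - (a * \<phi>a' (1 - t))) (at t within {0..1})"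
      if "t \<in> {0..1}" for t
      by (rule deriv_north[where y = "\<lambda>r. k + a * \<phi>a r" and y' = "\<lambda>r. a * \<phi>a' r", OF yder(1) that])
    show "((\<lambda>t. k + b * \<phi>b (1 + t)) has_real_derivative b * \<phi>b' (1 + t)) (at t within {-1..0})"
      if "t \<in> {-1..0}" for t
      by (rule deriv_south[where y = "\<lambda>r. k + b * \<phi>b r" and y' = "\<lambda>r. b * \<phi>b' r", OF yder(2) that])
  qed (use meet in auto)
  have W1d: "(W1 has_real_derivative W2 t) (at t within {-1..1})" if "t \<in> {-1..1}" for t
    unfolding W1_def W2_def
  proof (rule glue_has_derivative[OF _ _ _ _ that])
    show "((\<lambda>t. - (a * \<phi>a' (1 - t))) has_real_derivative a2 (1 - t)) (at t within {0..1})"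
      if "t \<in> {0..1}" for t
      using DERIV_minus[OF deriv_north[where y = "\<lambda>r. a * \<phi>a' r" and y' = a2, OF a2(1) that]] by simp
    show "((\<lambda>t. b * \<phi>b' (1 + t)) has_real_derivative b2 (1 + t)) (at t within {-1..0})"
      if "t \<in> {-1..0}" for t
      by (rule deriv_south[where y = "\<lambda>r. b * \<phi>b' r" and y' = b2, OF b2(1) that])
  qed (use meet eq2 in auto)
  have W2_lip: "\<bar>W2 s - W2 t\<bar> \<le> (\<bar>La\<bar> + \<bar>Lb\<bar>) * \<bar>s - t\<bar>" if "s \<in> {-1..1}" "t \<in> {-1..1}" for s t
    unfolding W2_def by (rule glue_lipschitz[OF a2(3) b2(3) eq2 that])
  have W_ode: "(1 - t\<^sup>2) * W2 t - real N * t * W1 t = - nl.g (W c t)" if t: "t \<in> {-1..1}" for t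
  proof (cases "0 \<le> t")
    case True
    then show ?thesis using a2(2)[of "1 - t"] t
      by (simp add: W_def W1_def W2_def power2_eq_square algebra_simps)
  next
    case False
    then show ?thesis using b2(2)[of "1 + t"] t
      by (simp add: W_def W1_def W2_def power2_eq_square algebra_simps)
  qed
  have W_pos: "W c t > 0" if "t \<in> {-1..1}" for t
    using range(1)[of "1 - t"] range(2)[of "1 + t"] that by (auto simp: W_def)
  let ?e = "(0, 1) :: (real ^ 'n) \<times> real"
  have prof: "axial_profile ?e (W k) W1 W2" for k
    by unfold_locales (use Wd W1d in \<open>auto simp: norm_Pair\<close>)
  define v where "v = (\<lambda>\<theta> :: (real ^ 'n) \<times> real. W c (\<theta> \<bullet> ?e))"
  have "- sphere_laplacian v \<theta> = v \<theta> powr p - lam * v \<theta> \<and> v \<theta> > 0" if \<theta>: "\<theta> \<in> sphere 0 1" for \<theta>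
  proof -
    have t: "\<theta> \<bullet> ?e \<in> {-1..1}" by (rule axial_profile.height_in_interval[OF prof \<theta>])
    have "real DIM((real ^ 'n) \<times> real) - 1 = real N" by (simp add: card)
    then show ?thesis
      unfolding v_def axial_profile.laplacian_axial[OF prof \<theta>] using W_ode[OF t] W_pos[OF t]
      by (simp add: nl.g_def)
  qed
  moreover have "(\<lambda>\<theta>. v \<theta> - c) \<in> nodal_set \<alpha> j"
  proof -
    have W0: "W c t - c = W 0 t" for t by (simp add: W_def)
    have vW: "(\<lambda>\<theta>. v \<theta> - c) = (\<lambda>\<theta>. W 0 (\<theta> \<bullet> ?e))" by (simp add: v_def W0)
    have "(\<lambda>\<theta>. W 0 (\<theta> \<bullet> ?e)) \<in> sphere_C2_holder_inv \<alpha>"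
      unfolding sphere_C2_holder_inv_def
      using axial_profile.axial_C2_holder[OF prof W2_lip \<alpha>, of 0]
      by (simp add: inner_pole axis_group_height)
    moreover have zeros: "{t \<in> {-1..1}. W 0 t = 0} = {t \<in> {-1..1}. (if 0 \<le> t then \<phi>a (1 - t) else \<phi>b (1 + t)) = 0}"
      using nz by (auto simp: W_def)
    have "finite {t \<in> {-1..1}. W 0 t = 0}" "card {t \<in> {-1..1}. W 0 t = 0} = j"
      unfolding zeros using glued_zero_count[OF ang der sum] by auto
    moreover have "t \<in> {-1<..<1} \<and> (\<exists>d. d \<noteq> 0 \<and> (W 0 has_real_derivative d) (at t))"
      if t: "t \<in> {-1..1}" and z: "W 0 t = 0" for t
    proof -
      have simple: "r \<noteq> 0 \<and> \<phi>' r \<noteq> 0" if an: "phase_angle \<phi> \<phi>' \<rho>" and r: "r \<in> {0..1}" and z: "\<phi> r = 0" for \<phi> \<phi>' \<rho> r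
      proof -
        obtain R where R: "R > 0" "\<phi> r = R * cos (\<rho> r)" "- Q r * \<phi>' r = R * sin (\<rho> r)"
          by (rule phase_angleE[OF an r]) (rule that)
        have cs: "cos (\<rho> r) = 0" using R z by simp
        then have "sin (\<rho> r) \<noteq> 0" using sin_zero_norm_cos_one[of "\<rho> r"] by auto
        moreover have "\<rho> 0 = 0" using an by (simp add: phase_angle_def)
        ultimately show ?thesis using R cs by auto
      qed
      have "t \<noteq> 1 \<and> t \<noteq> -1 \<and> W1 t \<noteq> 0"
      proof (cases "0 \<le> t")
        case True
        then have "\<phi>a (1 - t) = 0" using z nz by (simp add: W_def)
        from simple[OF ang(1) _ this] True t nz show ?thesis by (auto simp: W1_def)
      next
        case False
        then have "\<phi>b (1 + t) = 0" using z nz by (simp add: W_def)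
        from simple[OF ang(2) _ this] False t nz show ?thesis by (auto simp: W1_def)
      qed
      then have "t \<in> {-1<..<1}" "W1 t \<noteq> 0" using t by auto
      moreover from this have "(W 0 has_real_derivative W1 t) (at t)"
        using Wd[OF t, of 0] by (simp add: at_within_Icc_at)
      ultimately show ?thesis by blast
    qed
    ultimately show ?thesis
      unfolding vW nodal_set_def by (auto simp: inner_pole intro!: exI[of _ "W 0"])
  qed
  ultimately show ?thesis unfolding c_def by blast
qed

theorem theorem1p3:
  fixes N k :: nat and p \<alpha> lam :: real
  assumes "CARD('n::finite) = N" and "N \<ge> 2"
    and "1 < p" and "ereal p < crit_exponent N"
    and "0 < \<alpha>" and "\<alpha> < 1"
    and "k \<ge> 1"
    and "lambda_crit N p k < lam" and "lam \<le> lambda_crit N p (k + 1)"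
  shows "\<exists>v :: nat \<Rightarrow> (real ^ 'n) \<times> real \<Rightarrow> real.
      (\<forall>j\<in>{1..k}.
         (\<forall>\<theta>\<in>sphere 0 1.
            - sphere_laplacian (v j) \<theta> = v j \<theta> powr p - lam * v j \<theta> \<and> v j \<theta> > 0) \<and>
         \<not> v j constant_on sphere 0 1 \<and>
         (\<lambda>\<theta>. v j \<theta> - lam powr (1 / (p - 1))) \<in> nodal_set \<alpha> j) \<and>
      (\<forall>i\<in>{1..k}. \<forall>j\<in>{1..k}. i \<noteq> j \<longrightarrow> (\<exists>\<theta>\<in>sphere 0 1. v i \<theta> \<noteq> v j \<theta>))"
proof -
  have sub: "(real N - 2) * (p + 1) < 2 * real N"
  proof (cases "N = 2")
    case False
    then have "real N - 2 > 0" using assms(2) by simp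
    moreover have "p < (real N + 2) / (real N - 2)"
      using assms(4) False by (simp add: crit_exponent_def)
    ultimately have "(real N - 2) * p < real N + 2" by (simp add: field_simps)
    then show ?thesis by (simp add: algebra_simps)
  qed simp
  have nu: "nu N j < (p - 1) * lam" if "j \<in> {1..k}" for j
  proof -
    have "real j * (real j + real N - 1) \<le> real k * (real k + real N - 1)"
      using that assms(2) by (intro mult_mono) auto
    also have "\<dots> < (p - 1) * lam"
      using assms(3,8) by (simp add: lambda_crit_def nu_def field_simps)
    finally show ?thesis by (simp add: nu_def)
  qed
  have "\<forall>j\<in>{1..k}. \<exists>v :: (real ^ 'n) \<times> real \<Rightarrow> real.
    (\<forall>\<theta>\<in>sphere 0 1. - sphere_laplacian v \<theta> = v \<theta> powr p - lam * v \<theta> \<and> v \<theta> > 0) \<and>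
    (\<lambda>\<theta>. v \<theta> - lam powr (1 / (p - 1))) \<in> nodal_set \<alpha> j"
    using nodal_solution[OF assms(1,2,3) sub assms(5,6) _ nu] by simp
  from bchoice[OF this] obtain v :: "nat \<Rightarrow> (real ^ 'n) \<times> real \<Rightarrow> real" where
    v: "\<And>j \<theta>. j \<in> {1..k} \<Longrightarrow> \<theta> \<in> sphere 0 1 \<Longrightarrow>
        - sphere_laplacian (v j) \<theta> = v j \<theta> powr p - lam * v j \<theta> \<and> v j \<theta> > 0"
      "\<And>j. j \<in> {1..k} \<Longrightarrow> (\<lambda>\<theta>. v j \<theta> - lam powr (1 / (p - 1))) \<in> nodal_set \<alpha> j"
    by blast
  have "\<not> v j constant_on sphere 0 1" if j: "j \<in> {1..k}" for j
  proof
    assume "v j constant_on sphere 0 1"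
    then have "(\<lambda>\<theta>. v j \<theta> - lam powr (1 / (p - 1))) constant_on sphere 0 1"
      unfolding constant_on_def by auto
    then show False using nodal_set_not_constant[OF v(2)[OF j]] j by simp
  qed
  moreover have "\<exists>\<theta>\<in>sphere 0 1. v i \<theta> \<noteq> v j \<theta>" if "i \<in> {1..k}" "j \<in> {1..k}" "i \<noteq> j" for i j
    using nodal_sets_disjoint[OF v(2)[OF that(1)] v(2)[OF that(2)]] that(3) by force
  ultimately show ?thesis using v by (intro exI[of _ v]) blast
qed

end
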